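(* Let $Q\in\mathcal Q_\psi$ be a fixed privacy mechanism. Suppose that $\chi(P_{VX})$ has efficient influence function $\varphi\in\overline{\mathrm{lin}}\,\mathcal T_{VX}$ at $P_{VX}$ in some model $\mathcal P_{VX}\subset\mathcal P_{\mathfrak V\mathfrak X}$ with tangent set $\mathcal T_{VX}$. (a) If $\varphi\in Q_{\mathcal X}Q_{\mathcal X}^*\mathcal T_{VX}$, then the efficient influence function of $\psi(P_{VZ})$ at $P_{VZ}$ in the model $\mathcal P_{VZ}(Q,\mathcal P_{VX})$ is $Q_{\mathcal X}^{-1}\varphi$. (b) If $\mathcal P_{VX}=\mathcal P_{\mathfrak V\mathfrak X}$ is the nonparametric model, $\chi(P_{VX})=\mathbb E f(V,X,\mu_{\mathcal X},\gamma_{\mathcal V}(c))$ is the target parameter defined in the context, and $\varphi=\tilde\chi$ with $$\tilde\chi(v,x)=r(v_1,x)\big(m(v,x)-\mu_{\mathcal X}(v_1,x)\big)+\tfrac{1\{v_2=c\}}{p_{V_2}(c)}\big(g(v,x)-\gamma_{\mathcal V}(c)\big)\mathbb E\,\partial_\gamma f(V,X,\mu_{\mathcal X},\gamma_{\mathcal V}(c))+f(v,x,\mu_{\mathcal X},\gamma_{\mathcal V}(c))-\chi(P_{VX})$$ satisfies $\tilde\chi\in L_2(P_{VX})\cap L_2(P_V\otimes\bar Q)$ (for $Q\in\mathcal Q_J^{I}$, where there is no $\bar Q$: $\tilde\chi\in L_2(P_{VX})$), then $\tilde\psi:=Q_{\mathcal X}^{-1}\tilde\chi$ is the efficient influence function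 of $\psi(P_{VZ})$ at $P_{VZ}$ in the model $\mathcal P_{VZ}(Q,\mathcal P_{\mathfrak V\mathfrak X})$.
   Context: Data. $(V,X)$ has law $P_{VX}$ on a measurable space $\mathfrak V\times\mathfrak X$, $\mathfrak V$ a product space; $\mathcal P_{\mathfrak V\mathfrak X}$ is the set of all probability laws on $\mathfrak V\times\mathfrak X$. $P h=\int h\,dP$; $L_2^0(P)$ is the mean-zero part of $L_2(P)$. Mechanisms. A (local noninteractive) privacy mechanism is a Markov kernel $Q(B\mid x)$ from $\mathfrak X$ to a measurable space $\mathfrak Z$; given $(V,X)$, $Z\sim Q(\cdot\mid X)$, so $(V,Z)$ has law $P_{VZ}(B_v,B_z)=\int_{B_v}\int_{\mathfrak X}Q(B_z\mid x)\,dP_{VX}(v,x)$. For a set $\mathcal P$ of laws on $\mathfrak V\times\mathfrak X$, $\mathcal P_{VZ}(Q,\mathcal P)$ is the set of laws of $(V,Z)$ so obtained as the law of $(V,X)$ ranges over $\mathcal P$. $Q$ is known. Class $\mathcal Q_J^I$: here $\mathfrak X=\{x_1,\dots,x_J\}$, $\mathfrak Z=\{z_1,\dots,z_J\}$ are finite, $P_{VX}$ has a density w.r.t. $\nu_V\times$counting measure, and the $J\times J$ matrix (also denoted $Q$) with $(j,k)$ entry $Q(\{z_j\}\mid x_k)$ is invertible. Class $\mathcal Q_\delta$: here $\mathfrak Z=\mathfrak X$ and $Q(B\mid x)=\alpha\delta_x(B)+(1-\alpha)\bar Q(B)$ for some $\alpha\in(0,1)$ and some probability measure $\bar Q$ on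 $\mathfrak X$. $\mathcal Q_\psi=\mathcal Q_J^I\cup\mathcal Q_\delta$. For $Q\in\mathcal Q_\psi$ there is a map $L_Q$ with $P_{VX}=L_Q(P_{VZ})$ for all $P_{VX}$ in the model, and $\psi:=\chi\circ L_Q$, so $\psi(P_{VZ})=\chi(P_{VX})$. Operators. $Q_{\mathcal X}:L_2(P_{VZ})\to L_2(P_{VX})$, $(Q_{\mathcal X}k)(v,x)=\int k(v,z)Q(dz\mid x)$, with adjoint $(Q_{\mathcal X}^*h)(v,z)=\mathbb E[h(V,X)\mid V=v,Z=z]$. For $Q\in\mathcal Q_J^I$: $((Q_{\mathcal X}^{-1}h)(v,z_j))_{j}=(Q^{\top})^{-1}(h(v,x_j))_{j}$. For $Q\in\mathcal Q_\delta$: $Q_{\mathcal X}^{-1}:L_2(P_{VX})\cap L_2(P_V\otimes\bar Q)\to L_2(P_{VZ})$, $(Q_{\mathcal X}^{-1}h)(v,z)=\frac1\alpha h(v,z)-\frac{1-\alpha}\alpha\int h(v,x)\bar Q(dx)$. Semiparametrics. A regular submodel of a model $\mathcal P$ at $P$ is a map $t\mapsto P_t\in\mathcal P$, $P_0=P$, differentiable in quadratic mean at $t=0$ with score $s\in L_2^0(P)$; the tangent set $\mathcal T$ at $P$ is the set of scores of the submodels considered ($\mathcal T_{VX}=L_2^0(P_{VX})$ for the nonparametric model). The tangent set of $\mathcal P_{VZ}(Q,\mathcal P_{VX})$ at $P_{VZ}$ is that generated by the submodels $P_{VZ,t}=\int Q(\cdot\mid x)\,dP_{VX,t}$ induced by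 the submodels $P_{VX,t}$ generating $\mathcal T_{VX}$. The efficient influence function of a functional $\chi$ at $P$ is the element $\tilde\chi$ of $\overline{\mathrm{lin}}\,\mathcal T$ (closure in $L_2(P)$ of the linear span) with $\frac{d}{dt}|_{t=0}\chi(P_t)=P[\tilde\chi s]$ for all such submodels with score $s\in\mathcal T$. Target parameter in (b). $V_1,V_2$ are collections of coordinates of $V$ with values in $\mathcal V_1$ and the finite set $\mathcal V_2$; $v_1,v_2$ are the corresponding coordinates of $v$. For given $m,g:\mathfrak V\times\mathfrak X\to\mathbb R$, $\mu_{\mathcal X}(v_1,x)=\mathbb E[m(V,X)\mid V_1=v_1,X=x]\in L_2(P_{V_1X})$ and $\gamma_{\mathcal V}(v_2)=\mathbb E[g(V,X)\mid V_2=v_2]$; $c\in\mathcal V_2$ is fixed, $p_{V_2}(c)=\mathbb P(V_2=c)>0$. $\Gamma\subset\mathbb R$ contains the range of $g$ and $\gamma_{\mathcal V}(c)$; $f:\mathfrak V\times\mathfrak X\times L_2(P_{V_1X})\times\Gamma\to\mathbb R$ satisfies: for all $\gamma$, $\mu\mapsto\mathbb E f(V,X,\mu,\gamma)$ is $L_2(P_{VX})$-continuous and $\mu\mapsto f(V,X,\mu,\gamma)$ is a.s. linear; for all $\mu$, $\gamma\mapsto f(V,X,\mu,\gamma)$ is a.s. twice continuously differentiable with derivatives $\partial_\gamma f,\partial_\gamma^2f$. Integrability: $\mathbb E f(V,X,\mu_{\mathcal X},\gamma_{\mathcal V}(c))^2<\infty$, $\mathbb E1\{V_2=c\}g(V,X)^2<\infty$,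 $\mathbb E[m(V,X)^2\mid V_1,X]<\infty$ a.s. $r\in L_2(P_{V_1X})$ is the unique function with $\mathbb E f(V,X,\mu,\gamma_{\mathcal V}(c))=\mathbb E\,r(V_1,X)\mu(V_1,X)$ for all $\mu\in L_2(P_{V_1X})$. If $V_2$ is empty, $\frac{1\{v_2=c\}}{p_{V_2}(c)}(g-\gamma_{\mathcal V}(c))$ means $g-\mathbb E g(V,X)$.
   Formalization: (b) also assumes Q_X^{-1} respects P_VX-a.e. equality (else false, e.g. X=V a.s.) and, for Q_J^I, that Q_X^{-1}χ̃ lies in L2(P_VZ); in (a), φ in Q_XQ_X^*T means equality also (P_V⊗Q̄)-a.e., resp. (P_V⊗counting)-a.e. *)

theory Defs
  imports
    "HOL-Probability.Probability"
    "Jordan_Normal_Form.Gauss_Jordan_Elimination"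
begin

text \<open>Elements of \<open>L\<^sub>2(P)\<close> are represented by functions; equality in \<open>L\<^sub>2(P)\<close> is equality \<open>P\<close>-almost
  everywhere.\<close>

definition L2 :: "'a measure \<Rightarrow> ('a \<Rightarrow> real) set" where
  "L2 P = {h \<in> borel_measurable P. integrable P (\<lambda>w. (h w)\<^sup>2)}"

definition L2_0 :: "'a measure \<Rightarrow> ('a \<Rightarrow> real) set" where
  "L2_0 P = {h \<in> L2 P. (\<integral>w. h w \<partial>P) = 0}"

definition lin_span :: "('a \<Rightarrow> real) set \<Rightarrow> ('a \<Rightarrow> real) set" where
  "lin_span T = {h. \<exists>F a. finite F \<and> F \<subseteq> T \<and> h = (\<lambda>w. \<Sum>s\<in>F. a s * s w)}"

definition closed_lin_span :: "'a measure \<Rightarrow> ('a \<Rightarrow> real) set \<Rightarrow> ('a \<Rightarrow> real) set" where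
  "closed_lin_span P T =
     {h \<in> L2 P. \<forall>\<epsilon>>0. \<exists>k\<in>lin_span T. k \<in> L2 P \<and> (\<integral>w. (h w - k w)\<^sup>2 \<partial>P) < \<epsilon>}"

text \<open>\<open>k\<close> is a version of \<open>y \<mapsto> E[h | Y = y]\<close>, where \<open>Y\<close> is a random variable on \<open>P\<close> with values in
  \<open>N\<close>. Since \<^const>\<open>real_cond_exp\<close> treats positive and negative parts separately, this is meaningful
  as soon as \<open>E[\<bar>h\<bar> | Y]\<close> is almost surely finite.\<close>

definition cond_exp_version ::
    "'a measure \<Rightarrow> 'b measure \<Rightarrow> ('a \<Rightarrow> 'b) \<Rightarrow> ('a \<Rightarrow> real) \<Rightarrow> ('b \<Rightarrow> real) \<Rightarrow> bool" where
  "cond_exp_version P N Y h k \<longleftrightarrow>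
     k \<in> borel_measurable N \<and>
     (AE w in P. k (Y w) = real_cond_exp P (vimage_algebra (space P) Y N) h w)"

definition midpoint_measure :: "'a measure \<Rightarrow> 'a measure \<Rightarrow> 'a measure" where
  "midpoint_measure P P' =
     measure_of (space P) (sets P) (\<lambda>A. (emeasure P A + emeasure P' A) / 2)"

definition root_density :: "'a measure \<Rightarrow> 'a measure \<Rightarrow> 'a \<Rightarrow> real" where
  "root_density M P w = sqrt (enn2real (RN_deriv M P w))"

text \<open>Differentiability in quadratic mean of \<open>t \<mapsto> p t\<close> at \<open>t = 0\<close>, where \<open>p 0 = P\<close>:
  \<open>\<integral> ((dP\<^sub>t\<^sup>1\<^sup>/\<^sup>2 - dP\<^sup>1\<^sup>/\<^sup>2) / t - s dP\<^sup>1\<^sup>/\<^sup>2 / 2)\<^sup>2 \<rightarrow> 0\<close>. The integral does not depend on the measure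
  dominating \<open>P\<close> and \<open>P\<^sub>t\<close> with respect to which the densities are taken; \<open>(P + P\<^sub>t) / 2\<close> always
  is one.\<close>

definition dqm :: "'a measure \<Rightarrow> (real \<Rightarrow> 'a measure) \<Rightarrow> ('a \<Rightarrow> real) \<Rightarrow> bool" where
  "dqm P p s \<longleftrightarrow>
     s \<in> L2_0 P \<and>
     ((\<lambda>t. \<integral>\<^sup>+w. ennreal
          (((root_density (midpoint_measure P (p t)) (p t) w
             - root_density (midpoint_measure P (p t)) P w) / t
            - s w / 2 * root_density (midpoint_measure P (p t)) P w)\<^sup>2)
        \<partial>midpoint_measure P (p t)) \<longlongrightarrow> 0) (at 0)"

definition regular_submodel ::
    "'a measure set \<Rightarrow> 'a measure \<Rightarrow> (real \<Rightarrow> 'a measure) \<Rightarrow> bool" where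
  "regular_submodel \<M> P p \<longleftrightarrow>
     p 0 = P \<and> (\<exists>\<epsilon>>0. \<forall>t. \<bar>t\<bar> < \<epsilon> \<longrightarrow> p t \<in> \<M>) \<and> (\<exists>s. dqm P p s)"

text \<open>\<open>S\<close> is the collection of regular submodels under consideration.\<close>

definition tangent_set :: "'a measure \<Rightarrow> (real \<Rightarrow> 'a measure) set \<Rightarrow> ('a \<Rightarrow> real) set" where
  "tangent_set P S = {s. \<exists>p\<in>S. dqm P p s}"

text \<open>The efficient influence function is unique up to \<open>P\<close>-null sets, so it is described by a
  predicate on its representatives.\<close>

definition efficient_influence_function ::
    "'a measure set \<Rightarrow> (real \<Rightarrow> 'a measure) set \<Rightarrow> 'a measure \<Rightarrow> ('a measure \<Rightarrow> real) \<Rightarrow>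
     ('a \<Rightarrow> real) \<Rightarrow> bool" where
  "efficient_influence_function \<M> S P \<kappa> \<phi> \<longleftrightarrow>
     (\<forall>p\<in>S. regular_submodel \<M> P p) \<and>
     \<phi> \<in> closed_lin_span P (tangent_set P S) \<and>
     (\<forall>p\<in>S. \<forall>s. dqm P p s \<longrightarrow>
        ((\<lambda>t. \<kappa> (p t)) has_real_derivative (\<integral>w. \<phi> w * s w \<partial>P)) (at 0))"

text \<open>On a finite discrete space of values of \<open>X\<close>, every law of \<open>(V, X)\<close> has a density with respect
  to \<open>P\<^sub>V \<otimes> counting measure\<close>, so requiring a density with respect to some \<open>\<nu>\<^sub>V \<otimes> counting measure\<close>
  is no restriction.\<close>

lemma finite_X_has_density:
  assumes P: "P \<in> space (prob_algebra (MV \<Otimes>\<^sub>M MX))"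
    and fin: "finite (space MX)" "sets MX = Pow (space MX)"
  shows "\<exists>p\<in>borel_measurable (distr P MV fst \<Otimes>\<^sub>M count_space (space MX)).
           P = density (distr P MV fst \<Otimes>\<^sub>M count_space (space MX)) p"
proof -
  let ?PV = "distr P MV fst" and ?C = "count_space (space MX)"
  let ?N = "?PV \<Otimes>\<^sub>M ?C"
  have "prob_space P" and sP: "sets P = sets (MV \<Otimes>\<^sub>M MX)"
    using P by (auto simp: space_prob_algebra)
  then interpret P: prob_space P by simp
  have fst_m: "fst \<in> P \<rightarrow>\<^sub>M MV"
    using measurable_fst[of MV MX] measurable_cong_sets[OF sP refl] by blast
  interpret PV: prob_space ?PV by (rule P.prob_space_distr[OF fst_m])
  interpret C: sigma_finite_measure ?C
    using fin(1) by (simp add: sigma_finite_measure_count_space_finite)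
  interpret N: pair_sigma_finite ?PV ?C by unfold_locales
  have sX: "sets ?C = sets MX" using fin(2) by simp
  have sN: "sets ?N = sets P"
    unfolding sP by (rule sets_pair_measure_cong) (simp_all add: fin(2))
  have spP: "space P = space MV \<times> space MX"
    using sets_eq_imp_space_eq[OF sP] by (simp add: space_pair_measure)
  have "absolutely_continuous ?N P"
    unfolding absolutely_continuous_def
  proof
    fix A assume A: "A \<in> null_sets ?N"
    then have AN: "A \<in> sets ?N" and "emeasure ?N A = 0" by auto
    have AP: "A \<in> sets P" using AN sN by simp
    have "(\<integral>\<^sup>+x. emeasure ?PV ((\<lambda>v. (v, x)) -` A) \<partial>?C) = 0"
      using N.emeasure_pair_measure_alt2[OF AN] \<open>emeasure ?N A = 0\<close> by simp
    then have zero: "emeasure ?PV ((\<lambda>v. (v, x)) -` A) = 0" if "x \<in> space MX" for x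
      using that fin(1) by (simp add: nn_integral_count_space_finite)
    have sec: "(\<lambda>v. (v, x)) -` A \<in> sets MV" if "x \<in> space MX" for x
      using sets_Pair2[OF AN, of x] by simp
    have "A \<subseteq> (\<Union>x\<in>space MX. fst -` ((\<lambda>v. (v, x)) -` A) \<inter> space P)"
      using sets.sets_into_space[OF AP] spP by auto
    moreover have "(\<Union>x\<in>space MX. fst -` ((\<lambda>v. (v, x)) -` A) \<inter> space P) \<in> null_sets P"
    proof (rule null_sets.finite_UN[OF fin(1)])
      fix x assume x: "x \<in> space MX"
      show "fst -` ((\<lambda>v. (v, x)) -` A) \<inter> space P \<in> null_sets P"
        using zero[OF x] sec[OF x] fst_m by (auto simp: null_sets_def emeasure_distr)
    qed
    ultimately show "A \<in> null_sets P" using AP by (rule null_sets_subset[rotated -1])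
  qed
  then have "density ?N (RN_deriv ?N P) = P"
    using sN by (intro N.density_RN_deriv) simp_all
  then show ?thesis by (metis borel_measurable_RN_deriv)
qed

text \<open>A mechanism is a Markov kernel \<open>Q \<in> MX \<rightarrow>\<^sub>M prob_algebra MZ\<close>. The measurable spaces of \<open>X\<close> and
  \<open>Z\<close> live on one HOL type, which is only an ambient universe, so that both classes of mechanisms
  below can be formed over the same data.\<close>

definition law_VXZ ::
    "'v measure \<Rightarrow> 'x measure \<Rightarrow> 'x measure \<Rightarrow> ('x \<Rightarrow> 'x measure) \<Rightarrow> ('v \<times> 'x) measure \<Rightarrow>
     ('v \<times> 'x \<times> 'x) measure" where
  "law_VXZ MV MX MZ Q P =
     P \<bind> (\<lambda>(v, x). Q x \<bind> (\<lambda>z. return (MV \<Otimes>\<^sub>M MX \<Otimes>\<^sub>M MZ) (v, x, z)))"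

definition law_VZ ::
    "'v measure \<Rightarrow> 'x measure \<Rightarrow> ('x \<Rightarrow> 'x measure) \<Rightarrow> ('v \<times> 'x) measure \<Rightarrow> ('v \<times> 'x) measure" where
  "law_VZ MV MZ Q P = P \<bind> (\<lambda>(v, x). Q x \<bind> (\<lambda>z. return (MV \<Otimes>\<^sub>M MZ) (v, z)))"

definition mech_matrix ::
    "nat \<Rightarrow> (nat \<Rightarrow> 'x) \<Rightarrow> (nat \<Rightarrow> 'x) \<Rightarrow> ('x \<Rightarrow> 'x measure) \<Rightarrow> real Matrix.mat" where
  "mech_matrix J x z Q = Matrix.mat J J (\<lambda>(j, k). measure (Q (x k)) {z j})"

text \<open>The data entering the formula for the inverse operator: the enumerations of two finite spaces
  of cardinality \<open>J\<close>, or the mixing weight \<open>\<alpha>\<close> and the noise distribution.\<close>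

datatype 'x presentation =
    Finite nat "nat \<Rightarrow> 'x" "nat \<Rightarrow> 'x"
  | Mixture real "'x measure"

fun presents ::
    "'x measure \<Rightarrow> 'x measure \<Rightarrow> ('x \<Rightarrow> 'x measure) \<Rightarrow> 'x presentation \<Rightarrow> bool" where
  "presents MX MZ Q (Finite J x z) \<longleftrightarrow>
     Q \<in> MX \<rightarrow>\<^sub>M prob_algebra MZ \<and>
     bij_betw x {..<J} (space MX) \<and> sets MX = Pow (space MX) \<and>
     bij_betw z {..<J} (space MZ) \<and> sets MZ = Pow (space MZ) \<and>
     invertible_mat (mech_matrix J x z Q)"
| "presents MX MZ Q (Mixture \<alpha> Qbar) \<longleftrightarrow>
     Q \<in> MX \<rightarrow>\<^sub>M prob_algebra MZ \<and>
     sets MZ = sets MX \<and> 0 < \<alpha> \<and> \<alpha> < 1 \<and> Qbar \<in> space (prob_algebra MX) \<and>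
     (\<forall>x\<in>space MX. \<forall>B\<in>sets MX.
        measure (Q x) B = \<alpha> * measure (return MX x) B + (1 - \<alpha>) * measure Qbar B)"

definition mech_J :: "'x measure \<Rightarrow> 'x measure \<Rightarrow> ('x \<Rightarrow> 'x measure) set" where
  "mech_J MX MZ = {Q. \<exists>J x z. presents MX MZ Q (Finite J x z)}"

definition mech_delta :: "'x measure \<Rightarrow> 'x measure \<Rightarrow> ('x \<Rightarrow> 'x measure) set" where
  "mech_delta MX MZ = {Q. \<exists>\<alpha> Qbar. presents MX MZ Q (Mixture \<alpha> Qbar)}"

definition mech_psi :: "'x measure \<Rightarrow> 'x measure \<Rightarrow> ('x \<Rightarrow> 'x measure) set" where
  "mech_psi MX MZ = mech_J MX MZ \<union> mech_delta MX MZ"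

text \<open>\<open>\<psi> = \<kappa> \<circ> L\<^sub>Q\<close>, where \<open>L\<^sub>Q\<close> recovers a law of the model \<open>\<M>\<close> from the law of \<open>(V, Z)\<close>.\<close>

definition psi ::
    "'v measure \<Rightarrow> 'x measure \<Rightarrow> ('x \<Rightarrow> 'x measure) \<Rightarrow> ('v \<times> 'x) measure set \<Rightarrow>
     (('v \<times> 'x) measure \<Rightarrow> real) \<Rightarrow> ('v \<times> 'x) measure \<Rightarrow> real" where
  "psi MV MZ Q \<M> \<kappa> = \<kappa> \<circ> inv_into \<M> (law_VZ MV MZ Q)"

definition induced_submodels ::
    "'v measure \<Rightarrow> 'x measure \<Rightarrow> ('x \<Rightarrow> 'x measure) \<Rightarrow> (real \<Rightarrow> ('v \<times> 'x) measure) set \<Rightarrow>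
     (real \<Rightarrow> ('v \<times> 'x) measure) set" where
  "induced_submodels MV MZ Q S = (\<lambda>p t. law_VZ MV MZ Q (p t)) ` S"

definition Q_op :: "('x \<Rightarrow> 'x measure) \<Rightarrow> ('v \<times> 'x \<Rightarrow> real) \<Rightarrow> 'v \<times> 'x \<Rightarrow> real" where
  "Q_op Q k = (\<lambda>(v, x). \<integral>z. k (v, z) \<partial>Q x)"

text \<open>The set of versions of \<open>(v, z) \<mapsto> E[h(V, X) | V = v, Z = z]\<close>.\<close>

definition Q_adj ::
    "'v measure \<Rightarrow> 'x measure \<Rightarrow> 'x measure \<Rightarrow> ('x \<Rightarrow> 'x measure) \<Rightarrow> ('v \<times> 'x) measure \<Rightarrow>
     ('v \<times> 'x \<Rightarrow> real) \<Rightarrow> ('v \<times> 'x \<Rightarrow> real) set" where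
  "Q_adj MV MX MZ Q P h =
     {k. cond_exp_version (law_VXZ MV MX MZ Q P) (MV \<Otimes>\<^sub>M MZ) (\<lambda>(v, x, z). (v, z))
           (\<lambda>(v, x, z). h (v, x)) k}"

fun Q_inv ::
    "('x \<Rightarrow> 'x measure) \<Rightarrow> 'x presentation \<Rightarrow> ('v \<times> 'x \<Rightarrow> real) \<Rightarrow> 'v \<times> 'x \<Rightarrow> real" where
  "Q_inv Q (Finite J x z) h = (\<lambda>(v, y).
     \<Sum>k<J. the (mat_inverse (transpose_mat (mech_matrix J x z Q)))
              $$ (the_inv_into {..<J} z y, k) * h (v, x k))"
| "Q_inv Q (Mixture \<alpha> Qbar) h = (\<lambda>(v, z).
     1 / \<alpha> * h (v, z) - (1 - \<alpha>) / \<alpha> * (\<integral>x. h (v, x) \<partial>Qbar))"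

text \<open>The functions to which the inverse operator applies. In the finite case the inverse is in
  general unbounded: \<open>P(X = x\<^sub>k | V = v)\<close> need not be bounded away from \<open>0\<close>, and then it does not map
  all of \<open>L\<^sub>2(P\<^sub>V\<^sub>X)\<close> to \<open>L\<^sub>2(P\<^sub>V\<^sub>Z)\<close>. In the mixture case the values are in \<open>L\<^sub>2(P\<^sub>V\<^sub>Z)\<close>
  automatically.\<close>

fun inv_domain ::
    "'v measure \<Rightarrow> 'x measure \<Rightarrow> ('x \<Rightarrow> 'x measure) \<Rightarrow> ('v \<times> 'x) measure \<Rightarrow> 'x presentation \<Rightarrow>
     ('v \<times> 'x \<Rightarrow> real) set" where
  "inv_domain MV MZ Q P (Finite J x z) =
     {h \<in> L2 P. Q_inv Q (Finite J x z) h \<in> L2 (law_VZ MV MZ Q P)}"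
| "inv_domain MV MZ Q P (Mixture \<alpha> Qbar) = L2 P \<inter> L2 (distr P MV fst \<Otimes>\<^sub>M Qbar)"

text \<open>Identification of functions to which the inverse operator is applied. The formulas for the
  inverse involve \<open>h(v, x)\<close> for points \<open>(v, x)\<close> that \<open>P\<close> may not charge (in the finite case, for every
  \<open>x\<close>), hence equality \<open>P\<close>-almost everywhere does not determine the image.\<close>

fun inv_equal ::
    "'v measure \<Rightarrow> 'x measure \<Rightarrow> ('v \<times> 'x) measure \<Rightarrow> 'x presentation \<Rightarrow>
     ('v \<times> 'x \<Rightarrow> real) \<Rightarrow> ('v \<times> 'x \<Rightarrow> real) \<Rightarrow> bool" where
  "inv_equal MV MX P (Finite J x z) h h' \<longleftrightarrow>
     (AE w in distr P MV fst \<Otimes>\<^sub>M count_space (space MX). h w = h' w)"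
| "inv_equal MV MX P (Mixture \<alpha> Qbar) h h' \<longleftrightarrow>
     (AE w in P. h w = h' w) \<and> (AE w in distr P MV fst \<Otimes>\<^sub>M Qbar. h w = h' w)"

text \<open>The set \<open>Q\<^sub>X Q\<^sub>X\<^sup>* T\<close>, with functions identified as in \<^const>\<open>inv_equal\<close>.\<close>

definition Q_op_adj_image ::
    "'v measure \<Rightarrow> 'x measure \<Rightarrow> 'x measure \<Rightarrow> ('x \<Rightarrow> 'x measure) \<Rightarrow> ('v \<times> 'x) measure \<Rightarrow>
     'x presentation \<Rightarrow> ('v \<times> 'x \<Rightarrow> real) set \<Rightarrow> ('v \<times> 'x \<Rightarrow> real) set" where
  "Q_op_adj_image MV MX MZ Q P R T =
     {h. \<exists>s\<in>T. \<exists>k\<in>Q_adj MV MX MZ Q P s. inv_equal MV MX P R h (Q_op Q k)}"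

text \<open>The inverse operator acts on elements of \<open>L\<^sub>2(P\<^sub>V\<^sub>X)\<close>, rather than on functions: by linearity,
  it respects equality almost everywhere if it respects equality to \<open>0\<close>. In the mixture case this
  amounts to \<open>P\<^sub>V \<otimes> Qbar\<close> being absolutely continuous with respect to \<open>P\<^sub>V\<^sub>X\<close>.\<close>

definition inv_respects_AE ::
    "'v measure \<Rightarrow> 'x measure \<Rightarrow> ('x \<Rightarrow> 'x measure) \<Rightarrow> ('v \<times> 'x) measure \<Rightarrow> 'x presentation \<Rightarrow>
     bool" where
  "inv_respects_AE MV MZ Q P R \<longleftrightarrow>
     (\<forall>h\<in>inv_domain MV MZ Q P R.
        (AE w in P. h w = 0) \<longrightarrow> (AE w in law_VZ MV MZ Q P. Q_inv Q R h w = 0))"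

text \<open>\<open>V\<close> takes values in the product of the spaces \<open>MV i\<close>, \<open>i \<in> I\<close>; \<open>V\<^sub>1\<close> and \<open>V\<^sub>2\<close> are its
  restrictions to \<open>I1\<close> and \<open>I2\<close>. For \<open>I2 = {}\<close> the event \<open>V\<^sub>2 = c\<close> is the whole space, so that empty
  \<open>V\<^sub>2\<close> needs no separate treatment.\<close>

definition V1X :: "'i set \<Rightarrow> ('i \<Rightarrow> 'v) \<times> 'x \<Rightarrow> ('i \<Rightarrow> 'v) \<times> 'x" where
  "V1X I1 = (\<lambda>(v, x). (restrict v I1, x))"

definition V2_event :: "'i set \<Rightarrow> ('i \<Rightarrow> 'v) \<Rightarrow> (('i \<Rightarrow> 'v) \<times> 'x) set" where
  "V2_event I2 c = {(v, x). restrict v I2 = c}"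

definition prob_V2 :: "'i set \<Rightarrow> ('i \<Rightarrow> 'v) \<Rightarrow> (('i \<Rightarrow> 'v) \<times> 'x) measure \<Rightarrow> real" where
  "prob_V2 I2 c P = measure P (V2_event I2 c \<inter> space P)"

definition law_V1X ::
    "'i set \<Rightarrow> ('i \<Rightarrow> 'v measure) \<Rightarrow> 'x measure \<Rightarrow> (('i \<Rightarrow> 'v) \<times> 'x) measure \<Rightarrow>
     (('i \<Rightarrow> 'v) \<times> 'x) measure" where
  "law_V1X I1 MV MX P = distr P (PiM I1 MV \<Otimes>\<^sub>M MX) (V1X I1)"

text \<open>\<open>E[g(V, X) | V\<^sub>2 = c]\<close>, for \<open>P(V\<^sub>2 = c) > 0\<close>.\<close>

definition gamma_V ::
    "'i set \<Rightarrow> (('i \<Rightarrow> 'v) \<times> 'x \<Rightarrow> real) \<Rightarrow> (('i \<Rightarrow> 'v) \<times> 'x) measure \<Rightarrow> ('i \<Rightarrow> 'v) \<Rightarrow> real" where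
  "gamma_V I2 g P c = (\<integral>w. indicator (V2_event I2 c) w * g w \<partial>P) / prob_V2 I2 c P"

locale target_parameter =
  fixes I :: "'i set" and MV :: "'i \<Rightarrow> 'v measure" and MX :: "'x measure"
    and P :: "(('i \<Rightarrow> 'v) \<times> 'x) measure"
    and I1 I2 :: "'i set" and c :: "'i \<Rightarrow> 'v"
    and m g :: "('i \<Rightarrow> 'v) \<times> 'x \<Rightarrow> real"
    and \<mu>X :: "('i \<Rightarrow> 'v) \<times> 'x \<Rightarrow> real"
    and \<Gamma> :: "real set"
    and f f' f'' :: "('i \<Rightarrow> 'v) \<times> 'x \<Rightarrow> (('i \<Rightarrow> 'v) \<times> 'x \<Rightarrow> real) \<Rightarrow> real \<Rightarrow> real"
    and r :: "('i \<Rightarrow> 'v) \<times> 'x \<Rightarrow> real"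
  assumes P_law: "P \<in> space (prob_algebra (PiM I MV \<Otimes>\<^sub>M MX))"
    and coordinates: "I1 \<subseteq> I" "I2 \<subseteq> I"
    and V2_finite: "finite (space (PiM I2 MV))" "sets (PiM I2 MV) = Pow (space (PiM I2 MV))"
    and c_value: "c \<in> space (PiM I2 MV)" "prob_V2 I2 c P > 0"
    and m_g_measurable:
      "m \<in> borel_measurable (PiM I MV \<Otimes>\<^sub>M MX)" "g \<in> borel_measurable (PiM I MV \<Otimes>\<^sub>M MX)"
    and \<mu>X_cond_exp: "cond_exp_version P (PiM I1 MV \<Otimes>\<^sub>M MX) (V1X I1) m \<mu>X"
    and \<mu>X_L2: "\<mu>X \<in> L2 (law_V1X I1 MV MX P)"
    and \<Gamma>_range: "g ` space (PiM I MV \<Otimes>\<^sub>M MX) \<subseteq> \<Gamma>" "gamma_V I2 g P c \<in> \<Gamma>"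
    and f_class: \<comment> \<open>the third argument of \<open>f\<close> is an element of \<open>L\<^sub>2\<close>\<close>
      "\<And>\<gamma> \<mu> \<mu>'. \<gamma> \<in> \<Gamma> \<Longrightarrow> \<mu> \<in> L2 (law_V1X I1 MV MX P) \<Longrightarrow> \<mu>' \<in> L2 (law_V1X I1 MV MX P) \<Longrightarrow>
         (AE w in law_V1X I1 MV MX P. \<mu> w = \<mu>' w) \<Longrightarrow> (AE w in P. f w \<mu> \<gamma> = f w \<mu>' \<gamma>)"
    and f_integrable:
      "\<And>\<gamma> \<mu>. \<gamma> \<in> \<Gamma> \<Longrightarrow> \<mu> \<in> L2 (law_V1X I1 MV MX P) \<Longrightarrow> integrable P (\<lambda>w. f w \<mu> \<gamma>)"
    and f_continuous:
      "\<And>\<gamma> \<mu>. \<gamma> \<in> \<Gamma> \<Longrightarrow> \<mu> \<in> L2 (law_V1X I1 MV MX P) \<Longrightarrow>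
         \<forall>\<epsilon>>0. \<exists>\<delta>>0. \<forall>\<mu>'\<in>L2 (law_V1X I1 MV MX P).
           (\<integral>w. (\<mu>' w - \<mu> w)\<^sup>2 \<partial>law_V1X I1 MV MX P) < \<delta> \<longrightarrow>
           \<bar>(\<integral>w. f w \<mu>' \<gamma> \<partial>P) - (\<integral>w. f w \<mu> \<gamma> \<partial>P)\<bar> < \<epsilon>"
    and f_linear:
      "\<And>\<gamma> \<mu> \<mu>' a b. \<gamma> \<in> \<Gamma> \<Longrightarrow> \<mu> \<in> L2 (law_V1X I1 MV MX P) \<Longrightarrow> \<mu>' \<in> L2 (law_V1X I1 MV MX P) \<Longrightarrow>
         (AE w in P. f w (\<lambda>u. a * \<mu> u + b * \<mu>' u) \<gamma> = a * f w \<mu> \<gamma> + b * f w \<mu>' \<gamma>)"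
    and f_C2:
      "\<And>\<mu>. \<mu> \<in> L2 (law_V1X I1 MV MX P) \<Longrightarrow>
         (AE w in P. (\<forall>\<gamma>\<in>\<Gamma>. (f w \<mu> has_real_derivative f' w \<mu> \<gamma>) (at \<gamma> within \<Gamma>)) \<and>
                     (\<forall>\<gamma>\<in>\<Gamma>. (f' w \<mu> has_real_derivative f'' w \<mu> \<gamma>) (at \<gamma> within \<Gamma>)) \<and>
                     continuous_on \<Gamma> (f'' w \<mu>))"
    and f_L2: "integrable P (\<lambda>w. (f w \<mu>X (gamma_V I2 g P c))\<^sup>2)"
    and g_L2: "integrable P (\<lambda>w. indicator (V2_event I2 c) w * (g w)\<^sup>2)"
    and m_cond_L2:
      "AE w in P. nn_cond_exp P (vimage_algebra (space P) (V1X I1) (PiM I1 MV \<Otimes>\<^sub>M MX))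
                    (\<lambda>w. ennreal ((m w)\<^sup>2)) w < \<infinity>"
    and r_L2: "r \<in> L2 (law_V1X I1 MV MX P)"
    and r_represents:
      "\<And>\<mu>. \<mu> \<in> L2 (law_V1X I1 MV MX P) \<Longrightarrow>
         (\<integral>w. f w \<mu> (gamma_V I2 g P c) \<partial>P) = (\<integral>w. r (V1X I1 w) * \<mu> (V1X I1 w) \<partial>P)"

text \<open>The argument \<open>\<mu>X\<close> selects for every law \<open>P\<close> a version of \<open>E\<^sub>P[m(V, X) | V\<^sub>1, X]\<close>.\<close>

definition target_functional ::
    "'i set \<Rightarrow> ('i \<Rightarrow> 'v) \<Rightarrow> (('i \<Rightarrow> 'v) \<times> 'x \<Rightarrow> real) \<Rightarrow>
     ((('i \<Rightarrow> 'v) \<times> 'x) measure \<Rightarrow> ('i \<Rightarrow> 'v) \<times> 'x \<Rightarrow> real) \<Rightarrow>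
     (('i \<Rightarrow> 'v) \<times> 'x \<Rightarrow> (('i \<Rightarrow> 'v) \<times> 'x \<Rightarrow> real) \<Rightarrow> real \<Rightarrow> real) \<Rightarrow>
     (('i \<Rightarrow> 'v) \<times> 'x) measure \<Rightarrow> real" where
  "target_functional I2 c g \<mu>X f P = (\<integral>w. f w (\<mu>X P) (gamma_V I2 g P c) \<partial>P)"

definition chi_tilde ::
    "(('i \<Rightarrow> 'v) \<times> 'x) measure \<Rightarrow> 'i set \<Rightarrow> 'i set \<Rightarrow> ('i \<Rightarrow> 'v) \<Rightarrow>
     (('i \<Rightarrow> 'v) \<times> 'x \<Rightarrow> real) \<Rightarrow> (('i \<Rightarrow> 'v) \<times> 'x \<Rightarrow> real) \<Rightarrow>
     ((('i \<Rightarrow> 'v) \<times> 'x) measure \<Rightarrow> ('i \<Rightarrow> 'v) \<times> 'x \<Rightarrow> real) \<Rightarrow>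
     (('i \<Rightarrow> 'v) \<times> 'x \<Rightarrow> (('i \<Rightarrow> 'v) \<times> 'x \<Rightarrow> real) \<Rightarrow> real \<Rightarrow> real) \<Rightarrow>
     (('i \<Rightarrow> 'v) \<times> 'x \<Rightarrow> (('i \<Rightarrow> 'v) \<times> 'x \<Rightarrow> real) \<Rightarrow> real \<Rightarrow> real) \<Rightarrow>
     (('i \<Rightarrow> 'v) \<times> 'x \<Rightarrow> real) \<Rightarrow> ('i \<Rightarrow> 'v) \<times> 'x \<Rightarrow> real" where
  "chi_tilde P I1 I2 c m g \<mu>X f f' r w =
     r (V1X I1 w) * (m w - \<mu>X P (V1X I1 w))
     + indicator (V2_event I2 c) w / prob_V2 I2 c P * (g w - gamma_V I2 g P c)
       * (\<integral>w. f' w (\<mu>X P) (gamma_V I2 g P c) \<partial>P)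
     + f w (\<mu>X P) (gamma_V I2 g P c)
     - target_functional I2 c g \<mu>X f P"

end

theory Submission
  imports Defs
begin

text \<open>Both classes of mechanisms give a Markov kernel \<open>K\<close> from \<open>(v, x)\<close> to \<open>(v, z)\<close> with
  \<open>P\<^sub>V\<^sub>Z = P \<bind> K\<close>. Along such a kernel, differentiability in quadratic mean is inherited, the new
  score being the image of the old one under the adjoint of \<open>f \<mapsto> \<integral> f dK\<close>: the Hellinger distance
  contracts, so it suffices to treat the path with root densities \<open>dP\<^sup>1\<^sup>/\<^sup>2(1 + ts/2)\<close>, whose image
  is explicit. If \<open>\<phi> = \<integral> k dK\<close>, the adjoint identity turns \<open>\<integral> \<phi> s dP\<close> into the inner product of
  \<open>k\<close> with the new score, so \<open>k\<close> is a gradient, and \<open>Q_inv \<phi>\<close> is such a \<open>k\<close>. In part (a) it is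
  itself a score. In part (b) it lies in the closure of the scores because the range of the adjoint
  is dense in the orthogonal complement of the kernel of \<open>f \<mapsto> \<integral> f dK\<close>, which is trivial.\<close>

section \<open>Square-integrable functions\<close>

text \<open>A path of laws need not be dominated by \<open>P\<close>, and taking roots of densities
  does not commute with a kernel; this is why the image of a path is never differentiated directly.
  The comparison measures have density (1 + t s/2)^2 with respect to \<open>P\<close>. This is
  quadratic in t, so the image has density 1 + t g + t^2 h/4, where g and h are the adjoint images
  of s and s^2, and the conditional Jensen inequality g^2 <= h dominates the squared remainder of
  the square root by h. The adjoint is built from Radon-Nikodym derivatives of image measures, since
  on general measurable spaces conditional laws of X given (V, Z) may fail to exist.
  \<open>Q_inv\<close> inverts \<open>Q_op\<close> only up to null sets of suitable measures: its
  formulas read values at points that \<open>P\<close> need not charge. Hence equations between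
  functions are tracked under the marginal of V times a noise or counting measure, and triviality of
  the kernel in part (b) rests on \<open>inv_respects_AE\<close>. Applied to indicators, the same
  inverse identifies the law of (V, X), so that \<open>psi\<close> recovers the original
  parameter.\<close>

lemma
  assumes "h \<in> L2 M"
  shows L2_measurable: "h \<in> borel_measurable M" and L2_integrable_sq: "integrable M (\<lambda>w. (h w)\<^sup>2)"
  using assms by (auto simp: L2_def)

lemma L2_iff_nn:
  "h \<in> L2 M \<longleftrightarrow> h \<in> borel_measurable M \<and> (\<integral>\<^sup>+w. ennreal ((h w)\<^sup>2) \<partial>M) < \<infinity>"
  by (auto simp: L2_def integrable_iff_bounded)

lemma L2_mult_integrable:
  assumes "h \<in> L2 M" "k \<in> L2 M"
  shows "integrable M (\<lambda>w. h w * k w)"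
proof (rule Bochner_Integration.integrable_bound)
  show "integrable M (\<lambda>w. (h w)\<^sup>2 + (k w)\<^sup>2)"
    using assms by (auto simp: L2_def)
  show "(\<lambda>w. h w * k w) \<in> borel_measurable M"
    using assms by (auto simp: L2_def)
  have "\<bar>a * b\<bar> \<le> a\<^sup>2 + b\<^sup>2" for a b :: real
  proof -
    have "0 \<le> \<bar>a\<bar> * \<bar>b\<bar>" by simp
    moreover have "2 * (\<bar>a\<bar> * \<bar>b\<bar>) \<le> a\<^sup>2 + b\<^sup>2"
      using sum_squares_bound[of "\<bar>a\<bar>" "\<bar>b\<bar>"] by (simp add: mult.assoc)
    ultimately show ?thesis unfolding abs_mult by linarith
  qed
  then show "AE w in M. norm (h w * k w) \<le> norm ((h w)\<^sup>2 + (k w)\<^sup>2)"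
    by (intro AE_I2) simp
qed

lemma L2_add:
  assumes "h \<in> L2 M" "k \<in> L2 M"
  shows "(\<lambda>w. h w + k w) \<in> L2 M"
  using L2_mult_integrable[OF assms] assms
  by (auto simp: L2_def power2_sum mult.assoc)

lemma L2_scale: "h \<in> L2 M \<Longrightarrow> (\<lambda>w. a * h w) \<in> L2 M"
  by (auto simp: L2_def power_mult_distrib)

lemma L2_diff:
  assumes "h \<in> L2 M" "k \<in> L2 M"
  shows "(\<lambda>w. h w - k w) \<in> L2 M"
  using L2_add[OF assms(1) L2_scale[OF assms(2), of "-1"]] by simp

lemma L2_const: "finite_measure M \<Longrightarrow> (\<lambda>_. a) \<in> L2 M"
  by (simp add: L2_def finite_measure.integrable_const)

lemma L2_integrable:
  assumes "finite_measure M" "h \<in> L2 M"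
  shows "integrable M h"
  using L2_mult_integrable[OF assms(2) L2_const[OF assms(1), of 1]] by simp

lemma L2_AE_cong:
  assumes "h \<in> L2 M" "k \<in> borel_measurable M" "AE w in M. h w = k w"
  shows "k \<in> L2 M"
proof -
  have "integrable M (\<lambda>w. (k w)\<^sup>2) \<longleftrightarrow> integrable M (\<lambda>w. (h w)\<^sup>2)"
    using assms by (intro integrable_cong_AE) (auto simp: L2_def)
  then show ?thesis using assms by (auto simp: L2_def)
qed

text \<open>The quadratic polynomial x^2 a + 2 x b + c is the integral of a square, hence
  nonnegative. Evaluated at its minimizer -b/a it gives the inequality; for a = 0 it is affine,
  which forces b = 0.\<close>

lemma L2_Cauchy_Schwarz:
  assumes "h \<in> L2 M" "k \<in> L2 M"
  shows "(\<integral>w. h w * k w \<partial>M)\<^sup>2 \<le> (\<integral>w. (h w)\<^sup>2 \<partial>M) * (\<integral>w. (k w)\<^sup>2 \<partial>M)"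
proof -
  let ?a = "\<integral>w. (h w)\<^sup>2 \<partial>M" and ?b = "\<integral>w. h w * k w \<partial>M" and ?c = "\<integral>w. (k w)\<^sup>2 \<partial>M"
  have q: "0 \<le> x\<^sup>2 * ?a + 2 * x * ?b + ?c" for x
  proof -
    have i: "integrable M (\<lambda>w. (h w)\<^sup>2)" "integrable M (\<lambda>w. (k w)\<^sup>2)" "integrable M (\<lambda>w. h w * k w)"
      using assms L2_mult_integrable[OF assms] by (auto simp: L2_def)
    have "0 \<le> (\<integral>w. (x * h w + k w)\<^sup>2 \<partial>M)" by simp
    also have "\<dots> = (\<integral>w. x\<^sup>2 * (h w)\<^sup>2 + 2 * x * (h w * k w) + (k w)\<^sup>2 \<partial>M)"
      by (intro Bochner_Integration.integral_cong) (auto simp: power2_eq_square algebra_simps)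
    also have "\<dots> = x\<^sup>2 * ?a + 2 * x * ?b + ?c" using i by simp
    finally show ?thesis .
  qed
  have a0: "0 \<le> ?a" "0 \<le> ?c" by simp_all
  show ?thesis
  proof (cases "?a = 0")
    case True
    have "?b = 0"
    proof (rule ccontr)
      assume "?b \<noteq> 0"
      \<comment> \<open>At this argument the affine function takes the value -1.\<close>
      then show False using q[of "-(?c + 1) / (2 * ?b)"] True a0 by (simp add: field_simps)
    qed
    then show ?thesis using True by simp
  next
    case False
    then have "0 < ?a" using a0 by linarith
    have "0 \<le> ?a * ((- ?b / ?a)\<^sup>2 * ?a + 2 * (- ?b / ?a) * ?b + ?c)"
      using q[of "- ?b / ?a"] a0 by (intro mult_nonneg_nonneg) auto
    also have "\<dots> = ?a * ?c - ?b\<^sup>2" using \<open>0 < ?a\<close> by (simp add: field_simps power2_eq_square)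
    finally show ?thesis by simp
  qed
qed

text \<open>Pointwise, the right-hand side exceeds the left-hand side by (f - 2 g + h)^2.
  Nonnegative integrals match the form of \<open>dqm\<close> and ask only for measurability.\<close>

lemma nn_integral_sq_triangle:
  fixes f g h :: "'a \<Rightarrow> real"
  assumes [measurable]: "f \<in> borel_measurable M" "g \<in> borel_measurable M" "h \<in> borel_measurable M"
  shows "(\<integral>\<^sup>+w. ennreal ((f w - h w)\<^sup>2) \<partial>M)
    \<le> 2 * (\<integral>\<^sup>+w. ennreal ((f w - g w)\<^sup>2) \<partial>M) + 2 * (\<integral>\<^sup>+w. ennreal ((g w - h w)\<^sup>2) \<partial>M)"
proof -
  have *: "(a - c)\<^sup>2 \<le> 2 * (a - b)\<^sup>2 + 2 * (b - c)\<^sup>2" for a b c :: real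
    using zero_le_power2[of "a - 2 * b + c"] by (simp add: power2_eq_square algebra_simps)
  have "(\<integral>\<^sup>+w. ennreal ((f w - h w)\<^sup>2) \<partial>M)
      \<le> (\<integral>\<^sup>+w. ennreal (2 * (f w - g w)\<^sup>2 + 2 * (g w - h w)\<^sup>2) \<partial>M)"
    by (intro nn_integral_mono ennreal_leI *)
  also have "\<dots> = (\<integral>\<^sup>+w. 2 * ennreal ((f w - g w)\<^sup>2) + 2 * ennreal ((g w - h w)\<^sup>2) \<partial>M)"
    by (intro nn_integral_cong) (simp add: ennreal_mult' ennreal_plus)
  also have "\<dots> = 2 * (\<integral>\<^sup>+w. ennreal ((f w - g w)\<^sup>2) \<partial>M) + 2 * (\<integral>\<^sup>+w. ennreal ((g w - h w)\<^sup>2) \<partial>M)"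
    by (simp add: nn_integral_add nn_integral_cmult)
  finally show ?thesis .
qed

lemma nn_integral_sq_eq: 
  assumes "h \<in> L2 M"
  shows "(\<integral>\<^sup>+w. ennreal ((h w)\<^sup>2) \<partial>M) = ennreal (\<integral>w. (h w)\<^sup>2 \<partial>M)"
  using assms by (intro nn_integral_eq_integral) (auto simp: L2_def)

section \<open>Completeness and orthogonal approximation\<close>

text \<open>Riesz-Fischer along a fast Cauchy sequence: the rate (1/4)^m makes the L1 norms of the
  increments summable like (1/2)^n, so the sequence converges almost everywhere, and Fatou's lemma
  turns the Cauchy bound into a bound on the distance to the limit.\<close>

lemma L2_complete:
  fixes r :: "nat \<Rightarrow> 'a \<Rightarrow> real"
  assumes "finite_measure M" and r: "\<And>n. r n \<in> L2 M"
    and cauchy: "\<And>m n. m \<le> n \<Longrightarrow> (\<integral>w. (r n w - r m w)\<^sup>2 \<partial>M) \<le> (1 / 4) ^ m"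
  obtains l where "l \<in> L2 M" "(\<lambda>n. \<integral>w. (r n w - l w)\<^sup>2 \<partial>M) \<longlonglongrightarrow> 0"
proof -
  interpret finite_measure M by fact
  have m[measurable]: "r n \<in> borel_measurable M" for n using r by (rule L2_measurable)
  let ?d = "\<lambda>n w. \<bar>r (Suc n) w - r n w\<bar>"
  let ?c = "sqrt (measure M (space M))"
  have dL2: "?d n \<in> L2 M" for n
    using L2_diff[OF r r, of "Suc n" n] by (simp add: L2_def)
  have bound: "(\<integral>\<^sup>+w. ennreal (?d n w) \<partial>M) \<le> ennreal (?c * (1 / 2) ^ n)" for n
  proof -
    have int: "integrable M (?d n)" by (rule L2_integrable[OF \<open>finite_measure M\<close> dL2])
    have "(\<integral>w. ?d n w * 1 \<partial>M)\<^sup>2 \<le> (\<integral>w. (?d n w)\<^sup>2 \<partial>M) * (\<integral>w. 1\<^sup>2 \<partial>M)"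
      by (rule L2_Cauchy_Schwarz[OF dL2 L2_const[OF \<open>finite_measure M\<close>]])
    also have "\<dots> \<le> (1 / 4) ^ n * measure M (space M)"
      using cauchy[of n "Suc n"] by (intro mult_mono) auto
    also have "\<dots> = (?c * (1 / 2) ^ n)\<^sup>2"
      using power_mult_distrib[of "1/2 :: real" "1/2" n] by (simp add: power2_eq_square)
    finally have "(\<integral>w. ?d n w \<partial>M)\<^sup>2 \<le> (?c * (1 / 2) ^ n)\<^sup>2" by simp
    then have "(\<integral>w. ?d n w \<partial>M) \<le> ?c * (1 / 2) ^ n"
      by (rule power2_le_imp_le) simp
    then show ?thesis using int by (simp add: nn_integral_eq_integral ennreal_leI)
  qed
  have "(\<integral>\<^sup>+w. (\<Sum>n. ennreal (?d n w)) \<partial>M) = (\<Sum>n. \<integral>\<^sup>+w. ennreal (?d n w) \<partial>M)"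
    by (rule nn_integral_suminf) measurable
  also have "\<dots> \<le> (\<Sum>n. ennreal (?c * (1 / 2) ^ n))"
    by (intro suminf_le bound) auto
  also have "\<dots> = ennreal (\<Sum>n. ?c * (1 / 2) ^ n)"
    by (intro suminf_ennreal2 summable_mult summable_geometric) auto
  also have "\<dots> < \<infinity>" by simp
  finally have "AE w in M. (\<Sum>n. ennreal (?d n w)) \<noteq> \<infinity>"
    by (intro nn_integral_noteq_infinite) auto
  then have conv: "AE w in M. convergent (\<lambda>n. r n w)"
  proof eventually_elim
    case (elim w)
    then have "summable (\<lambda>n. ?d n w)" by (intro summable_suminf_not_top) auto
    then have "summable (\<lambda>n. r (Suc n) w - r n w)" by (rule summable_rabs_cancel)
    then have "convergent (\<lambda>n. r n w - r 0 w)"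
      using summable_iff_convergent[of "\<lambda>n. r (Suc n) w - r n w"]
      by (simp add: sum_lessThan_telescope[of "\<lambda>n. r n w"])
    from convergent_add[OF this convergent_const[of "r 0 w"]] show ?case by simp
  qed
  define l where "l w = lim (\<lambda>n. r n w)" for w
  have [measurable]: "l \<in> borel_measurable M" unfolding l_def by measurable
  have lim: "AE w in M. (\<lambda>n. r n w) \<longlonglongrightarrow> l w"
    using conv by eventually_elim (simp add: l_def convergent_LIMSEQ_iff)
  have fatou: "(\<integral>\<^sup>+w. ennreal ((r m w - l w)\<^sup>2) \<partial>M) \<le> ennreal ((1 / 4) ^ m)" for m
  proof -
    have "(\<integral>\<^sup>+w. ennreal ((r m w - l w)\<^sup>2) \<partial>M)
        = (\<integral>\<^sup>+w. liminf (\<lambda>n. ennreal ((r m w - r n w)\<^sup>2)) \<partial>M)"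
    proof (rule nn_integral_cong_AE)
      show "AE w in M. ennreal ((r m w - l w)\<^sup>2) = liminf (\<lambda>n. ennreal ((r m w - r n w)\<^sup>2))"
        using lim by eventually_elim (auto intro!: lim_imp_Liminf[symmetric] tendsto_intros)
    qed
    also have "\<dots> \<le> liminf (\<lambda>n. \<integral>\<^sup>+w. ennreal ((r m w - r n w)\<^sup>2) \<partial>M)"
      by (rule nn_integral_liminf) measurable
    also have "\<dots> \<le> limsup (\<lambda>n. \<integral>\<^sup>+w. ennreal ((r m w - r n w)\<^sup>2) \<partial>M)"
      by (rule Liminf_le_Limsup) simp
    also have "\<dots> \<le> ennreal ((1 / 4) ^ m)"
    proof (rule Limsup_bounded)
      show "\<forall>\<^sub>F n in sequentially. (\<integral>\<^sup>+w. ennreal ((r m w - r n w)\<^sup>2) \<partial>M) \<le> ennreal ((1 / 4) ^ m)"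
        using eventually_ge_at_top[of m]
      proof eventually_elim
        case (elim n)
        then show ?case using cauchy[of m n]
          by (simp add: nn_integral_sq_eq[OF L2_diff[OF r r]] power2_commute ennreal_leI)
      qed
    qed
    finally show ?thesis .
  qed
  have dl: "(\<lambda>w. r n w - l w) \<in> L2 M" for n
    using fatou[of n] by (auto simp: L2_iff_nn intro: le_less_trans)
  show ?thesis
  proof
    show "l \<in> L2 M" using L2_diff[OF r[of 0] dl[of 0]] by simp
    have "(\<integral>w. (r n w - l w)\<^sup>2 \<partial>M) \<le> (1 / 4) ^ n" for n
      using fatou[of n] by (simp add: nn_integral_sq_eq[OF dl])
    then show "(\<lambda>n. \<integral>w. (r n w - l w)\<^sup>2 \<partial>M) \<longlonglongrightarrow> 0"
      by (intro tendsto_sandwich[OF _ _ tendsto_const LIMSEQ_realpow_zero[of "1/4"]]) auto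
  qed
qed

lemma L2_inner_tendsto:
  assumes r: "\<And>n. r n \<in> L2 M" and "l \<in> L2 M" "k \<in> L2 M"
    and "(\<lambda>n. \<integral>w. (r n w - l w)\<^sup>2 \<partial>M) \<longlonglongrightarrow> 0"
  shows "(\<lambda>n. \<integral>w. r n w * k w \<partial>M) \<longlonglongrightarrow> (\<integral>w. l w * k w \<partial>M)"
proof -
  have "(\<integral>w. (r n w - l w) * k w \<partial>M) = (\<integral>w. r n w * k w \<partial>M) - (\<integral>w. l w * k w \<partial>M)" for n
    using assms by (simp add: left_diff_distrib L2_mult_integrable)
  moreover have "(\<lambda>n. (\<integral>w. (r n w - l w) * k w \<partial>M)\<^sup>2) \<longlonglongrightarrow> 0"
  proof (rule tendsto_sandwich[OF _ _ tendsto_const])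
    show "\<forall>\<^sub>F n in sequentially. (\<integral>w. (r n w - l w) * k w \<partial>M)\<^sup>2
        \<le> (\<integral>w. (r n w - l w)\<^sup>2 \<partial>M) * (\<integral>w. (k w)\<^sup>2 \<partial>M)"
      using assms by (intro always_eventually allI L2_Cauchy_Schwarz L2_diff)
    show "(\<lambda>n. (\<integral>w. (r n w - l w)\<^sup>2 \<partial>M) * (\<integral>w. (k w)\<^sup>2 \<partial>M)) \<longlonglongrightarrow> 0"
      using tendsto_mult[OF assms(4) tendsto_const] by simp
  qed auto
  ultimately show ?thesis
    by (simp add: LIM_zero_iff)
qed

text \<open>The residuals of a minimizing sequence of distances to \<open>D\<close> converge to a function
  orthogonal to \<open>D\<close>.\<close>

lemma L2_closure_if_orthogonal:
  assumes fin: "finite_measure M" and D: "D \<subseteq> L2 M" "(\<lambda>_. 0) \<in> D"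
    and lin: "\<And>h k a b. h \<in> D \<Longrightarrow> k \<in> D \<Longrightarrow> (\<lambda>w. a * h w + b * k w) \<in> D"
    and x: "x \<in> L2 M"
    and orth: "\<And>r. r \<in> L2 M \<Longrightarrow> (\<And>h. h \<in> D \<Longrightarrow> (\<integral>w. r w * h w \<partial>M) = 0) \<Longrightarrow>
                 (\<integral>w. r w * x w \<partial>M) = 0"
    and "\<epsilon> > 0"
  shows "\<exists>h\<in>D. (\<integral>w. (x w - h w)\<^sup>2 \<partial>M) < \<epsilon>"
proof -
  define dist2 where "dist2 h = (\<integral>w. (x w - h w)\<^sup>2 \<partial>M)" for h
  define d where "d = Inf (dist2 ` D)"
  have bdd: "bdd_below (dist2 ` D)" by (rule bdd_belowI2[where m = 0]) (simp add: dist2_def)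
  have d_le: "d \<le> dist2 h" if "h \<in> D" for h
    unfolding d_def using that bdd by (intro cInf_lower) auto
  \<comment> \<open>The excess (1/4)^n / 4 over the infimum is what turns the parallelogram estimate
    below into the rate demanded by \<open>L2_complete\<close>.\<close>
  have ex: "\<forall>n. \<exists>h. h \<in> D \<and> dist2 h < d + (1 / 4) ^ n / 4"
  proof
    fix n :: nat
    have lt: "Inf (dist2 ` D) < d + (1 / 4) ^ n / 4" by (simp add: d_def)
    have ne: "dist2 ` D \<noteq> {}" using D(2) by auto
    from cInf_lessD[OF ne lt] show "\<exists>h. h \<in> D \<and> dist2 h < d + (1 / 4) ^ n / 4"
      by blast
  qed
  from choice[OF ex] obtain y where "\<forall>n. y n \<in> D \<and> dist2 (y n) < d + (1 / 4) ^ n / 4" ..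
  then have yD: "\<And>n. y n \<in> D" and y: "\<And>n. dist2 (y n) < d + (1 / 4) ^ n / 4"
    by simp_all
  define r where "r n w = x w - y n w" for n w
  have yL: "y n \<in> L2 M" for n using yD D by auto
  have rL: "r n \<in> L2 M" for n unfolding r_def by (intro L2_diff x yL)
  have rd: "(\<integral>w. (r n w)\<^sup>2 \<partial>M) = dist2 (y n)" for n by (simp add: r_def dist2_def)
  have cauchy: "(\<integral>w. (r n w - r m w)\<^sup>2 \<partial>M) \<le> (1 / 4) ^ m" if "m \<le> n" for m n
  proof -
    \<comment> \<open>The midpoint of two approximants lies in D, so its squared distance from x is
      at least d, and the parallelogram identity bounds the distance between the two
      residuals.\<close>
    let ?z = "\<lambda>w. 1/2 * y n w + 1/2 * y m w"
    have i: "integrable M (\<lambda>w. (r n w)\<^sup>2)" "integrable M (\<lambda>w. (r m w)\<^sup>2)"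
        "integrable M (\<lambda>w. (x w - ?z w)\<^sup>2)"
      using rL L2_diff[OF x, of ?z] lin[OF yD[of n] yD[of m], of "1/2" "1/2"] D(1)
      by (auto simp: L2_def)
    have "(\<integral>w. (r n w - r m w)\<^sup>2 \<partial>M)
        = (\<integral>w. 2 * (r n w)\<^sup>2 + 2 * (r m w)\<^sup>2 - 4 * (x w - ?z w)\<^sup>2 \<partial>M)"
      by (intro Bochner_Integration.integral_cong)
         (auto simp: r_def power2_eq_square algebra_simps)
    also have "\<dots> = 2 * dist2 (y n) + 2 * dist2 (y m) - 4 * dist2 ?z"
      using i by (simp add: rd) (simp add: dist2_def)
    also have "\<dots> \<le> 2 * (d + (1 / 4) ^ n / 4) + 2 * (d + (1 / 4) ^ m / 4) - 4 * d"
    proof -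
      have *: "2 * p + 2 * q - 4 * z \<le> 2 * (d + a / 4) + 2 * (d + b / 4) - 4 * d"
        if "p < d + a / 4" "q < d + b / 4" "d \<le> z" for p q z a b :: real
        using that by argo
      show ?thesis by (rule *[OF y y d_le[OF lin[OF yD yD]]])
    qed
    also have "\<dots> = ((1 / 4) ^ n + (1 / 4) ^ m) / 2" by simp
    also have "\<dots> \<le> (1 / 4) ^ m" using power_decreasing[OF that, of "1/4 :: real"] by simp
    finally show ?thesis .
  qed
  obtain l where l: "l \<in> L2 M" "(\<lambda>n. \<integral>w. (r n w - l w)\<^sup>2 \<partial>M) \<longlonglongrightarrow> 0"
    using L2_complete[OF fin rL cauchy] by blast
  have l_orth: "(\<integral>w. l w * h w \<partial>M) = 0" if h: "h \<in> D" for h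
  proof -
    have hL: "h \<in> L2 M" using h D by auto
    let ?H = "\<integral>w. (h w)\<^sup>2 \<partial>M"
    have *: "(\<integral>w. r n w * h w \<partial>M)\<^sup>2 \<le> (?H + 1) * ((1 / 4) ^ n / 4)" for n
    proof -
      let ?b = "\<integral>w. r n w * h w \<partial>M"
      \<comment> \<open>The coefficient that nearly minimizes the squared distance along y n + a h;
        the \<open>+ 1\<close> keeps the denominator positive when h vanishes almost
        everywhere.\<close>
      define a where "a = ?b / (?H + 1)"
      have H1: "?H + 1 > 0" by (intro add_nonneg_pos) simp_all
      have i: "integrable M (\<lambda>w. (r n w)\<^sup>2)" "integrable M (\<lambda>w. r n w * h w)" "integrable M (\<lambda>w. (h w)\<^sup>2)"
        using rL hL L2_mult_integrable[OF rL hL] by (auto simp: L2_def)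
      have "d \<le> dist2 (\<lambda>w. 1 * y n w + a * h w)" by (rule d_le[OF lin[OF yD h]])
      also have "\<dots> = (\<integral>w. (r n w)\<^sup>2 - 2 * a * (r n w * h w) + a\<^sup>2 * (h w)\<^sup>2 \<partial>M)"
        unfolding dist2_def r_def
        by (intro Bochner_Integration.integral_cong) (auto simp: power2_eq_square algebra_simps)
      also have "\<dots> = dist2 (y n) - 2 * a * ?b + a\<^sup>2 * ?H" using i by (simp add: rd)
      also have "\<dots> \<le> d + (1 / 4) ^ n / 4 - 2 * a * ?b + a\<^sup>2 * (?H + 1)"
      proof -
        have "a\<^sup>2 * ?H \<le> a\<^sup>2 * (?H + 1)" by (intro mult_left_mono) simp_all
        then show ?thesis using y[of n] by argo
      qed
      also have "\<dots> = d + (1 / 4) ^ n / 4 - ?b\<^sup>2 / (?H + 1)"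
        using H1 by (simp add: a_def power2_eq_square)
      finally have "?b\<^sup>2 / (?H + 1) \<le> (1 / 4) ^ n / 4" by simp
      then show ?thesis using H1 by (simp only: pos_divide_le_eq mult.commute)
    qed
    have "(\<lambda>n. (\<integral>w. r n w * h w \<partial>M)\<^sup>2) \<longlonglongrightarrow> 0"
    proof (rule tendsto_sandwich[OF _ _ tendsto_const])
      show "\<forall>\<^sub>F n in sequentially. (\<integral>w. r n w * h w \<partial>M)\<^sup>2 \<le> (?H + 1) * ((1 / 4) ^ n / 4)"
        using * by simp
      have "(\<lambda>n. (?H + 1) * ((1 / 4) ^ n / 4)) \<longlonglongrightarrow> (?H + 1) * (0 / 4)"
        by (intro tendsto_intros LIMSEQ_realpow_zero) auto
      then show "(\<lambda>n. (?H + 1) * ((1 / 4) ^ n / 4)) \<longlonglongrightarrow> 0" by simp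
    qed auto
    then have "(\<lambda>n. \<integral>w. r n w * h w \<partial>M) \<longlonglongrightarrow> 0" by simp
    with L2_inner_tendsto[OF rL l(1) hL l(2)] show ?thesis by (rule LIMSEQ_unique)
  qed
  have "(\<integral>w. l w * x w \<partial>M) = 0" by (rule orth[OF l(1) l_orth])
  \<comment> \<open>Since r n = x - y n, and l is orthogonal to x by \<open>orth\<close> and to y n
    in D, l is orthogonal to every r n. In the limit it is orthogonal to itself and hence
    zero.\<close>
  moreover have "(\<integral>w. r n w * l w \<partial>M) = (\<integral>w. l w * x w \<partial>M) - (\<integral>w. l w * y n w \<partial>M)" for n
    using L2_mult_integrable[OF l(1) x] L2_mult_integrable[OF l(1) yL]
    by (simp add: r_def right_diff_distrib mult.commute[of _ "l _"])
  ultimately have "(\<integral>w. r n w * l w \<partial>M) = 0" for n using l_orth[OF yD] by simp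
  then have "(\<integral>w. l w * l w \<partial>M) = 0"
    using L2_inner_tendsto[OF rL l(1) l(1) l(2)] LIMSEQ_unique[OF _ tendsto_const] by auto
  then have "AE w in M. l w = 0"
    using integral_nonneg_eq_0_iff_AE[OF L2_mult_integrable[OF l(1) l(1)]] by auto
  then have "(\<integral>w. (r n w - l w)\<^sup>2 \<partial>M) = dist2 (y n)" for n
    unfolding rd[symmetric] using rL[THEN L2_measurable] l(1)[THEN L2_measurable]
    by (intro integral_cong_AE) auto
  then have "(\<lambda>n. dist2 (y n)) \<longlonglongrightarrow> 0" using l(2) by simp
  then have "\<forall>\<^sub>F n in sequentially. dist2 (y n) < \<epsilon>" using \<open>\<epsilon> > 0\<close> by (rule order_tendstoD)
  then obtain n where "dist2 (y n) < \<epsilon>" by (metis eventually_happens sequentially_bot)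
  then show ?thesis using yD unfolding dist2_def by blast
qed

section \<open>Mixtures and densities of square roots\<close>

text \<open>Induction over nonnegative measurable functions, starting from indicators, for which the
  identity is the assumption on \<open>emeasure\<close>. It serves twice: for the midpoint measure,
  and for a channel that keeps x with probability \<alpha> and otherwise draws noise.\<close>

lemma nn_integral_mixture:
  fixes a b :: ennreal
  assumes sets: "sets P = sets M" "sets P' = sets M"
    and em: "\<And>A. A \<in> sets M \<Longrightarrow> emeasure M A = a * emeasure P A + b * emeasure P' A"
    and f: "f \<in> borel_measurable M"
  shows "(\<integral>\<^sup>+w. f w \<partial>M) = a * (\<integral>\<^sup>+w. f w \<partial>P) + b * (\<integral>\<^sup>+w. f w \<partial>P')"
proof -
  note [measurable_cong] = sets
  show ?thesis using f
  proof induct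
    case (cong f g)
    have "space P = space M" "space P' = space M" using sets[THEN sets_eq_imp_space_eq] by auto
    then show ?case
      using cong nn_integral_cong[of M f g] nn_integral_cong[of P f g] nn_integral_cong[of P' f g] by simp
  next
    case (set A)
    then show ?case using sets em by simp
  next
    case (mult u c)
    note [measurable] = mult(2)
    show ?case using mult(4)
      by (simp add: nn_integral_cmult distrib_left ac_simps)
  next
    case (add u v)
    note [measurable] = add(1,4)
    show ?case using add(3,7)
      by (simp add: nn_integral_add distrib_left ac_simps)
  next
    case (seq U)
    note [measurable] = seq(1)
    have P: "incseq (\<lambda>i. a * (\<integral>\<^sup>+w. U i w \<partial>P))" and P': "incseq (\<lambda>i. b * (\<integral>\<^sup>+w. U i w \<partial>P'))"
      using seq(4) by (auto simp: incseq_def le_fun_def intro!: nn_integral_mono mult_left_mono)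
    have "(\<integral>\<^sup>+w. (SUP i. U i) w \<partial>M) = (SUP i. \<integral>\<^sup>+w. U i w \<partial>M)"
      using seq(4) by (simp add: nn_integral_monotone_convergence_SUP image_comp)
    also have "\<dots> = (SUP i. a * (\<integral>\<^sup>+w. U i w \<partial>P) + b * (\<integral>\<^sup>+w. U i w \<partial>P'))"
      using seq(3) by simp
    also have "\<dots> = a * (SUP i. \<integral>\<^sup>+w. U i w \<partial>P) + b * (SUP i. \<integral>\<^sup>+w. U i w \<partial>P')"
      using ennreal_SUP_add[OF P P'] by (simp add: SUP_mult_left_ennreal)
    also have "\<dots> = a * (\<integral>\<^sup>+w. (SUP i. U i) w \<partial>P) + b * (\<integral>\<^sup>+w. (SUP i. U i) w \<partial>P')"
      using seq(4) by (simp add: nn_integral_monotone_convergence_SUP image_comp)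
    finally show ?case .
  qed
qed

lemma AE_mixture:
  fixes a b :: ennreal
  assumes "sets P = sets M" "sets P' = sets M"
    and em: "\<And>A. A \<in> sets M \<Longrightarrow> emeasure M A = a * emeasure P A + b * emeasure P' A"
    and "AE w in P. R w" "AE w in P'. R w"
  shows "AE w in M. R w"
proof -
  have sp: "space P = space M" "space P' = space M"
    using assms(1,2)[THEN sets_eq_imp_space_eq] by auto
  obtain A A' where A: "A \<in> null_sets P" "{w \<in> space M. \<not> R w} \<subseteq> A"
    and A': "A' \<in> null_sets P'" "{w \<in> space M. \<not> R w} \<subseteq> A'"
    using assms(4,5) unfolding eventually_ae_filter sp by auto
  have sA: "A \<in> sets M" "A' \<in> sets M"
    using null_setsD2[OF A(1)] null_setsD2[OF A'(1)] assms(1,2) by auto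
  then have s: "A \<inter> A' \<in> sets M" by auto
  \<comment> \<open>The intersection is taken because each of the two sets is known to be null only
    for its own measure.\<close>
  have "A \<inter> A' \<in> null_sets P"
    by (rule null_set_Int2[OF A(1)]) (use sA assms(1) in simp)
  moreover have "A \<inter> A' \<in> null_sets P'"
    by (rule null_set_Int1[OF A'(1)]) (use sA assms(2) in simp)
  ultimately have "emeasure M (A \<inter> A') = 0" using em[OF s] by auto
  then have "A \<inter> A' \<in> null_sets M" using s by auto
  moreover have "{w \<in> space M. \<not> R w} \<subseteq> A \<inter> A'" using A A' by auto
  ultimately show ?thesis by (rule AE_I')
qed

text \<open>Positive and negative part are nonnegative integrals, to which
  \<open>nn_integral_mixture\<close> applies; finiteness of the absolute integrals lets
  \<open>enn2real\<close> act on each summand.\<close>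

lemma integral_mixture:
  fixes f :: "'a \<Rightarrow> real" and a b :: real
  assumes sets: "sets P = sets M" "sets P' = sets M" and "0 \<le> a" "0 \<le> b"
    and em: "\<And>A. A \<in> sets M \<Longrightarrow> emeasure M A = ennreal a * emeasure P A + ennreal b * emeasure P' A"
    and i: "integrable P f" "integrable P' f"
  shows "(\<integral>w. f w \<partial>M) = a * (\<integral>w. f w \<partial>P) + b * (\<integral>w. f w \<partial>P')"
proof -
  have [measurable]: "f \<in> borel_measurable M"
    using borel_measurable_integrable[OF i(1)] by (simp cong: measurable_cong_sets add: sets)
  note nn = nn_integral_mixture[OF sets em]
  have fin: "(\<integral>\<^sup>+w. ennreal \<bar>f w\<bar> \<partial>P) < \<infinity>" "(\<integral>\<^sup>+w. ennreal \<bar>f w\<bar> \<partial>P') < \<infinity>"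
    using i by (auto simp: integrable_iff_bounded)
  then have "(\<integral>\<^sup>+w. ennreal \<bar>f w\<bar> \<partial>M) < \<infinity>"
    by (simp add: nn ennreal_mult_less_top)
  then have "integrable M f" by (simp add: integrable_iff_bounded)
  \<comment> \<open>An arbitrary g below the absolute value of f covers f and -f at once.\<close>
  moreover have e: "enn2real (\<integral>\<^sup>+w. ennreal (g w) \<partial>M)
      = a * enn2real (\<integral>\<^sup>+w. ennreal (g w) \<partial>P) + b * enn2real (\<integral>\<^sup>+w. ennreal (g w) \<partial>P')"
    if g: "\<And>w. g w \<le> \<bar>f w\<bar>" "g \<in> borel_measurable M" for g
  proof -
    have "(\<integral>\<^sup>+w. ennreal (g w) \<partial>P) < \<infinity>" "(\<integral>\<^sup>+w. ennreal (g w) \<partial>P') < \<infinity>"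
      by (rule le_less_trans[OF nn_integral_mono[OF ennreal_leI[OF g(1)]] fin(1)],
          rule le_less_trans[OF nn_integral_mono[OF ennreal_leI[OF g(1)]] fin(2)])
    then show ?thesis
      using g(2) assms(3,4) by (simp add: nn enn2real_plus enn2real_mult ennreal_mult_less_top)
  qed
  ultimately show ?thesis
    using e[of f] e[of "\<lambda>w. - f w"] i by (simp add: real_lebesgue_integral_def algebra_simps)
qed

section \<open>Midpoint measures and root densities\<close>

lemma
  shows sets_midpoint [simp]: "sets (midpoint_measure P P') = sets P"
    and space_midpoint [simp]: "space (midpoint_measure P P') = space P"
  by (simp_all add: midpoint_measure_def)

lemma emeasure_midpoint:
  assumes "sets P' = sets P" "A \<in> sets P"
  shows "emeasure (midpoint_measure P P') A = (emeasure P A + emeasure P' A) / 2"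
  unfolding midpoint_measure_def
proof (rule emeasure_measure_of_sigma)
  show "sigma_algebra (space P) (sets P)" ..
  show "positive (sets P) (\<lambda>A. (emeasure P A + emeasure P' A) / 2)"
    by (simp add: positive_def)
  show "countably_additive (sets P) (\<lambda>A. (emeasure P A + emeasure P' A) / 2)"
  proof (rule countably_additiveI)
    fix A :: "nat \<Rightarrow> 'a set"
    assume A: "range A \<subseteq> sets P" "disjoint_family A"
    have "(\<Sum>i. (emeasure P (A i) + emeasure P' (A i)) / 2)
        = (\<Sum>i. emeasure P (A i) + emeasure P' (A i)) / 2"
      by (simp add: divide_ennreal_def)
    also have "(\<Sum>i. emeasure P (A i) + emeasure P' (A i)) = (\<Sum>i. emeasure P (A i)) + (\<Sum>i. emeasure P' (A i))"
      by (intro suminf_add[symmetric]) auto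
    also have "\<dots> = emeasure P (\<Union>i. A i) + emeasure P' (\<Union>i. A i)"
      using suminf_emeasure[of A P] suminf_emeasure[of A P'] A assms(1) by simp
    finally show "(\<Sum>i. (emeasure P (A i) + emeasure P' (A i)) / 2)
        = (emeasure P (\<Union>i. A i) + emeasure P' (\<Union>i. A i)) / 2" .
  qed
qed (rule assms(2))

lemma nn_integral_midpoint:
  assumes sets: "sets P' = sets P" and f: "f \<in> borel_measurable P"
  shows "(\<integral>\<^sup>+w. f w \<partial>midpoint_measure P P') = ((\<integral>\<^sup>+w. f w \<partial>P) + (\<integral>\<^sup>+w. f w \<partial>P')) / 2"
proof -
  have "(\<integral>\<^sup>+w. f w \<partial>midpoint_measure P P') = inverse 2 * (\<integral>\<^sup>+w. f w \<partial>P) + inverse 2 * (\<integral>\<^sup>+w. f w \<partial>P')"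
    using sets f
    by (intro nn_integral_mixture)
       (simp_all add: emeasure_midpoint divide_ennreal_def distrib_left mult.commute cong: measurable_cong_sets)
  then show ?thesis by (simp add: divide_ennreal_def distrib_left mult.commute)
qed

lemma absolutely_continuous_midpoint:
  assumes "sets P' = sets P"
  shows "absolutely_continuous (midpoint_measure P P') P"
    and "absolutely_continuous (midpoint_measure P P') P'"
  using assms by (auto simp: absolutely_continuous_def null_sets_def emeasure_midpoint)

lemma prob_space_midpoint:
  assumes "sets P' = sets P" "prob_space P" "prob_space P'"
  shows "prob_space (midpoint_measure P P')"
proof (rule prob_spaceI)
  have "space P' = space P" using assms(1) by (rule sets_eq_imp_space_eq)
  then show "emeasure (midpoint_measure P P') (space (midpoint_measure P P')) = 1"
    using prob_space.emeasure_space_1[OF assms(2)] prob_space.emeasure_space_1[OF assms(3)] assms(1)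
    by (simp add: emeasure_midpoint)
qed

lemma root_density_measurable [measurable]:
  "root_density M P \<in> borel_measurable M"
  unfolding root_density_def by measurable

lemma root_density_nonneg: "0 \<le> root_density M P w"
  by (simp add: root_density_def)

text \<open>The squared root density is almost everywhere the Radon-Nikodym derivative, because the
  latter is almost everywhere finite. Root densities enter the later arguments only through this
  identity, their measurability and their sign.\<close>

lemma nn_integral_root_density:
  assumes M: "prob_space M" and P: "prob_space P" and ac: "absolutely_continuous M P" "sets P = sets M"
    and f[measurable]: "f \<in> borel_measurable M"
  shows "(\<integral>\<^sup>+w. ennreal ((root_density M P w)\<^sup>2) * f w \<partial>M) = (\<integral>\<^sup>+w. f w \<partial>P)"
proof -
  interpret M: prob_space M by fact
  interpret P: prob_space P by fact
  have "AE w in M. RN_deriv M P w \<noteq> \<infinity>"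
    by (rule M.RN_deriv_finite[OF P.sigma_finite_measure_axioms ac])
  then have "(\<integral>\<^sup>+w. ennreal ((root_density M P w)\<^sup>2) * f w \<partial>M) = (\<integral>\<^sup>+w. RN_deriv M P w * f w \<partial>M)"
    by (intro nn_integral_cong_AE) (auto simp: root_density_def less_top)
  also have "\<dots> = (\<integral>\<^sup>+w. f w \<partial>density M (RN_deriv M P))"
    by (simp add: nn_integral_density)
  also have "density M (RN_deriv M P) = P" by (rule M.density_RN_deriv[OF ac])
  finally show ?thesis .
qed

lemma nn_integral_root_density_midpoint:
  assumes P: "prob_space P" "prob_space P'" "sets P' = sets P" and f: "f \<in> borel_measurable P"
  shows "(\<integral>\<^sup>+w. ennreal ((root_density (midpoint_measure P P') P w)\<^sup>2) * f w \<partial>midpoint_measure P P')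
           = (\<integral>\<^sup>+w. f w \<partial>P)"
    and "(\<integral>\<^sup>+w. ennreal ((root_density (midpoint_measure P P') P' w)\<^sup>2) * f w \<partial>midpoint_measure P P')
           = (\<integral>\<^sup>+w. f w \<partial>P')"
proof -
  have f': "f \<in> borel_measurable (midpoint_measure P P')"
    using f by (simp cong: measurable_cong_sets)
  note * = prob_space_midpoint[OF P(3,1,2)] absolutely_continuous_midpoint[OF P(3)]
  show "(\<integral>\<^sup>+w. ennreal ((root_density (midpoint_measure P P') P w)\<^sup>2) * f w \<partial>midpoint_measure P P')
           = (\<integral>\<^sup>+w. f w \<partial>P)"
    by (rule nn_integral_root_density[OF *(1) P(1) *(2) _ f']) simp
  show "(\<integral>\<^sup>+w. ennreal ((root_density (midpoint_measure P P') P' w)\<^sup>2) * f w \<partial>midpoint_measure P P')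
           = (\<integral>\<^sup>+w. f w \<partial>P')"
    by (rule nn_integral_root_density[OF *(1) P(2) *(3) _ f']) (simp add: P(3))
qed

text \<open>Both scores, multiplied by half the root density of \<open>P\<close>, approximate the
  same difference quotient, so the distance of the two products tends to 0. Rewritten as an integral
  over \<open>P\<close>, this distance does not depend on t.\<close>

lemma dqm_unique:
  assumes dqm: "dqm P p s" "dqm P p s'" and P: "prob_space P"
    and p: "\<forall>\<^sub>F t in at 0. prob_space (p t) \<and> sets (p t) = sets P"
  shows "AE w in P. s w = s' w"
proof -
  let ?D = "\<lambda>s t. \<integral>\<^sup>+w. ennreal
          (((root_density (midpoint_measure P (p t)) (p t) w
             - root_density (midpoint_measure P (p t)) P w) / t
            - s w / 2 * root_density (midpoint_measure P (p t)) P w)\<^sup>2)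
        \<partial>midpoint_measure P (p t)"
  let ?C = "\<integral>\<^sup>+w. ennreal (((s w - s' w) / 2)\<^sup>2) \<partial>P"
  have [measurable]: "s \<in> borel_measurable P" "s' \<in> borel_measurable P"
    using dqm by (auto simp: dqm_def L2_0_def L2_def)
  have "\<forall>\<^sub>F t in at 0. ?C \<le> 2 * ?D s t + 2 * ?D s' t"
    using p
  proof eventually_elim
    case (elim t)
    let ?M = "midpoint_measure P (p t)"
    let ?r = "root_density ?M P" and ?q = "\<lambda>w. (root_density ?M (p t) w - root_density ?M P w) / t"
    have [measurable_cong]: "sets ?M = sets P" by simp
    have "?C = (\<integral>\<^sup>+w. ennreal ((?r w)\<^sup>2) * ennreal (((s w - s' w) / 2)\<^sup>2) \<partial>?M)"
      using elim P by (subst nn_integral_root_density_midpoint(1)) auto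
    also have "\<dots> = (\<integral>\<^sup>+w. ennreal ((s w / 2 * ?r w - s' w / 2 * ?r w)\<^sup>2) \<partial>?M)"
    proof -
      have "ennreal (q\<^sup>2) * ennreal (((x - y) / 2)\<^sup>2) = ennreal ((x / 2 * q - y / 2 * q)\<^sup>2)" for q x y :: real
        by (subst ennreal_mult[symmetric], simp, simp, intro arg_cong[where f = ennreal])
           (simp add: power2_eq_square field_simps)
      then show ?thesis by simp
    qed
    also have "\<dots> \<le> 2 * (\<integral>\<^sup>+w. ennreal ((s w / 2 * ?r w - ?q w)\<^sup>2) \<partial>?M)
        + 2 * (\<integral>\<^sup>+w. ennreal ((?q w - s' w / 2 * ?r w)\<^sup>2) \<partial>?M)"
      by (intro nn_integral_sq_triangle) measurable
    also have "(\<integral>\<^sup>+w. ennreal ((s w / 2 * ?r w - ?q w)\<^sup>2) \<partial>?M) = ?D s t"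
      by (subst power2_commute) (rule refl)
    finally show ?case .
  qed
  moreover have "((\<lambda>t. 2 * ?D s t + 2 * ?D s' t) \<longlongrightarrow> 2 * 0 + 2 * 0) (at 0)"
    using dqm unfolding dqm_def by (intro tendsto_add ennreal_tendsto_cmult) auto
  ultimately have "?C \<le> 2 * 0 + 2 * 0"
    by (intro tendsto_lowerbound[where F = "at 0"]) auto
  then have "?C = 0" by simp
  then have "AE w in P. ennreal (((s w - s' w) / 2)\<^sup>2) = 0"
    by (subst (asm) nn_integral_0_iff_AE) auto
  then show ?thesis by eventually_elim simp
qed

section \<open>Markov kernels and their adjoints\<close>

text \<open>Kept abstract because it is instantiated for the channel from (v, x) to (v, z), for the
  pure noise channel of a mixture, and for the kernel that produces (v, x, z).\<close>

locale markov_kernel =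
  fixes N :: "'a measure" and N' :: "'b measure" and K :: "'a \<Rightarrow> 'b measure"
  assumes kernel: "K \<in> N \<rightarrow>\<^sub>M prob_algebra N'"
    and nonempty: "space N \<noteq> {}"
begin

lemma kernel_subprob: "sets M = sets N \<Longrightarrow> K \<in> M \<rightarrow>\<^sub>M subprob_algebra N'"
  using measurable_prob_algebraD[OF kernel] measurable_cong_sets[of M N] by auto

lemma kernel_subprob_N [measurable]: "K \<in> N \<rightarrow>\<^sub>M subprob_algebra N'"
  by (rule kernel_subprob) simp

lemma
  assumes "y \<in> space N"
  shows prob_space_kernel: "prob_space (K y)" and sets_kernel: "sets (K y) = sets N'"
  using measurable_space[OF kernel assms] by (auto simp: space_prob_algebra)

text \<open>On an empty space \<open>bind\<close> takes a default value that forgets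
  \<open>N'\<close>; the assumption \<open>nonempty\<close> rules this out.\<close>

lemma
  assumes "sets M = sets N"
  shows sets_bind_kernel: "sets (M \<bind> K) = sets N'"
    and space_bind_kernel: "space (M \<bind> K) = space N'"
proof -
  have "space M \<noteq> {}" using sets_eq_imp_space_eq[OF assms] nonempty by simp
  then show "sets (M \<bind> K) = sets N'" by (rule sets_bind_measurable[OF kernel_subprob[OF assms]])
  then show "space (M \<bind> K) = space N'" by (rule sets_eq_imp_space_eq)
qed

lemma nn_integral_bind_kernel:
  assumes "sets M = sets N" "f \<in> borel_measurable N'"
  shows "(\<integral>\<^sup>+z. f z \<partial>(M \<bind> K)) = (\<integral>\<^sup>+y. \<integral>\<^sup>+z. f z \<partial>K y \<partial>M)"
  by (rule nn_integral_bind[OF assms(2) kernel_subprob[OF assms(1)]])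

lemma emeasure_bind_kernel:
  assumes "sets M = sets N" "B \<in> sets N'"
  shows "emeasure (M \<bind> K) B = (\<integral>\<^sup>+y. emeasure (K y) B \<partial>M)"
proof -
  have "space M \<noteq> {}" using sets_eq_imp_space_eq[OF assms(1)] nonempty by simp
  then show ?thesis by (rule emeasure_bind[OF _ kernel_subprob[OF assms(1)] assms(2)])
qed

lemma measurable_bind_kernel:
  "sets M = sets N \<Longrightarrow> f \<in> borel_measurable (M \<bind> K) \<longleftrightarrow> f \<in> borel_measurable N'"
  using measurable_cong_sets[OF sets_bind_kernel refl, of M borel] by auto

lemma emeasure_space_bind_kernel:
  assumes "sets M = sets N"
  shows "emeasure (M \<bind> K) (space N') = emeasure M (space M)"
proof -
  have "emeasure (M \<bind> K) (space N') = (\<integral>\<^sup>+y. emeasure (K y) (space N') \<partial>M)"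
    by (rule emeasure_bind_kernel[OF assms]) simp
  also have "\<dots> = (\<integral>\<^sup>+y. 1 \<partial>M)"
    using sets_eq_imp_space_eq[OF assms]
    by (intro nn_integral_cong)
       (metis prob_space.emeasure_space_1 prob_space_kernel sets_kernel sets_eq_imp_space_eq)
  finally show ?thesis by simp
qed

lemma finite_measure_bind_kernel:
  assumes "sets M = sets N" "finite_measure M"
  shows "finite_measure (M \<bind> K)"
  using emeasure_space_bind_kernel[OF assms(1)] space_bind_kernel[OF assms(1)]
    finite_measure.emeasure_finite[OF assms(2)]
  by (intro finite_measureI) simp

lemma bind_kernel_prob_algebra:
  "P \<in> space (prob_algebra N) \<Longrightarrow> P \<bind> K \<in> space (prob_algebra N')"
  using sets_bind_kernel[of P] prob_space_bind'[OF _ kernel, of P]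
  by (auto simp: space_prob_algebra)

lemma integral_kernel_measurable [measurable]:
  fixes f :: "'b \<Rightarrow> real"
  assumes "f \<in> borel_measurable N'"
  shows "(\<lambda>y. \<integral>z. f z \<partial>K y) \<in> borel_measurable N"
  using measurable_compose[OF kernel_subprob_N integral_measurable_subprob_algebra[OF assms]] .

lemma nn_integral_kernel_measurable [measurable]:
  assumes "f \<in> borel_measurable N'"
  shows "(\<lambda>y. \<integral>\<^sup>+z. f z \<partial>K y) \<in> borel_measurable N"
  using measurable_compose[OF kernel_subprob_N nn_integral_measurable_subprob_algebra[OF assms]] .

lemma measure_kernel_measurable [measurable]:
  assumes "B \<in> sets N'"
  shows "(\<lambda>y. measure (K y) B) \<in> borel_measurable N"
  using measurable_compose[OF kernel measurable_measure_prob_algebra[OF assms]] .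

text \<open>The exceptional set {z. \<not> R z} need not be measurable, so a measurable null set
  containing it is passed through the bind instead.\<close>

lemma AE_bind_kernel:
  assumes "sets M = sets N" "AE z in M \<bind> K. R z"
  shows "AE y in M. AE z in K y. R z"
proof -
  obtain A where A: "A \<in> null_sets (M \<bind> K)" "{z \<in> space N'. \<not> R z} \<subseteq> A"
    using assms(2) unfolding eventually_ae_filter space_bind_kernel[OF assms(1)] by auto
  then have "AE z in M \<bind> K. z \<notin> A" by (intro AE_not_in) auto
  moreover have A': "A \<in> sets N'" using A sets_bind_kernel[OF assms(1)] by auto
  ultimately have "AE y in M. AE z in K y. z \<notin> A"
    using AE_bind[OF kernel_subprob[OF assms(1)], of "\<lambda>z. z \<notin> A"] by simp
  then show ?thesis using AE_space
  proof eventually_elim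
    case (elim y)
    then have y: "space (K y) = space N'"
      using sets_eq_imp_space_eq[OF sets_kernel] sets_eq_imp_space_eq[OF assms(1)] by simp
    show ?case using elim(1) AE_space
      by eventually_elim (use A(2) y in auto)
  qed
qed

text \<open>The identity is known for the two nonnegative parts of f. Their inner integrals are
  finite for almost every y only, so they are converted by \<open>enn2real\<close> before being
  subtracted.\<close>

lemma
  fixes f :: "'b \<Rightarrow> real"
  assumes M: "sets M = sets N" and f: "integrable (M \<bind> K) f"
  shows AE_integrable_kernel: "AE y in M. integrable (K y) f"
    and integrable_integral_kernel: "integrable M (\<lambda>y. \<integral>z. f z \<partial>K y)"
    and integral_bind_kernel: "(\<integral>z. f z \<partial>(M \<bind> K)) = (\<integral>y. \<integral>z. f z \<partial>K y \<partial>M)"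
proof -
  note [measurable_cong] = M
  have [measurable]: "f \<in> borel_measurable N'"
    by (rule iffD1[OF measurable_bind_kernel[OF M] borel_measurable_integrable[OF f]])
  have fK: "f \<in> borel_measurable (K y)" if "y \<in> space M" for y
    using measurable_cong_sets[OF sets_kernel refl, of y borel] sets_eq_imp_space_eq[OF M] that by auto
  have fin: "(\<integral>\<^sup>+y. \<integral>\<^sup>+z. ennreal \<bar>f z\<bar> \<partial>K y \<partial>M) < \<infinity>"
    using f by (simp add: integrable_iff_bounded nn_integral_bind_kernel[OF M])
  then have "AE y in M. (\<integral>\<^sup>+z. ennreal \<bar>f z\<bar> \<partial>K y) \<noteq> \<infinity>"
    by (intro nn_integral_noteq_infinite) auto
  then show ae: "AE y in M. integrable (K y) f"
    by (rule AE_mp) (auto intro!: AE_I2 simp: integrable_iff_bounded fK less_top)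
  let ?p = "\<lambda>y. \<integral>\<^sup>+z. ennreal (f z) \<partial>K y" and ?n = "\<lambda>y. \<integral>\<^sup>+z. ennreal (- f z) \<partial>K y"
  have p_fin: "(\<integral>\<^sup>+y. ?p y \<partial>M) < \<infinity>" and n_fin: "(\<integral>\<^sup>+y. ?n y \<partial>M) < \<infinity>"
    using fin by (auto intro!: nn_integral_mono ennreal_leI elim: le_less_trans[rotated])
  have p_ae: "AE y in M. ?p y < \<infinity>" and n_ae: "AE y in M. ?n y < \<infinity>"
    using nn_integral_noteq_infinite[of ?p M] nn_integral_noteq_infinite[of ?n M] p_fin n_fin
    by (auto simp: less_top)
  have "(\<integral>\<^sup>+y. ennreal (enn2real (?p y)) \<partial>M) = (\<integral>\<^sup>+y. ?p y \<partial>M)"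
    using p_ae by (intro nn_integral_cong_AE) auto
  then have p: "integrable M (\<lambda>y. enn2real (?p y))"
      "(\<integral>y. enn2real (?p y) \<partial>M) = enn2real (\<integral>\<^sup>+y. ?p y \<partial>M)"
    using p_fin by (auto simp: integrable_iff_bounded integral_eq_nn_integral)
  have "(\<integral>\<^sup>+y. ennreal (enn2real (?n y)) \<partial>M) = (\<integral>\<^sup>+y. ?n y \<partial>M)"
    using n_ae by (intro nn_integral_cong_AE) auto
  then have n: "integrable M (\<lambda>y. enn2real (?n y))"
      "(\<integral>y. enn2real (?n y) \<partial>M) = enn2real (\<integral>\<^sup>+y. ?n y \<partial>M)"
    using n_fin by (auto simp: integrable_iff_bounded integral_eq_nn_integral)
  have eq: "AE y in M. (\<integral>z. f z \<partial>K y) = enn2real (?p y) - enn2real (?n y)"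
    using ae by eventually_elim (rule real_lebesgue_integral_def)
  have [measurable]: "(\<lambda>y. \<integral>z. f z \<partial>K y) \<in> borel_measurable M" by measurable
  have "integrable M (\<lambda>y. enn2real (?p y) - enn2real (?n y))" using p n by simp
  then show "integrable M (\<lambda>y. \<integral>z. f z \<partial>K y)"
    using eq by (subst integrable_cong_AE) auto
  have "(\<integral>y. \<integral>z. f z \<partial>K y \<partial>M) = (\<integral>y. enn2real (?p y) - enn2real (?n y) \<partial>M)"
    using eq by (intro integral_cong_AE) auto
  also have "\<dots> = enn2real (\<integral>\<^sup>+y. ?p y \<partial>M) - enn2real (\<integral>\<^sup>+y. ?n y \<partial>M)" using p n by simp
  also have "\<dots> = (\<integral>z. f z \<partial>(M \<bind> K))"
    by (simp add: real_lebesgue_integral_def[OF f] nn_integral_bind_kernel[OF M])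
  finally show "(\<integral>z. f z \<partial>(M \<bind> K)) = (\<integral>y. \<integral>z. f z \<partial>K y \<partial>M)" by simp
qed

text \<open>\<open>g\<close> is the image of \<open>s\<close> under the adjoint of \<open>f \<mapsto> (y \<mapsto> \<integral>f dK y)\<close>: the density with respect
  to \<open>P \<bind> K\<close> of the image under \<open>K\<close> of the signed measure with \<open>P\<close>-density \<open>s\<close>.\<close>

definition kernel_adj :: "'a measure \<Rightarrow> ('a \<Rightarrow> real) \<Rightarrow> ('b \<Rightarrow> real) \<Rightarrow> bool" where
  "kernel_adj P s g \<longleftrightarrow> g \<in> borel_measurable N' \<and> integrable (P \<bind> K) g \<and>
     (\<forall>B\<in>sets N'. (\<integral>z. indicator B z * g z \<partial>(P \<bind> K)) = (\<integral>y. s y * measure (K y) B \<partial>P))"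

section \<open>Existence, positivity and duality of the adjoint\<close>

context
  fixes P :: "'a measure"
  assumes P: "P \<in> space (prob_algebra N)"
begin

lemma sets_P [measurable_cong]: "sets P = sets N" and prob_P: "prob_space P"
  using P by (auto simp: space_prob_algebra)

lemma space_P: "space P = space N"
  by (rule sets_eq_imp_space_eq[OF sets_P])

lemmas sets_PK [measurable_cong] = sets_bind_kernel[OF sets_P]

lemma prob_PK: "prob_space (P \<bind> K)"
  using bind_kernel_prob_algebra[OF P] by (simp add: space_prob_algebra)

lemma finite_PK: "finite_measure (P \<bind> K)"
  using prob_PK by (rule prob_space.finite_measure)

lemma integrable_mult_measure_kernel:
  assumes "integrable P s" "B \<in> sets N'"
  shows "integrable P (\<lambda>y. s y * measure (K y) B)"
proof (rule Bochner_Integration.integrable_bound[OF assms(1)])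
  show "(\<lambda>y. s y * measure (K y) B) \<in> borel_measurable P"
    using assms by measurable
  show "AE y in P. norm (s y * measure (K y) B) \<le> norm (s y)"
    using prob_space_kernel[THEN prob_space.prob_le_1]
    by (intro AE_I2) (auto simp: abs_mult space_P intro: mult_left_le)
qed

lemma kernel_adj_lin:
  assumes "kernel_adj P s g" "kernel_adj P s' g'" "integrable P s" "integrable P s'"
  shows "kernel_adj P (\<lambda>y. a * s y + b * s' y) (\<lambda>z. a * g z + b * g' z)"
  unfolding kernel_adj_def
proof (intro conjI ballI)
  show "(\<lambda>z. a * g z + b * g' z) \<in> borel_measurable N'"
    "integrable (P \<bind> K) (\<lambda>z. a * g z + b * g' z)"
    using assms by (auto simp: kernel_adj_def)
  fix B assume B: "B \<in> sets N'"
  have i: "integrable (P \<bind> K) (\<lambda>z. indicator B z * h z)" if "integrable (P \<bind> K) h" for h :: "'b \<Rightarrow> real"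
    using integrable_mult_indicator[OF _ that, of B] B by (simp add: sets_PK)
  have "(\<integral>z. indicator B z * (a * g z + b * g' z) \<partial>(P \<bind> K))
      = (\<integral>z. a * (indicator B z * g z) + b * (indicator B z * g' z) \<partial>(P \<bind> K))"
    by (intro Bochner_Integration.integral_cong) (auto simp: algebra_simps)
  also have "\<dots> = a * (\<integral>y. s y * measure (K y) B \<partial>P) + b * (\<integral>y. s' y * measure (K y) B \<partial>P)"
    using assms B i by (simp add: kernel_adj_def)
  also have "\<dots> = (\<integral>y. a * (s y * measure (K y) B) + b * (s' y * measure (K y) B) \<partial>P)"
    using assms(3,4) B by (simp add: integrable_mult_measure_kernel)
  also have "\<dots> = (\<integral>y. (a * s y + b * s' y) * measure (K y) B \<partial>P)"
    by (intro Bochner_Integration.integral_cong) (auto simp: algebra_simps)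
  finally show "(\<integral>z. indicator B z * (a * g z + b * g' z) \<partial>(P \<bind> K))
      = (\<integral>y. (a * s y + b * s' y) * measure (K y) B \<partial>P)" .
qed

text \<open>For a = 1 the defining identity is the formula for the mass that
  \<open>P \<bind> K\<close> gives to B.\<close>

lemma kernel_adj_const: "kernel_adj P (\<lambda>_. a) (\<lambda>_. a)"
  unfolding kernel_adj_def
proof (intro conjI ballI)
  interpret PK: prob_space "P \<bind> K" by (rule prob_PK)
  show "integrable (P \<bind> K) (\<lambda>_. a)" by simp
  fix B assume B: "B \<in> sets N'"
  have i: "integrable (P \<bind> K) (indicator B :: _ \<Rightarrow> real)"
    by (rule PK.integrable_const_bound[of _ 1]) (use B in auto)
  have "(\<integral>z. indicator B z \<partial>(P \<bind> K)) = (\<integral>y. (\<integral>z. indicator B z \<partial>K y) \<partial>P :: real)"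
    by (rule integral_bind_kernel[OF sets_P i])
  also have "\<dots> = (\<integral>y. measure (K y) B \<partial>P)"
    using B by (intro Bochner_Integration.integral_cong) (auto simp: space_P sets_kernel)
  finally show "(\<integral>z. indicator B z * a \<partial>(P \<bind> K)) = (\<integral>y. a * measure (K y) B \<partial>P)"
    by (simp add: mult.commute)
qed simp

text \<open>A nonnegative integrable s is the density of a finite measure M. The image
  \<open>M \<bind> K\<close> is absolutely continuous: a null set B of \<open>P \<bind> K\<close>
  has K y B = 0 for \<open>P\<close>-almost every y, so M gives no mass to B through K either. The
  Radon-Nikodym derivative is then an adjoint image.\<close>

lemma kernel_adj_nonneg_exists:
  assumes s: "integrable P s" "\<And>y. 0 \<le> s y"
  shows "\<exists>g. kernel_adj P s g"
proof -
  interpret PK: prob_space "P \<bind> K" by (rule prob_PK)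
  have [measurable]: "s \<in> borel_measurable N"
    using borel_measurable_integrable[OF s(1)] by (simp cong: measurable_cong_sets add: sets_P)
  define M where "M = density P (\<lambda>y. ennreal (s y))"
  have M: "sets M = sets N" by (simp add: M_def sets_P)
  have M_K: "emeasure (M \<bind> K) B = (\<integral>\<^sup>+y. ennreal (s y) * emeasure (K y) B \<partial>P)" if "B \<in> sets N'" for B
    unfolding emeasure_bind_kernel[OF M that] using that
    by (simp add: M_def nn_integral_density)
  have "finite_measure M"
    using s by (intro finite_measureI) (simp add: M_def emeasure_density nn_integral_eq_integral cong: nn_integral_cong)
  then interpret MK: finite_measure "M \<bind> K" by (rule finite_measure_bind_kernel[OF M])
  have "absolutely_continuous (P \<bind> K) (M \<bind> K)"
    unfolding absolutely_continuous_def
  proof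
    fix B assume "B \<in> null_sets (P \<bind> K)"
    then have B: "B \<in> sets N'" "emeasure (P \<bind> K) B = 0" by (auto simp: null_sets_def sets_PK)
    note [measurable] = B(1)
    have "(\<lambda>y. emeasure (K y) B) \<in> borel_measurable P" by measurable
    then have "AE y in P. emeasure (K y) B = 0"
      using emeasure_bind_kernel[OF sets_P B(1)] B(2) by (simp add: nn_integral_0_iff_AE)
    moreover have "(\<lambda>y. ennreal (s y) * emeasure (K y) B) \<in> borel_measurable P" by measurable
    ultimately have "emeasure (M \<bind> K) B = 0"
      unfolding M_K[OF B(1)] by (auto simp: nn_integral_0_iff_AE)
    then show "B \<in> null_sets (M \<bind> K)"
      using B by (auto simp: null_sets_def sets_bind_kernel[OF M])
  qed
  moreover have sets_eq: "sets (M \<bind> K) = sets (P \<bind> K)"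
    by (simp add: sets_bind_kernel[OF M] sets_PK)
  ultimately have RN: "density (P \<bind> K) (RN_deriv (P \<bind> K) (M \<bind> K)) = M \<bind> K"
    "AE z in P \<bind> K. RN_deriv (P \<bind> K) (M \<bind> K) z \<noteq> \<infinity>"
    by (rule PK.density_RN_deriv, rule PK.RN_deriv_finite[OF MK.sigma_finite_measure_axioms])
  define g where "g z = enn2real (RN_deriv (P \<bind> K) (M \<bind> K) z)" for z
  have [measurable]: "g \<in> borel_measurable N'"
    unfolding g_def using borel_measurable_RN_deriv[of "P \<bind> K" "M \<bind> K"]
    by (simp cong: measurable_cong_sets add: sets_PK)
  have g_eq: "(\<integral>\<^sup>+z. ennreal (indicator B z * g z) \<partial>(P \<bind> K)) = emeasure (M \<bind> K) B"
    if B[measurable]: "B \<in> sets N'" for B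
  proof -
    have "(\<integral>\<^sup>+z. ennreal (indicator B z * g z) \<partial>(P \<bind> K))
        = (\<integral>\<^sup>+z. RN_deriv (P \<bind> K) (M \<bind> K) z * indicator B z \<partial>(P \<bind> K))"
      using RN(2)
      by (intro nn_integral_cong_AE) (auto simp: g_def less_top indicator_def)
    also have "\<dots> = emeasure (M \<bind> K) B"
      by (subst (2) RN(1)[symmetric]) (simp add: emeasure_density)
    finally show ?thesis .
  qed
  have "kernel_adj P s g"
    unfolding kernel_adj_def
  proof (intro conjI ballI)
    show "g \<in> borel_measurable N'" by measurable
    have "(\<integral>\<^sup>+z. ennreal (g z) \<partial>(P \<bind> K)) = (\<integral>\<^sup>+z. ennreal (indicator (space N') z * g z) \<partial>(P \<bind> K))"
      by (intro nn_integral_cong) (auto simp: space_bind_kernel[OF sets_P])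
    then have "(\<integral>\<^sup>+z. ennreal (g z) \<partial>(P \<bind> K)) < \<infinity>"
      unfolding g_eq[OF sets.top] using MK.emeasure_finite[of "space N'"]
      unfolding infinity_ennreal_def less_top by simp
    then show "integrable (P \<bind> K) g"
      by (auto simp: integrable_iff_bounded g_def)
    fix B assume B[measurable]: "B \<in> sets N'"
    have "(\<integral>z. indicator B z * g z \<partial>(P \<bind> K)) = enn2real (emeasure (M \<bind> K) B)"
      using g_eq[OF B] by (subst integral_eq_nn_integral) (auto simp: g_def)
    also have "emeasure (M \<bind> K) B = (\<integral>\<^sup>+y. ennreal (s y * measure (K y) B) \<partial>P)"
      unfolding M_K[OF B]
      by (intro nn_integral_cong)
         (auto simp: ennreal_mult s space_P finite_measure.emeasure_eq_measure[OF prob_space.finite_measure[OF prob_space_kernel]])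
    also have "enn2real \<dots> = (\<integral>y. s y * measure (K y) B \<partial>P)"
      using s by (subst integral_eq_nn_integral) auto
    finally show "(\<integral>z. indicator B z * g z \<partial>(P \<bind> K)) = (\<integral>y. s y * measure (K y) B \<partial>P)" .
  qed
  then show ?thesis by blast
qed

lemma kernel_adj_exists:
  assumes s: "integrable P s"
  shows "\<exists>g. kernel_adj P s g"
proof -
  have i: "integrable P (\<lambda>y. max 0 (s y))" "integrable P (\<lambda>y. max 0 (- s y))"
    using s by auto
  obtain g1 g2 where g: "kernel_adj P (\<lambda>y. max 0 (s y)) g1" "kernel_adj P (\<lambda>y. max 0 (- s y)) g2"
    using kernel_adj_nonneg_exists[OF i(1)] kernel_adj_nonneg_exists[OF i(2)] by auto
  have "(\<lambda>y. 1 * max 0 (s y) + (- 1) * max 0 (- s y)) = s" by (auto simp: max_def)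
  with kernel_adj_lin[OF g i, of 1 "- 1"] show ?thesis by auto
qed

text \<open>Tested against B = {g < 0}, the defining identity equates a nonpositive integral with a
  nonnegative one.\<close>

lemma kernel_adj_nonneg:
  assumes g: "kernel_adj P s g" and s: "AE y in P. 0 \<le> s y"
  shows "AE z in P \<bind> K. 0 \<le> g z"
proof -
  have gm[measurable]: "g \<in> borel_measurable N'" and gi: "integrable (P \<bind> K) g"
    using g by (auto simp: kernel_adj_def)
  define B where "B = {z \<in> space N'. g z < 0}"
  have B[measurable]: "B \<in> sets N'" unfolding B_def by measurable
  have i: "integrable (P \<bind> K) (\<lambda>z. - (indicator B z * g z))"
    using integrable_mult_indicator[OF _ gi, of B] B by (simp add: sets_PK)
  have "0 \<le> (\<integral>y. s y * measure (K y) B \<partial>P)"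
    using s by (intro integral_nonneg_AE) auto
  then have "(\<integral>z. - (indicator B z * g z) \<partial>(P \<bind> K)) \<le> 0"
    using g B by (simp add: kernel_adj_def)
  moreover have nn: "AE z in P \<bind> K. 0 \<le> - (indicator B z * g z)"
    by (intro AE_I2) (auto simp: indicator_def B_def)
  ultimately have "(\<integral>z. - (indicator B z * g z) \<partial>(P \<bind> K)) = 0"
    using integral_nonneg_AE[OF nn] by linarith
  then have "AE z in P \<bind> K. - (indicator B z * g z) = 0"
    using integral_nonneg_eq_0_iff_AE[OF i nn] by simp
  then show ?thesis
    by (rule AE_mp) (auto intro!: AE_I2 simp: space_bind_kernel[OF sets_P] B_def indicator_def)
qed

text \<open>Both g - g' and g' - g are images of s - s = 0, so positivity applies in both
  directions.\<close>

lemma kernel_adj_unique: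
  assumes "kernel_adj P s g" "kernel_adj P s g'" "integrable P s"
  shows "AE z in P \<bind> K. g z = g' z"
proof -
  have "AE z in P \<bind> K. 0 \<le> 1 * g z + (- 1) * g' z"
    by (rule kernel_adj_nonneg[OF kernel_adj_lin[OF assms(1,2) assms(3,3)]]) simp
  moreover have "AE z in P \<bind> K. 0 \<le> 1 * g' z + (- 1) * g z"
    by (rule kernel_adj_nonneg[OF kernel_adj_lin[OF assms(2,1) assms(3,3)]]) simp
  ultimately show ?thesis by eventually_elim simp
qed

text \<open>For nonnegative s the identity between set functions becomes an equality of measures,
  along which arbitrary integrals can be carried.\<close>

lemma kernel_adj_density:
  assumes g: "kernel_adj P s g" and s: "integrable P s" "AE y in P. 0 \<le> s y"
  shows "density (P \<bind> K) (\<lambda>z. ennreal (g z)) = density P (\<lambda>y. ennreal (s y)) \<bind> K"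
proof (rule measure_eqI)
  have gm[measurable]: "g \<in> borel_measurable N'" and gi: "integrable (P \<bind> K) g"
    using g by (auto simp: kernel_adj_def)
  have [measurable]: "s \<in> borel_measurable N"
    using borel_measurable_integrable[OF s(1)] by (simp cong: measurable_cong_sets add: sets_P)
  let ?M = "density P (\<lambda>y. ennreal (s y))"
  have M: "sets ?M = sets N" by (simp add: sets_P)
  show "sets (density (P \<bind> K) (\<lambda>z. ennreal (g z))) = sets (?M \<bind> K)"
    by (simp add: sets_PK sets_bind_kernel[OF M])
  fix B assume "B \<in> sets (density (P \<bind> K) (\<lambda>z. ennreal (g z)))"
  then have B[measurable]: "B \<in> sets N'" by (simp add: sets_PK)
  have i: "integrable (P \<bind> K) (\<lambda>z. indicator B z * g z)"
    using integrable_mult_indicator[OF _ gi, of B] B by (simp add: sets_PK)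
  have "emeasure (density (P \<bind> K) (\<lambda>z. ennreal (g z))) B
      = (\<integral>\<^sup>+z. ennreal (indicator B z * g z) \<partial>(P \<bind> K))"
    by (subst emeasure_density) (auto intro!: nn_integral_cong simp: indicator_def)
  also have "\<dots> = ennreal (\<integral>z. indicator B z * g z \<partial>(P \<bind> K))"
    using kernel_adj_nonneg[OF g s(2)] by (intro nn_integral_eq_integral i) auto
  also have "\<dots> = ennreal (\<integral>y. s y * measure (K y) B \<partial>P)"
    using g B by (simp add: kernel_adj_def)
  also have "\<dots> = (\<integral>\<^sup>+y. ennreal (s y * measure (K y) B) \<partial>P)"
    using s(2) by (intro nn_integral_eq_integral[symmetric] integrable_mult_measure_kernel s B) auto
  also have "\<dots> = (\<integral>\<^sup>+y. ennreal (s y) * emeasure (K y) B \<partial>P)"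
    by (intro nn_integral_cong)
       (auto simp: ennreal_mult'' space_P finite_measure.emeasure_eq_measure[OF prob_space.finite_measure[OF prob_space_kernel]])
  also have "\<dots> = emeasure (?M \<bind> K) B"
    unfolding emeasure_bind_kernel[OF M B] by (simp add: nn_integral_density)
  finally show "emeasure (density (P \<bind> K) (\<lambda>z. ennreal (g z))) B = emeasure (?M \<bind> K) B" .
qed

lemma kernel_adj_nn_integral:
  assumes g: "kernel_adj P s g" and s: "integrable P s" "AE y in P. 0 \<le> s y"
    and f[measurable]: "f \<in> borel_measurable N'"
  shows "(\<integral>\<^sup>+z. ennreal (g z) * f z \<partial>(P \<bind> K)) = (\<integral>\<^sup>+y. ennreal (s y) * (\<integral>\<^sup>+z. f z \<partial>K y) \<partial>P)"
proof -
  have gm[measurable]: "g \<in> borel_measurable N'" using g by (auto simp: kernel_adj_def)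
  have [measurable]: "s \<in> borel_measurable N"
    using borel_measurable_integrable[OF s(1)] by (simp cong: measurable_cong_sets add: sets_P)
  have M: "sets (density P (\<lambda>y. ennreal (s y))) = sets N" by (simp add: sets_P)
  have "(\<integral>\<^sup>+z. ennreal (g z) * f z \<partial>(P \<bind> K))
      = (\<integral>\<^sup>+z. f z \<partial>density (P \<bind> K) (\<lambda>z. ennreal (g z)))"
    by (simp add: nn_integral_density)
  also have "\<dots> = (\<integral>\<^sup>+y. ennreal (s y) * (\<integral>\<^sup>+z. f z \<partial>K y) \<partial>P)"
    unfolding kernel_adj_density[OF g s] nn_integral_bind_kernel[OF M f]
    by (simp add: nn_integral_density)
  finally show ?thesis .
qed

text \<open>Conditional Jensen inequality without conditional laws: the image h - 2 q g + q^2 of (s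
  - q)^2 is nonnegative for each rational q, hence almost everywhere for all of them at once, and a
  quadratic that is nonnegative on the rationals has nonpositive discriminant.\<close>

lemma kernel_adj_square_le:
  assumes s: "s \<in> L2 P" and g: "kernel_adj P s g" and h: "kernel_adj P (\<lambda>y. (s y)\<^sup>2) h"
  shows "AE z in P \<bind> K. (g z)\<^sup>2 \<le> h z"
proof -
  have fin: "finite_measure P" using prob_P by (rule prob_space.finite_measure)
  have si: "integrable P s" "integrable P (\<lambda>y. (s y)\<^sup>2)"
    using L2_integrable[OF fin s] L2_integrable_sq[OF s] by auto
  have ci: "integrable P (\<lambda>_. 1 :: real)" using finite_measure.integrable_const[OF fin] .
  have "AE z in P \<bind> K. 0 \<le> h z - 2 * q * g z + q\<^sup>2" for q :: real
  proof -
    have 1: "kernel_adj P (\<lambda>y. 1 * (s y)\<^sup>2 + (- 2 * q) * s y) (\<lambda>z. 1 * h z + (- 2 * q) * g z)"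
      by (rule kernel_adj_lin[OF h g si(2,1)])
    have i: "integrable P (\<lambda>y. 1 * (s y)\<^sup>2 + (- 2 * q) * s y)" using si by simp
    have "AE z in P \<bind> K. 0 \<le> 1 * (1 * h z + (- 2 * q) * g z) + q\<^sup>2 * 1"
    proof (rule kernel_adj_nonneg[OF kernel_adj_lin[OF 1 kernel_adj_const i ci]], rule AE_I2)
      fix y show "0 \<le> 1 * (1 * (s y)\<^sup>2 + - 2 * q * s y) + q\<^sup>2 * 1"
        using zero_le_power2[of "s y - q"] by (simp add: power2_eq_square algebra_simps)
    qed
    then show ?thesis by (simp add: algebra_simps)
  qed
  then have "AE z in P \<bind> K. \<forall>q\<in>\<rat>. 0 \<le> h z - 2 * q * g z + q\<^sup>2"
    by (subst AE_ball_countable) (auto simp: countable_rat)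
  then show ?thesis
  proof eventually_elim
    case (elim z)
    show ?case
    proof (rule ccontr)
      assume "\<not> (g z)\<^sup>2 \<le> h z"
      then have d: "0 < sqrt ((g z)\<^sup>2 - h z)" by simp
      \<comment> \<open>If g^2 > h, the quadratic is negative strictly between its roots g - sqrt
        (g^2 - h) and g + sqrt (g^2 - h); q is a rational from the upper half of this
        interval.\<close>
      obtain q where q: "q \<in> \<rat>" "g z < q" "q < g z + sqrt ((g z)\<^sup>2 - h z)"
        using Rats_dense_in_real[of "g z" "g z + sqrt ((g z)\<^sup>2 - h z)"] d by auto
      then have "(q - g z)\<^sup>2 < (sqrt ((g z)\<^sup>2 - h z))\<^sup>2"
        by (intro power_strict_mono) auto
      also have "\<dots> = (g z)\<^sup>2 - h z" using d by simp
      finally show False using elim q(1) by (auto simp: power2_eq_square algebra_simps)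
    qed
  qed
qed

lemma kernel_adj_L2:
  assumes s: "s \<in> L2 P" and g: "kernel_adj P s g"
  shows "g \<in> L2 (P \<bind> K)"
proof -
  have [measurable]: "g \<in> borel_measurable N'" using g by (simp add: kernel_adj_def)
  obtain h where h: "kernel_adj P (\<lambda>y. (s y)\<^sup>2) h"
    using kernel_adj_exists L2_integrable_sq[OF s] by blast
  have "integrable (P \<bind> K) (\<lambda>z. (g z)\<^sup>2)"
  proof (rule Bochner_Integration.integrable_bound)
    show "integrable (P \<bind> K) h" using h by (simp add: kernel_adj_def)
    show "AE z in P \<bind> K. norm ((g z)\<^sup>2) \<le> norm (h z)"
      using kernel_adj_square_le[OF s g h] by eventually_elim simp
  qed measurable
  then show ?thesis by (simp add: L2_def)
qed

lemma kernel_adj_integral: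
  assumes "kernel_adj P s g"
  shows "(\<integral>z. g z \<partial>(P \<bind> K)) = (\<integral>y. s y \<partial>P)"
proof -
  have "(\<integral>z. g z \<partial>(P \<bind> K)) = (\<integral>z. indicator (space N') z * g z \<partial>(P \<bind> K))"
    by (intro Bochner_Integration.integral_cong) (auto simp: space_bind_kernel[OF sets_P])
  also have "\<dots> = (\<integral>y. s y * measure (K y) (space N') \<partial>P)"
    using assms by (simp add: kernel_adj_def)
  also have "\<dots> = (\<integral>y. s y \<partial>P)"
  proof (rule Bochner_Integration.integral_cong)
    fix y assume "y \<in> space P"
    then have y: "y \<in> space N" by (simp add: space_P)
    show "s y * measure (K y) (space N') = s y"
      using prob_space.prob_space[OF prob_space_kernel[OF y]] sets_eq_imp_space_eq[OF sets_kernel[OF y]] by simp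
  qed simp
  finally show ?thesis .
qed

text \<open>Jensen's inequality for each K y, in the form of Cauchy-Schwarz against the constant
  1.\<close>

lemma integral_kernel_L2:
  assumes f: "f \<in> L2 (P \<bind> K)"
  shows "(\<lambda>y. \<integral>z. f z \<partial>K y) \<in> L2 P"
proof -
  have [measurable]: "f \<in> borel_measurable N'"
    by (rule iffD1[OF measurable_bind_kernel[OF sets_P] L2_measurable[OF f]])
  have i: "integrable (P \<bind> K) f" "integrable (P \<bind> K) (\<lambda>z. (f z)\<^sup>2)"
    using L2_integrable[OF finite_PK f] L2_integrable_sq[OF f] by auto
  have "integrable P (\<lambda>y. (\<integral>z. f z \<partial>K y)\<^sup>2)"
  proof (rule Bochner_Integration.integrable_bound[OF integrable_integral_kernel[OF sets_P i(2)]])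
    show "(\<lambda>y. (\<integral>z. f z \<partial>K y)\<^sup>2) \<in> borel_measurable P" by measurable
    show "AE y in P. norm ((\<integral>z. f z \<partial>K y)\<^sup>2) \<le> norm (\<integral>z. (f z)\<^sup>2 \<partial>K y)"
      using AE_integrable_kernel[OF sets_P i(2)] AE_integrable_kernel[OF sets_P i(1)] AE_space
    proof eventually_elim
      case (elim y)
      then have y: "y \<in> space N" by (simp add: space_P)
      interpret prob_space "K y" by (rule prob_space_kernel[OF y])
      have L: "f \<in> L2 (K y)" using elim by (auto simp: L2_def)
      have "(\<integral>z. f z * 1 \<partial>K y)\<^sup>2 \<le> (\<integral>z. (f z)\<^sup>2 \<partial>K y) * (\<integral>z. 1\<^sup>2 \<partial>K y)"
        by (rule L2_Cauchy_Schwarz[OF L L2_const]) unfold_locales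
      then show ?case by (simp add: prob_space)
    qed
  qed
  then show ?thesis by (simp add: L2_def)
qed

text \<open>The equality of measures in \<open>kernel_adj_density\<close> reduces this to the
  formula for integrals with respect to a bind.\<close>

lemma kernel_adj_inner_nonneg:
  assumes s: "s \<in> L2 P" "\<And>y. 0 \<le> s y" and g: "kernel_adj P s g" and f: "f \<in> L2 (P \<bind> K)"
  shows "(\<integral>z. g z * f z \<partial>(P \<bind> K)) = (\<integral>y. s y * (\<integral>z. f z \<partial>K y) \<partial>P)"
proof -
  have gm[measurable]: "g \<in> borel_measurable N'" using g by (auto simp: kernel_adj_def)
  have [measurable]: "f \<in> borel_measurable N'"
    by (rule iffD1[OF measurable_bind_kernel[OF sets_P] L2_measurable[OF f]])
  have [measurable]: "s \<in> borel_measurable N"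
    using L2_measurable[OF s(1)] by (simp cong: measurable_cong_sets add: sets_P)
  have si: "integrable P s"
    using L2_integrable[OF prob_space.finite_measure[OF prob_P] s(1)] .
  have s0: "AE y in P. 0 \<le> s y" using s(2) by simp
  let ?M = "density P (\<lambda>y. ennreal (s y))" and ?G = "density (P \<bind> K) (\<lambda>z. ennreal (g z))"
  have M: "sets ?M = sets N" by (simp add: sets_P)
  have g0: "AE z in P \<bind> K. 0 \<le> g z" by (rule kernel_adj_nonneg[OF g s0])
  have eq: "?G = ?M \<bind> K" by (rule kernel_adj_density[OF g si s0])
  have "integrable ?G f"
    using L2_mult_integrable[OF kernel_adj_L2[OF s(1) g] f] g0
    by (subst integrable_real_density) auto
  then have i: "integrable (?M \<bind> K) f" by (simp add: eq)
  have "(\<integral>z. g z * f z \<partial>(P \<bind> K)) = (\<integral>z. f z \<partial>?G)"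
    using g0 by (subst integral_real_density) auto
  also have "\<dots> = (\<integral>y. \<integral>z. f z \<partial>K y \<partial>?M)"
    unfolding eq by (rule integral_bind_kernel[OF M i])
  also have "\<dots> = (\<integral>y. s y * (\<integral>z. f z \<partial>K y) \<partial>P)"
    using s0 by (subst integral_real_density) auto
  finally show ?thesis .
qed

text \<open>Positive and negative part of s are treated separately; uniqueness identifies g with the
  difference of their images.\<close>

lemma kernel_adj_inner:
  assumes s: "s \<in> L2 P" and g: "kernel_adj P s g" and f: "f \<in> L2 (P \<bind> K)"
  shows "(\<integral>z. g z * f z \<partial>(P \<bind> K)) = (\<integral>y. s y * (\<integral>z. f z \<partial>K y) \<partial>P)"
proof -
  have fin: "finite_measure P" using prob_P by (rule prob_space.finite_measure)
  have sL: "(\<lambda>y. max 0 (t y)) \<in> L2 P" if "t \<in> L2 P" for t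
  proof -
    have [measurable]: "t \<in> borel_measurable P" by (rule L2_measurable[OF that])
    have "(max 0 x)\<^sup>2 \<le> x\<^sup>2" for x :: real by (simp add: max_def)
    then have "integrable P (\<lambda>y. (max 0 (t y))\<^sup>2)"
      by (intro Bochner_Integration.integrable_bound[OF L2_integrable_sq[OF that]]) simp_all
    then show ?thesis using that by (auto simp: L2_def)
  qed
  have L: "(\<lambda>y. max 0 (s y)) \<in> L2 P" "(\<lambda>y. max 0 (- s y)) \<in> L2 P"
    using sL[OF s] sL[OF L2_scale[OF s, of "-1"]] by auto
  have i: "integrable P (\<lambda>y. max 0 (s y))" "integrable P (\<lambda>y. max 0 (- s y))" "integrable P s"
    using L2_integrable[OF fin] L s by auto
  obtain g1 g2 where g12: "kernel_adj P (\<lambda>y. max 0 (s y)) g1" "kernel_adj P (\<lambda>y. max 0 (- s y)) g2"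
    using kernel_adj_exists[OF i(1)] kernel_adj_exists[OF i(2)] by auto
  have *: "(\<lambda>y. 1 * max 0 (s y) + (- 1) * max 0 (- s y)) = s" by (auto simp: max_def)
  have "kernel_adj P s (\<lambda>z. 1 * g1 z + (- 1) * g2 z)"
    using kernel_adj_lin[OF g12 i(1,2), of 1 "- 1"] unfolding * .
  from kernel_adj_unique[OF g this i(3)] have ae: "AE z in P \<bind> K. g z = g1 z - g2 z" by simp
  note gL = kernel_adj_L2[OF L(1) g12(1)] kernel_adj_L2[OF L(2) g12(2)]
  have "(\<integral>z. g z * f z \<partial>(P \<bind> K)) = (\<integral>z. g1 z * f z - g2 z * f z \<partial>(P \<bind> K))"
    using ae kernel_adj_L2[OF s g, THEN L2_measurable] gL[THEN L2_measurable] L2_measurable[OF f]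
    by (intro integral_cong_AE) (auto simp: left_diff_distrib)
  also have "\<dots> = (\<integral>z. g1 z * f z \<partial>(P \<bind> K)) - (\<integral>z. g2 z * f z \<partial>(P \<bind> K))"
    using gL f by (simp add: L2_mult_integrable)
  also have "\<dots> = (\<integral>y. max 0 (s y) * (\<integral>z. f z \<partial>K y) \<partial>P) - (\<integral>y. max 0 (- s y) * (\<integral>z. f z \<partial>K y) \<partial>P)"
    using kernel_adj_inner_nonneg[OF L(1) _ g12(1) f] kernel_adj_inner_nonneg[OF L(2) _ g12(2) f] by simp
  also have "\<dots> = (\<integral>y. max 0 (s y) * (\<integral>z. f z \<partial>K y) - max 0 (- s y) * (\<integral>z. f z \<partial>K y) \<partial>P)"
    using L integral_kernel_L2[OF f] by (simp add: L2_mult_integrable)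
  also have "\<dots> = (\<integral>y. s y * (\<integral>z. f z \<partial>K y) \<partial>P)"
    by (intro Bochner_Integration.integral_cong) (auto simp: max_def)
  finally show ?thesis .
qed

end

end

section \<open>Differentiability in quadratic mean under Markov kernels\<close>

text \<open>Lets \<epsilon> tend to 0 when the error is \<epsilon> times a fixed c; dividing by c +
  1 also covers c = 0.\<close>

lemma field_le_epsilon_mult:
  fixes x y c :: real
  assumes "0 \<le> c" "\<And>\<epsilon>. 0 < \<epsilon> \<Longrightarrow> x \<le> y + \<epsilon> * c"
  shows "x \<le> y"
proof (rule field_le_epsilon)
  fix e :: real assume "0 < e"
  have "0 < e / (c + 1)" using assms(1) \<open>0 < e\<close> by simp
  then have "x \<le> y + e / (c + 1) * c" by (rule assms(2))
  also have "e / (c + 1) * c \<le> e" using assms(1) \<open>0 < e\<close> by (simp add: field_simps)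
  finally show "x \<le> y + e" by simp
qed

context markov_kernel
begin

text \<open>Integrated conditional Cauchy--Schwarz inequality: \<open>2ac \<le> a\<^sup>2f + c\<^sup>2/f\<close> with \<open>f = w/u\<close>, where
  \<open>\<epsilon>\<close> keeps the quotients positive.\<close>

lemma hellinger_contraction:
  assumes M: "sets M = sets N" "finite_measure M"
    and a: "a \<in> L2 M" and c: "c \<in> L2 M"
    and [measurable]: "u \<in> borel_measurable N'" "w \<in> borel_measurable N'"
    and nonneg: "\<And>z. 0 \<le> u z" "\<And>z. 0 \<le> w z"
    and u: "\<And>f. f \<in> borel_measurable N' \<Longrightarrow> (\<integral>\<^sup>+z. ennreal ((u z)\<^sup>2) * f z \<partial>(M \<bind> K))
                = (\<integral>\<^sup>+y. ennreal ((a y)\<^sup>2) * (\<integral>\<^sup>+z. f z \<partial>K y) \<partial>M)"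
    and w: "\<And>f. f \<in> borel_measurable N' \<Longrightarrow> (\<integral>\<^sup>+z. ennreal ((w z)\<^sup>2) * f z \<partial>(M \<bind> K))
                = (\<integral>\<^sup>+y. ennreal ((c y)\<^sup>2) * (\<integral>\<^sup>+z. f z \<partial>K y) \<partial>M)"
  shows "(\<integral>\<^sup>+z. ennreal ((u z - w z)\<^sup>2) \<partial>(M \<bind> K)) \<le> (\<integral>\<^sup>+y. ennreal ((a y - c y)\<^sup>2) \<partial>M)"
proof -
  note [measurable_cong] = M(1) sets_bind_kernel[OF M(1)]
  have am[measurable]: "a \<in> borel_measurable M" and cm[measurable]: "c \<in> borel_measurable M"
    using a c by (auto simp: L2_def)
  have spM: "space M = space N" using M(1) by (rule sets_eq_imp_space_eq)
  have one: "emeasure (K y) (space (K y)) = 1" if "y \<in> space M" for y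
    using prob_space.emeasure_space_1[OF prob_space_kernel] that by (simp add: spM)
  have finK: "finite_measure (M \<bind> K)" by (rule finite_measure_bind_kernel[OF M])
  \<comment> \<open>With f = 1 the hypotheses say that u and a, and likewise w and c, have equal
    norms. Only the inner products remain to be compared: the affinity may not decrease under the
    kernel.\<close>
  have u2: "(\<integral>\<^sup>+z. ennreal ((u z)\<^sup>2) \<partial>(M \<bind> K)) = ennreal (\<integral>y. (a y)\<^sup>2 \<partial>M)"
    using u[of "\<lambda>_. 1"] one by (simp add: nn_integral_sq_eq[OF a, symmetric] cong: nn_integral_cong)
  have w2: "(\<integral>\<^sup>+z. ennreal ((w z)\<^sup>2) \<partial>(M \<bind> K)) = ennreal (\<integral>y. (c y)\<^sup>2 \<partial>M)"
    using w[of "\<lambda>_. 1"] one by (simp add: nn_integral_sq_eq[OF c, symmetric] cong: nn_integral_cong)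
  have uL: "u \<in> L2 (M \<bind> K)" and wL: "w \<in> L2 (M \<bind> K)"
    using u2 w2 by (auto simp: L2_iff_nn)
  have u2': "(\<integral>z. (u z)\<^sup>2 \<partial>(M \<bind> K)) = (\<integral>y. (a y)\<^sup>2 \<partial>M)"
    using u2 unfolding nn_integral_sq_eq[OF uL] by simp
  have w2': "(\<integral>z. (w z)\<^sup>2 \<partial>(M \<bind> K)) = (\<integral>y. (c y)\<^sup>2 \<partial>M)"
    using w2 unfolding nn_integral_sq_eq[OF wL] by simp
  have i: "integrable (M \<bind> K) u" "integrable (M \<bind> K) w" "integrable (M \<bind> K) (\<lambda>z. u z * w z)"
    "integrable M (\<lambda>y. a y * c y)"
    using L2_integrable[OF finK] L2_mult_integrable uL wL a c by auto
  have C: "2 * (\<integral>y. a y * c y \<partial>M) \<le> 2 * (\<integral>z. u z * w z \<partial>(M \<bind> K))"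
  proof (rule field_le_epsilon_mult)
    show "0 \<le> (\<integral>z. u z + w z \<partial>(M \<bind> K))"
      using nonneg by (intro Bochner_Integration.integral_nonneg) simp
    fix \<epsilon> :: real assume \<epsilon>: "0 < \<epsilon>"
    define f where "f z = (w z + \<epsilon>) / (u z + \<epsilon>)" for z
    define g where "g z = (u z + \<epsilon>) / (w z + \<epsilon>)" for z
    have [measurable]: "f \<in> borel_measurable N'" "g \<in> borel_measurable N'"
      unfolding f_def g_def by measurable
    have mf: "(\<lambda>y. \<integral>\<^sup>+z. ennreal (f z) \<partial>K y) \<in> borel_measurable M"
      and mg: "(\<lambda>y. \<integral>\<^sup>+z. ennreal (g z) \<partial>K y) \<in> borel_measurable M"
      using nn_integral_kernel_measurable[of "\<lambda>z. ennreal (f z)"]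
        nn_integral_kernel_measurable[of "\<lambda>z. ennreal (g z)"]
      by (simp_all cong: measurable_cong_sets add: M(1))
    have pos: "0 < u z + \<epsilon>" "0 < w z + \<epsilon>" for z using nonneg[of z] \<epsilon> by auto
    have pos': "0 < f z" "0 < g z" for z using pos[of z] by (auto simp: f_def g_def)
    have inv: "g z = 1 / f z" for z using pos[of z] by (simp add: f_def g_def)
    have pw: "2 * (x * y) \<le> x\<^sup>2 * f z + y\<^sup>2 * g z" for x y z
    proof -
      have "x\<^sup>2 * f z + y\<^sup>2 * g z - 2 * (x * y) = (x * f z - y)\<^sup>2 / f z"
        unfolding inv using pos'(1)[of z] by (simp add: field_simps power2_eq_square)
      also have "\<dots> \<ge> 0" using pos'[of z] by simp
      finally show ?thesis by simp
    qed
    have quot: "x\<^sup>2 * (k / (x + \<epsilon>)) \<le> x * k" if "0 \<le> x" "0 \<le> k" for x k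
    proof -
      have "x / (x + \<epsilon>) \<le> 1" using that \<epsilon> by simp
      then have "x * k * (x / (x + \<epsilon>)) \<le> x * k" using that by (intro mult_left_le) auto
      then show ?thesis by (simp add: power2_eq_square mult_ac)
    qed
    \<comment> \<open>These bounds lose only \<epsilon>: together the two right-hand sides exceed 2
      u w by \<epsilon> (u + w).\<close>
    have uf: "(u z)\<^sup>2 * f z \<le> u z * (w z + \<epsilon>)" and wg: "(w z)\<^sup>2 * g z \<le> w z * (u z + \<epsilon>)" for z
      unfolding f_def g_def using nonneg[of z] \<epsilon> by (intro quot; simp)+
    have "(\<integral>\<^sup>+y. ennreal (2 * (a y * c y)) \<partial>M)
        \<le> (\<integral>\<^sup>+y. ennreal ((a y)\<^sup>2) * (\<integral>\<^sup>+z. ennreal (f z) \<partial>K y)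
              + ennreal ((c y)\<^sup>2) * (\<integral>\<^sup>+z. ennreal (g z) \<partial>K y) \<partial>M)"
    proof (rule nn_integral_mono)
      fix y assume y: "y \<in> space M"
      have sK: "sets (K y) = sets N'" using y by (simp add: spM sets_kernel)
      have [measurable]: "f \<in> borel_measurable (K y)" "g \<in> borel_measurable (K y)"
        by (simp_all cong: measurable_cong_sets add: sK)
      have "ennreal (2 * (a y * c y)) = (\<integral>\<^sup>+z. ennreal (2 * (a y * c y)) \<partial>K y)"
        using one[OF y] by simp
      also have "\<dots> \<le> (\<integral>\<^sup>+z. ennreal ((a y)\<^sup>2) * ennreal (f z) + ennreal ((c y)\<^sup>2) * ennreal (g z) \<partial>K y)"
      proof (rule nn_integral_mono)
        fix z
        have "ennreal ((a y)\<^sup>2) * ennreal (f z) + ennreal ((c y)\<^sup>2) * ennreal (g z)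
            = ennreal ((a y)\<^sup>2 * f z + (c y)\<^sup>2 * g z)"
          using pos'[of z] by (subst ennreal_plus) (auto simp: ennreal_mult less_imp_le)
        then show "ennreal (2 * (a y * c y))
            \<le> ennreal ((a y)\<^sup>2) * ennreal (f z) + ennreal ((c y)\<^sup>2) * ennreal (g z)"
          using pw[of "a y" "c y" z] by (simp add: ennreal_leI)
      qed
      also have "\<dots> = ennreal ((a y)\<^sup>2) * (\<integral>\<^sup>+z. ennreal (f z) \<partial>K y)
              + ennreal ((c y)\<^sup>2) * (\<integral>\<^sup>+z. ennreal (g z) \<partial>K y)"
        by (subst nn_integral_add) (simp_all add: nn_integral_cmult)
      finally show "ennreal (2 * (a y * c y)) \<le> ennreal ((a y)\<^sup>2) * (\<integral>\<^sup>+z. ennreal (f z) \<partial>K y)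
              + ennreal ((c y)\<^sup>2) * (\<integral>\<^sup>+z. ennreal (g z) \<partial>K y)" .
    qed
    also have "\<dots> = (\<integral>\<^sup>+z. ennreal ((u z)\<^sup>2) * ennreal (f z) \<partial>(M \<bind> K))
        + (\<integral>\<^sup>+z. ennreal ((w z)\<^sup>2) * ennreal (g z) \<partial>(M \<bind> K))"
      using mf mg by (subst nn_integral_add) (simp_all add: u w)
    also have "\<dots> \<le> (\<integral>\<^sup>+z. ennreal (u z * (w z + \<epsilon>)) \<partial>(M \<bind> K))
        + (\<integral>\<^sup>+z. ennreal (w z * (u z + \<epsilon>)) \<partial>(M \<bind> K))"
      using uf wg pos'
      by (intro add_mono nn_integral_mono)
         (simp_all add: less_imp_le ennreal_leI flip: ennreal_mult)
    also have "\<dots> = ennreal (\<integral>z. u z * (w z + \<epsilon>) \<partial>(M \<bind> K)) + ennreal (\<integral>z. w z * (u z + \<epsilon>) \<partial>(M \<bind> K))"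
      using nonneg \<epsilon> i by (subst (1 2) nn_integral_eq_integral) (auto simp: distrib_left mult.commute)
    also have "\<dots> = ennreal ((\<integral>z. u z * (w z + \<epsilon>) \<partial>(M \<bind> K)) + (\<integral>z. w z * (u z + \<epsilon>) \<partial>(M \<bind> K)))"
      using nonneg \<epsilon> by (intro ennreal_plus[symmetric] Bochner_Integration.integral_nonneg) auto
    also have "(\<integral>z. u z * (w z + \<epsilon>) \<partial>(M \<bind> K)) + (\<integral>z. w z * (u z + \<epsilon>) \<partial>(M \<bind> K))
        = 2 * (\<integral>z. u z * w z \<partial>(M \<bind> K)) + \<epsilon> * (\<integral>z. u z + w z \<partial>(M \<bind> K))"
      using i by (simp add: distrib_left mult.commute)
    finally have *: "(\<integral>\<^sup>+y. ennreal (2 * (a y * c y)) \<partial>M)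
        \<le> ennreal (2 * (\<integral>z. u z * w z \<partial>(M \<bind> K)) + \<epsilon> * (\<integral>z. u z + w z \<partial>(M \<bind> K)))" (is "_ \<le> ennreal ?r") .
    have r: "0 \<le> ?r" using nonneg \<epsilon>
      by (intro add_nonneg_nonneg mult_nonneg_nonneg Bochner_Integration.integral_nonneg) auto
    have "2 * (\<integral>y. a y * c y \<partial>M) = (\<integral>y. 2 * (a y * c y) \<partial>M)" by simp
    \<comment> \<open>The Bochner integral is the integral of the positive part minus that of the
      negative part; the latter is dropped.\<close>
    also have "\<dots> \<le> enn2real (\<integral>\<^sup>+y. ennreal (2 * (a y * c y)) \<partial>M)"
      using i by (subst real_lebesgue_integral_def) auto
    also have "\<dots> \<le> ?r"
      using enn2real_mono[OF *] r by simp
    finally show "2 * (\<integral>y. a y * c y \<partial>M) \<le> ?r" .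
  qed
  have "(\<integral>z. (u z - w z)\<^sup>2 \<partial>(M \<bind> K))
      = (\<integral>z. (u z)\<^sup>2 \<partial>(M \<bind> K)) + (\<integral>z. (w z)\<^sup>2 \<partial>(M \<bind> K)) - 2 * (\<integral>z. u z * w z \<partial>(M \<bind> K))"
    using i L2_integrable_sq[OF uL] L2_integrable_sq[OF wL] by (simp add: power2_diff mult.assoc)
  also have "\<dots> \<le> (\<integral>y. (a y)\<^sup>2 \<partial>M) + (\<integral>y. (c y)\<^sup>2 \<partial>M) - 2 * (\<integral>y. a y * c y \<partial>M)"
    using C by (simp add: u2' w2')
  also have "\<dots> = (\<integral>y. (a y - c y)\<^sup>2 \<partial>M)"
    using i L2_integrable_sq[OF a] L2_integrable_sq[OF c] by (simp add: power2_diff mult.assoc)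
  finally show ?thesis
    by (simp add: nn_integral_sq_eq[OF L2_diff[OF uL wL]] nn_integral_sq_eq[OF L2_diff[OF a c]] ennreal_leI)
qed

text \<open>Binding is additive in the measure. Thus the dominating measure in \<open>dqm\<close> on
  the target side is the image of the one on the source side, which is the form required by
  \<open>hellinger_contraction\<close>.\<close>

lemma midpoint_bind_kernel:
  assumes "sets P = sets N" "sets P' = sets N"
  shows "midpoint_measure (P \<bind> K) (P' \<bind> K) = midpoint_measure P P' \<bind> K"
proof (rule measure_eqI)
  have M: "sets (midpoint_measure P P') = sets N" using assms(1) by simp
  show "sets (midpoint_measure (P \<bind> K) (P' \<bind> K)) = sets (midpoint_measure P P' \<bind> K)"
    by (simp add: sets_bind_kernel[OF assms(1)] sets_bind_kernel[OF M])
  fix B assume "B \<in> sets (midpoint_measure (P \<bind> K) (P' \<bind> K))"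
  then have B: "B \<in> sets N'" by (simp add: sets_bind_kernel[OF assms(1)])
  have "(\<lambda>y. emeasure (K y) B) \<in> borel_measurable P"
    using measurable_compose[OF kernel_subprob[OF assms(1)] measurable_emeasure_subprob_algebra[OF B]] .
  then show "emeasure (midpoint_measure (P \<bind> K) (P' \<bind> K)) B = emeasure (midpoint_measure P P' \<bind> K) B"
    using B assms
    by (simp add: emeasure_midpoint sets_bind_kernel emeasure_bind_kernel nn_integral_midpoint)
qed

end

section \<open>Expansion of the root of a quadratic density\<close>

text \<open>The hypothesis gives |t g| <= |t| sqrt h, so the quadratic lies between the squares of 1
  - |t| sqrt h / 2 and 1 + |t| sqrt h / 2. Divided by |t|, the bound is free of t and serves for
  dominated convergence.\<close>

lemma sqrt_remainder_bound:
  fixes t g h :: real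
  assumes "g\<^sup>2 \<le> h"
  shows "\<bar>sqrt (max 0 (1 + t * g + t\<^sup>2 * h / 4)) - 1\<bar> \<le> \<bar>t\<bar> * sqrt h / 2"
proof -
  have h: "0 \<le> h" using assms zero_le_power2[of g] by linarith
  define a where "a = sqrt h"
  have a: "0 \<le> a" "a\<^sup>2 = h" using h by (auto simp: a_def)
  have "\<bar>g\<bar> \<le> a" using assms unfolding a_def by (intro real_le_rsqrt) simp
  then have tg: "\<bar>t * g\<bar> \<le> \<bar>t\<bar> * a" by (simp add: abs_mult mult_left_mono)
  have sq: "(\<bar>t\<bar> * a / 2)\<^sup>2 = t\<^sup>2 * h / 4"
    by (simp add: power_mult_distrib power_divide a)
  let ?q = "1 + t * g + t\<^sup>2 * h / 4"
  have up: "?q \<le> (1 + \<bar>t\<bar> * a / 2)\<^sup>2"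
    using tg unfolding power2_sum sq by (simp add: abs_le_iff)
  have lo: "(1 - \<bar>t\<bar> * a / 2)\<^sup>2 \<le> ?q"
    using tg unfolding power2_diff sq by (simp add: abs_le_iff)
  have q: "0 \<le> ?q" using lo zero_le_power2[of "1 - \<bar>t\<bar> * a / 2"] by linarith
  have "sqrt ?q \<le> 1 + \<bar>t\<bar> * a / 2"
    using up a by (intro real_le_lsqrt) auto
  moreover have "1 - \<bar>t\<bar> * a / 2 \<le> sqrt ?q"
    using lo by (rule real_le_rsqrt)
  moreover have "max 0 ?q = ?q" using q by simp
  ultimately show ?thesis unfolding a_def by linarith
qed

text \<open>For fixed g and h the quadratic tends to 1, so the truncation by \<open>max 0\<close> is
  inactive for small t and the limit comes from the derivative g/2 of the root at t = 0.\<close>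

lemma sqrt_remainder_tendsto:
  fixes g h :: real
  shows "((\<lambda>t. (sqrt (max 0 (1 + t * g + t\<^sup>2 * h / 4)) - 1) / t - g / 2) \<longlongrightarrow> 0) (at 0)"
proof -
  have "((\<lambda>t. sqrt (1 + t * g + t\<^sup>2 * h / 4)) has_real_derivative g / 2) (at 0)"
  proof -
    have "((\<lambda>t. sqrt (1 + t * g + t\<^sup>2 * k)) has_real_derivative g / 2) (at 0)" for k
      by (auto intro!: derivative_eq_intros)
    from this[of "h / 4"] show ?thesis by simp
  qed
  then have "((\<lambda>t. (sqrt (1 + t * g + t\<^sup>2 * h / 4) - 1) / t) \<longlongrightarrow> g / 2) (at 0)"
    by (simp add: has_field_derivative_iff)
  then have lim: "((\<lambda>t. (sqrt (1 + t * g + t\<^sup>2 * h / 4) - 1) / t - g / 2) \<longlongrightarrow> 0) (at 0)"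
    using LIM_zero by fastforce
  have "((\<lambda>t. 1 + t * g + t\<^sup>2 * h / 4) \<longlongrightarrow> 1 + 0 * g + 0\<^sup>2 * h / 4) (at 0)"
    by (intro tendsto_intros) simp
  then have "\<forall>\<^sub>F t in at 0. 0 < 1 + t * g + t\<^sup>2 * h / 4"
    by (intro order_tendstoD(1)) auto
  then have "\<forall>\<^sub>F t in at 0. (sqrt (1 + t * g + t\<^sup>2 * h / 4) - 1) / t - g / 2
      = (sqrt (max 0 (1 + t * g + t\<^sup>2 * h / 4)) - 1) / t - g / 2"
    by eventually_elim (simp add: max_def)
  then show ?thesis using lim by (rule Lim_transform_eventually[rotated])
qed

text \<open>Dominated convergence along sequences: the difference quotient and g/2 are each at most
  sqrt h / 2 in absolute value, so the squared remainder is at most h.\<close>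

lemma sqrt_remainder_L2_tendsto:
  assumes [measurable]: "g \<in> borel_measurable M" and h: "integrable M h"
    and gh: "AE z in M. (g z)\<^sup>2 \<le> h z"
  shows "((\<lambda>t. \<integral>\<^sup>+z. ennreal (((sqrt (max 0 (1 + t * g z + t\<^sup>2 * h z / 4)) - 1) / t - g z / 2)\<^sup>2) \<partial>M)
           \<longlongrightarrow> 0) (at 0)"
  unfolding tendsto_at_iff_sequentially
proof (intro allI impI)
  have [measurable]: "h \<in> borel_measurable M" using h by auto
  fix X :: "nat \<Rightarrow> real" assume X: "\<forall>i. X i \<in> UNIV - {0}" "X \<longlonglongrightarrow> 0"
  let ?e = "\<lambda>t z. ((sqrt (max 0 (1 + t * g z + t\<^sup>2 * h z / 4)) - 1) / t - g z / 2)\<^sup>2"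
  have X': "filterlim X (at 0) sequentially"
    using X by (auto simp: filterlim_at)
  have "(\<lambda>i. \<integral>\<^sup>+z. ennreal (?e (X i) z) \<partial>M) \<longlonglongrightarrow> (\<integral>\<^sup>+z. 0 \<partial>M)"
  proof (rule nn_integral_dominated_convergence[where w = "\<lambda>z. ennreal (h z)"])
    show "AE z in M. ennreal (?e (X i) z) \<le> ennreal (h z)" for i
      using gh
    proof eventually_elim
      case (elim z)
      let ?q = "(sqrt (max 0 (1 + X i * g z + (X i)\<^sup>2 * h z / 4)) - 1) / X i"
      have h: "0 \<le> h z" using elim zero_le_power2[of "g z"] by linarith
      have "X i \<noteq> 0" using X by auto
      then have 1: "\<bar>?q\<bar> \<le> sqrt (h z) / 2"
        using sqrt_remainder_bound[OF elim, of "X i"] by (simp add: field_simps)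
      have "\<bar>g z\<bar> \<le> sqrt (h z)" using elim by (intro real_le_rsqrt) simp
      with 1 have "\<bar>?q - g z / 2\<bar> \<le> sqrt (h z)" by linarith
      then have "(?q - g z / 2)\<^sup>2 \<le> (sqrt (h z))\<^sup>2" by (intro abs_le_square_iff[THEN iffD1]) simp
      then show ?case using h by (intro ennreal_leI) simp
    qed
    show "(\<integral>\<^sup>+z. ennreal (h z) \<partial>M) < \<infinity>"
    proof -
      have "(\<integral>\<^sup>+z. ennreal (h z) \<partial>M) \<le> (\<integral>\<^sup>+z. ennreal \<bar>h z\<bar> \<partial>M)"
        by (intro nn_integral_mono ennreal_leI) simp
      also have "\<dots> < \<infinity>" using h by (simp add: integrable_iff_bounded)
      finally show ?thesis .
    qed
    show "AE z in M. (\<lambda>i. ennreal (?e (X i) z)) \<longlonglongrightarrow> 0"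
    proof (rule AE_I2)
      fix z
      have "(\<lambda>i. ?e (X i) z) \<longlonglongrightarrow> 0\<^sup>2"
        by (intro tendsto_power filterlim_compose[OF sqrt_remainder_tendsto X'])
      then show "(\<lambda>i. ennreal (?e (X i) z)) \<longlonglongrightarrow> 0"
        using tendsto_ennrealI by fastforce
    qed
  qed measurable
  then show "((\<lambda>t. \<integral>\<^sup>+z. ennreal (?e t z) \<partial>M) \<circ> X) \<longlonglongrightarrow> 0"
    by (simp add: comp_def)
qed

context markov_kernel
begin

text \<open>The intermediate term is \<open>W\<close>, the root of the density of the image of (1 +
  t s/2)^2 \<open>P\<close>. Its distance from the root density of \<open>P' \<bind> K\<close> is
  controlled by the contraction, its distance from the linear approximation by the remainder of the
  square root.\<close>

lemma dqm_kernel_step: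
  assumes P: "P \<in> space (prob_algebra N)" and P': "P' \<in> space (prob_algebra N)" and "t \<noteq> 0"
    and s: "s \<in> L2 P" and g: "kernel_adj P s g" and h: "kernel_adj P (\<lambda>y. (s y)\<^sup>2) h"
  defines "\<mu> \<equiv> midpoint_measure P P'" and "\<nu> \<equiv> midpoint_measure (P \<bind> K) (P' \<bind> K)"
  shows "(\<integral>\<^sup>+z. ennreal (((root_density \<nu> (P' \<bind> K) z - root_density \<nu> (P \<bind> K) z) / t
              - g z / 2 * root_density \<nu> (P \<bind> K) z)\<^sup>2) \<partial>\<nu>)
    \<le> 2 * (\<integral>\<^sup>+y. ennreal (((root_density \<mu> P' y - root_density \<mu> P y) / t
              - s y / 2 * root_density \<mu> P y)\<^sup>2) \<partial>\<mu>)
      + 2 * (\<integral>\<^sup>+z. ennreal (((sqrt (max 0 (1 + t * g z + t\<^sup>2 * h z / 4)) - 1) / t - g z / 2)\<^sup>2) \<partial>(P \<bind> K))"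
proof -
  have sP: "sets P = sets N" "prob_space P" and sP': "sets P' = sets N" "prob_space P'"
    using P P' by (auto simp: space_prob_algebra)
  have PP: "sets P' = sets P" using sP sP' by simp
  note PK = sets_bind_kernel[OF sP(1)] prob_PK[OF P]
  note PK' = sets_bind_kernel[OF sP'(1)] prob_PK[OF P']
  have PPK: "sets (P' \<bind> K) = sets (P \<bind> K)" using PK PK' by simp
  have \<mu>: "sets \<mu> = sets N" "prob_space \<mu>"
    using sP prob_space_midpoint[OF PP sP(2) sP'(2)] by (auto simp: \<mu>_def)
  have \<nu>: "\<nu> = \<mu> \<bind> K" unfolding \<mu>_def \<nu>_def by (rule midpoint_bind_kernel[OF sP(1) sP'(1)])
  have s\<nu>: "sets \<nu> = sets N'" unfolding \<nu> by (rule sets_bind_kernel[OF \<mu>(1)])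
  note [measurable_cong] = \<mu>(1) s\<nu> sP(1) PK(1)
  have [measurable]: "s \<in> borel_measurable N"
    using L2_measurable[OF s] by (simp cong: measurable_cong_sets add: sP)
  have [measurable]: "g \<in> borel_measurable N'" "h \<in> borel_measurable N'"
    using g h by (auto simp: kernel_adj_def)
  let ?\<rho>' = "root_density \<mu> P'" and ?\<rho> = "root_density \<mu> P"
  let ?\<sigma>' = "root_density \<nu> (P' \<bind> K)" and ?\<sigma> = "root_density \<nu> (P \<bind> K)"
  have rho: "?\<rho>' \<in> borel_measurable N" "?\<rho> \<in> borel_measurable N"
    using root_density_measurable[of \<mu>] by (auto cong: measurable_cong_sets simp: \<mu>)
  have sigma: "?\<sigma>' \<in> borel_measurable N'" "?\<sigma> \<in> borel_measurable N'"
    using root_density_measurable[of \<nu>] by (auto cong: measurable_cong_sets simp: s\<nu>)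
  note [measurable] = rho sigma
  have [measurable]: "s \<in> borel_measurable \<mu>" "?\<rho>' \<in> borel_measurable \<mu>" "?\<rho> \<in> borel_measurable \<mu>"
    using rho \<open>s \<in> borel_measurable N\<close> by (simp_all cong: measurable_cong_sets add: \<mu>)
  \<comment> \<open>The truncation makes the square of sqrt (q z) equal to q z everywhere; it
    changes values on a null set of \<open>P \<bind> K\<close> only, because the quadratic is the
    image of a square.\<close>
  define q where "q z = max 0 (1 + t * g z + t\<^sup>2 * h z / 4)" for z
  have q0: "0 \<le> q z" for z by (simp add: q_def)
  have [measurable]: "q \<in> borel_measurable N'" unfolding q_def by measurable
  define W where "W z = ?\<sigma> z * sqrt (q z)" for z
  have [measurable]: "W \<in> borel_measurable N'" unfolding W_def by measurable
  have rd: "(\<integral>\<^sup>+y. ennreal ((?\<rho> y)\<^sup>2) * f y \<partial>\<mu>) = (\<integral>\<^sup>+y. f y \<partial>P)"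
      "(\<integral>\<^sup>+y. ennreal ((?\<rho>' y)\<^sup>2) * f y \<partial>\<mu>) = (\<integral>\<^sup>+y. f y \<partial>P')"
    if "f \<in> borel_measurable N" for f
    unfolding \<mu>_def using that sP
    by (intro nn_integral_root_density_midpoint[OF sP(2) sP'(2) PP]; simp cong: measurable_cong_sets)+
  have sd: "(\<integral>\<^sup>+z. ennreal ((?\<sigma> z)\<^sup>2) * f z \<partial>\<nu>) = (\<integral>\<^sup>+z. f z \<partial>(P \<bind> K))"
      "(\<integral>\<^sup>+z. ennreal ((?\<sigma>' z)\<^sup>2) * f z \<partial>\<nu>) = (\<integral>\<^sup>+z. f z \<partial>(P' \<bind> K))"
    if "f \<in> borel_measurable N'" for f
    unfolding \<nu>_def using that PK
    by (intro nn_integral_root_density_midpoint[OF PK(2) PK'(2) PPK]; simp cong: measurable_cong_sets)+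
  have u1: "(\<integral>\<^sup>+z. ennreal ((?\<sigma>' z)\<^sup>2) * f z \<partial>\<nu>) = (\<integral>\<^sup>+y. ennreal ((?\<rho>' y)\<^sup>2) * (\<integral>\<^sup>+z. f z \<partial>K y) \<partial>\<mu>)"
    if [measurable]: "f \<in> borel_measurable N'" for f
  proof -
    have "(\<lambda>y. \<integral>\<^sup>+z. f z \<partial>K y) \<in> borel_measurable N" by (rule nn_integral_kernel_measurable) fact
    then show ?thesis by (simp add: sd[OF that] rd nn_integral_bind_kernel[OF sP'(1) that])
  qed
  have fin: "finite_measure P" using sP(2) by (rule prob_space.finite_measure)
  have s_int: "integrable P s" "integrable P (\<lambda>y. (s y)\<^sup>2)" "integrable P (\<lambda>_. 1 :: real)"
    using L2_integrable[OF fin s] L2_integrable_sq[OF s] finite_measure.integrable_const[OF fin] by auto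
  \<comment> \<open>A signed root of the comparison density: it can be negative where t s < -2, so
    \<open>hellinger_contraction\<close> demands a sign only of the functions on the target
    side.\<close>
  let ?c = "\<lambda>y. ?\<rho> y * (1 + t * s y / 2)"
  have sq_eq: "(\<lambda>y. 1 * (t * s y + t\<^sup>2 / 4 * (s y)\<^sup>2) + 1 * 1) = (\<lambda>y. (1 + t * s y / 2)\<^sup>2)"
    by (auto simp: power2_eq_square field_simps)
  have "kernel_adj P (\<lambda>y. 1 * (t * s y + t\<^sup>2 / 4 * (s y)\<^sup>2) + 1 * 1)
      (\<lambda>z. 1 * (t * g z + t\<^sup>2 / 4 * h z) + 1 * 1)"
    using s_int
    by (intro kernel_adj_lin[OF P] g h kernel_adj_const[OF P]) auto
  then have adj: "kernel_adj P (\<lambda>y. (1 + t * s y / 2)\<^sup>2) (\<lambda>z. 1 + t * g z + t\<^sup>2 * h z / 4)"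
    unfolding sq_eq by (simp add: algebra_simps)
  have c_int: "integrable P (\<lambda>y. (1 + t * s y / 2)\<^sup>2)"
    unfolding sq_eq[symmetric] using s_int by simp
  have u2: "(\<integral>\<^sup>+z. ennreal ((W z)\<^sup>2) * f z \<partial>\<nu>) = (\<integral>\<^sup>+y. ennreal ((?c y)\<^sup>2) * (\<integral>\<^sup>+z. f z \<partial>K y) \<partial>\<mu>)"
    if f[measurable]: "f \<in> borel_measurable N'" for f
  proof -
    have m[measurable]: "(\<lambda>y. \<integral>\<^sup>+z. f z \<partial>K y) \<in> borel_measurable N"
      by (rule nn_integral_kernel_measurable) fact
    have "(\<integral>\<^sup>+z. ennreal ((W z)\<^sup>2) * f z \<partial>\<nu>) = (\<integral>\<^sup>+z. ennreal ((?\<sigma> z)\<^sup>2) * (ennreal (q z) * f z) \<partial>\<nu>)"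
      by (intro nn_integral_cong)
         (simp add: W_def power_mult_distrib ennreal_mult q0 mult.assoc)
    also have "\<dots> = (\<integral>\<^sup>+z. ennreal (q z) * f z \<partial>(P \<bind> K))"
      by (rule sd) measurable
    \<comment> \<open>\<open>ennreal\<close> sends negative numbers to 0, so the truncation
      disappears under a nonnegative integral.\<close>
    also have "\<dots> = (\<integral>\<^sup>+z. ennreal (1 + t * g z + t\<^sup>2 * h z / 4) * f z \<partial>(P \<bind> K))"
      by (intro nn_integral_cong) (simp add: q_def max_def ennreal_neg)
    also have "\<dots> = (\<integral>\<^sup>+y. ennreal ((1 + t * s y / 2)\<^sup>2) * (\<integral>\<^sup>+z. f z \<partial>K y) \<partial>P)"
      by (rule kernel_adj_nn_integral[OF P adj c_int _ f]) simp
    also have "\<dots> = (\<integral>\<^sup>+y. ennreal ((?\<rho> y)\<^sup>2) * (ennreal ((1 + t * s y / 2)\<^sup>2) * (\<integral>\<^sup>+z. f z \<partial>K y)) \<partial>\<mu>)"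
      by (rule rd(1)[symmetric]) measurable
    also have "\<dots> = (\<integral>\<^sup>+y. ennreal ((?c y)\<^sup>2) * (\<integral>\<^sup>+z. f z \<partial>K y) \<partial>\<mu>)"
      by (intro nn_integral_cong) (simp add: power_mult_distrib ennreal_mult mult.assoc)
    finally show ?thesis .
  qed
  have rL: "?\<rho>' \<in> L2 \<mu>"
    using rd(2)[of "\<lambda>_. 1"] prob_space.emeasure_space_1[OF sP'(2)] by (simp add: L2_iff_nn)
  have cL: "?c \<in> L2 \<mu>"
  proof -
    have "(\<integral>\<^sup>+y. ennreal ((?c y)\<^sup>2) \<partial>\<mu>) = (\<integral>\<^sup>+y. ennreal ((?\<rho> y)\<^sup>2) * ennreal ((1 + t * s y / 2)\<^sup>2) \<partial>\<mu>)"
      by (intro nn_integral_cong) (simp add: power_mult_distrib ennreal_mult)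
    also have "\<dots> = (\<integral>\<^sup>+y. ennreal ((1 + t * s y / 2)\<^sup>2) \<partial>P)" by (rule rd) measurable
    also have "\<dots> < \<infinity>" using c_int by (simp add: integrable_iff_bounded)
    finally show ?thesis by (simp add: L2_iff_nn)
  qed
  have hell: "(\<integral>\<^sup>+z. ennreal ((?\<sigma>' z - W z)\<^sup>2) \<partial>\<nu>) \<le> (\<integral>\<^sup>+y. ennreal ((?\<rho>' y - ?c y)\<^sup>2) \<partial>\<mu>)"
    unfolding \<nu>
  proof (rule hellinger_contraction[OF \<mu>(1) prob_space.finite_measure[OF \<mu>(2)] rL cL])
    show "root_density (\<mu> \<bind> K) (P' \<bind> K) \<in> borel_measurable N'" using sigma(1) unfolding \<nu> .
    show "W \<in> borel_measurable N'" by measurable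
  qed (use u1 u2 q0 in \<open>simp_all add: \<nu> root_density_nonneg W_def\<close>)
  have scale: "ennreal ((x / t)\<^sup>2) = ennreal (1 / t\<^sup>2) * ennreal (x\<^sup>2)" for x
    by (subst ennreal_mult[symmetric]) (simp_all add: power_divide)
  have A: "(\<integral>\<^sup>+z. ennreal ((?\<sigma>' z / t - W z / t)\<^sup>2) \<partial>\<nu>)
      \<le> (\<integral>\<^sup>+y. ennreal (((?\<rho>' y - ?\<rho> y) / t - s y / 2 * ?\<rho> y)\<^sup>2) \<partial>\<mu>)"
  proof -
    have "(\<integral>\<^sup>+z. ennreal ((?\<sigma>' z / t - W z / t)\<^sup>2) \<partial>\<nu>) = ennreal (1 / t\<^sup>2) * (\<integral>\<^sup>+z. ennreal ((?\<sigma>' z - W z)\<^sup>2) \<partial>\<nu>)"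
      unfolding diff_divide_distrib[symmetric] scale by (rule nn_integral_cmult) measurable
    also have "\<dots> \<le> ennreal (1 / t\<^sup>2) * (\<integral>\<^sup>+y. ennreal ((?\<rho>' y - ?c y)\<^sup>2) \<partial>\<mu>)"
      by (intro mult_left_mono hell) simp
    also have "\<dots> = (\<integral>\<^sup>+y. ennreal (((?\<rho>' y - ?c y) / t)\<^sup>2) \<partial>\<mu>)"
      unfolding scale by (rule nn_integral_cmult[symmetric]) measurable
    also have "\<dots> = (\<integral>\<^sup>+y. ennreal (((?\<rho>' y - ?\<rho> y) / t - s y / 2 * ?\<rho> y)\<^sup>2) \<partial>\<mu>)"
      using \<open>t \<noteq> 0\<close> by (intro nn_integral_cong arg_cong[where f = "\<lambda>x. ennreal (x\<^sup>2)"]) (simp add: field_simps)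
    finally show ?thesis .
  qed
  \<comment> \<open>The difference is the root density of \<open>P \<bind> K\<close> times the
    remainder, and the squared root density turns the integral into one over
    \<open>P \<bind> K\<close>, in which neither \<open>P'\<close> nor the midpoint occurs.\<close>
  have B: "(\<integral>\<^sup>+z. ennreal ((W z / t - (?\<sigma> z / t + g z / 2 * ?\<sigma> z))\<^sup>2) \<partial>\<nu>)
      = (\<integral>\<^sup>+z. ennreal (((sqrt (q z) - 1) / t - g z / 2)\<^sup>2) \<partial>(P \<bind> K))"
  proof -
    have eq: "W z / t - (?\<sigma> z / t + g z / 2 * ?\<sigma> z) = ?\<sigma> z * ((sqrt (q z) - 1) / t - g z / 2)" for z
      using \<open>t \<noteq> 0\<close> by (simp add: W_def field_simps)
    have "(\<integral>\<^sup>+z. ennreal ((W z / t - (?\<sigma> z / t + g z / 2 * ?\<sigma> z))\<^sup>2) \<partial>\<nu>)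
        = (\<integral>\<^sup>+z. ennreal ((?\<sigma> z)\<^sup>2) * ennreal (((sqrt (q z) - 1) / t - g z / 2)\<^sup>2) \<partial>\<nu>)"
      unfolding eq by (simp add: power_mult_distrib ennreal_mult)
    also have "\<dots> = (\<integral>\<^sup>+z. ennreal (((sqrt (q z) - 1) / t - g z / 2)\<^sup>2) \<partial>(P \<bind> K))"
      by (rule sd) measurable
    finally show ?thesis .
  qed
  have "(\<integral>\<^sup>+z. ennreal (((?\<sigma>' z - ?\<sigma> z) / t - g z / 2 * ?\<sigma> z)\<^sup>2) \<partial>\<nu>)
      = (\<integral>\<^sup>+z. ennreal ((?\<sigma>' z / t - (?\<sigma> z / t + g z / 2 * ?\<sigma> z))\<^sup>2) \<partial>\<nu>)"
    by (simp add: diff_divide_distrib algebra_simps)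
  also have "\<dots> \<le> 2 * (\<integral>\<^sup>+z. ennreal ((?\<sigma>' z / t - W z / t)\<^sup>2) \<partial>\<nu>)
      + 2 * (\<integral>\<^sup>+z. ennreal ((W z / t - (?\<sigma> z / t + g z / 2 * ?\<sigma> z))\<^sup>2) \<partial>\<nu>)"
    by (rule nn_integral_sq_triangle) measurable
  also have "\<dots> \<le> 2 * (\<integral>\<^sup>+y. ennreal (((?\<rho>' y - ?\<rho> y) / t - s y / 2 * ?\<rho> y)\<^sup>2) \<partial>\<mu>)
      + 2 * (\<integral>\<^sup>+z. ennreal (((sqrt (q z) - 1) / t - g z / 2)\<^sup>2) \<partial>(P \<bind> K))"
    unfolding B by (intro add_right_mono mult_left_mono A) simp
  finally show ?thesis unfolding q_def .
qed

lemma kernel_adj_L2_0: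
  assumes "P \<in> space (prob_algebra N)" "s \<in> L2_0 P" "kernel_adj P s g"
  shows "g \<in> L2_0 (P \<bind> K)"
  using kernel_adj_L2[OF assms(1) _ assms(3)] kernel_adj_integral[OF assms(1,3)] assms(2)
  by (simp add: L2_0_def)

text \<open>The bound of \<open>dqm_kernel_step\<close> holds for all small t; its first term
  vanishes by differentiability of the given path, and its second term no longer involves the
  path.\<close>

theorem dqm_kernel:
  assumes P: "P \<in> space (prob_algebra N)" and dqm: "dqm P p s" and g: "kernel_adj P s g"
    and p: "\<forall>\<^sub>F t in at 0. p t \<in> space (prob_algebra N)"
  shows "dqm (P \<bind> K) (\<lambda>t. p t \<bind> K) g"
proof -
  have s0: "s \<in> L2_0 P" and s: "s \<in> L2 P" using dqm by (auto simp: dqm_def L2_0_def)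
  obtain h where h: "kernel_adj P (\<lambda>y. (s y)\<^sup>2) h"
    using kernel_adj_exists[OF P] L2_integrable_sq[OF s] by blast
  let ?A = "\<lambda>t. \<integral>\<^sup>+y. ennreal
          (((root_density (midpoint_measure P (p t)) (p t) y
             - root_density (midpoint_measure P (p t)) P y) / t
            - s y / 2 * root_density (midpoint_measure P (p t)) P y)\<^sup>2)
        \<partial>midpoint_measure P (p t)"
  let ?B = "\<lambda>t. \<integral>\<^sup>+z. ennreal (((sqrt (max 0 (1 + t * g z + t\<^sup>2 * h z / 4)) - 1) / t - g z / 2)\<^sup>2) \<partial>(P \<bind> K)"
  have B: "(?B \<longlongrightarrow> 0) (at 0)"
  proof (rule sqrt_remainder_L2_tendsto)
    show "g \<in> borel_measurable (P \<bind> K)" using L2_measurable[OF kernel_adj_L2[OF P s g]] .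
    show "integrable (P \<bind> K) h" using h by (simp add: kernel_adj_def)
    show "AE z in P \<bind> K. (g z)\<^sup>2 \<le> h z" by (rule kernel_adj_square_le[OF P s g h])
  qed
  have A: "(?A \<longlongrightarrow> 0) (at 0)" using dqm by (simp add: dqm_def)
  have "((\<lambda>t. 2 * ?A t + 2 * ?B t) \<longlongrightarrow> 2 * 0 + 2 * 0) (at 0)"
    by (intro tendsto_add ennreal_tendsto_cmult A B) auto
  then have lim: "((\<lambda>t. 2 * ?A t + 2 * ?B t) \<longlongrightarrow> 0) (at 0)" by simp
  have le: "\<forall>\<^sub>F t in at 0. (\<integral>\<^sup>+z. ennreal
          (((root_density (midpoint_measure (P \<bind> K) (p t \<bind> K)) (p t \<bind> K) z
             - root_density (midpoint_measure (P \<bind> K) (p t \<bind> K)) (P \<bind> K) z) / t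
            - g z / 2 * root_density (midpoint_measure (P \<bind> K) (p t \<bind> K)) (P \<bind> K) z)\<^sup>2)
        \<partial>midpoint_measure (P \<bind> K) (p t \<bind> K)) \<le> 2 * ?A t + 2 * ?B t"
    using p eventually_neq_at_within[of 0 0 UNIV]
  proof eventually_elim
    case (elim t)
    show ?case by (rule dqm_kernel_step[OF P elim s g h])
  qed
  show ?thesis
    unfolding dqm_def
    using kernel_adj_L2_0[OF P s0 g] tendsto_sandwich[OF _ le tendsto_const lim] by simp
qed

end

section \<open>Efficient influence functions under Markov kernels\<close>

lemma lin_span_base: "s \<in> T \<Longrightarrow> s \<in> lin_span T"
  unfolding lin_span_def by (auto intro!: exI[of _ "{s}"] exI[of _ "\<lambda>_. 1"])

lemma closed_lin_spanI:
  assumes "h \<in> L2 P" "T \<subseteq> L2 P"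
    and "\<And>\<epsilon>. 0 < \<epsilon> \<Longrightarrow> \<exists>k\<in>T. (\<integral>w. (h w - k w)\<^sup>2 \<partial>P) < \<epsilon>"
  shows "h \<in> closed_lin_span P T"
  unfolding closed_lin_span_def
proof (intro CollectI conjI allI impI assms(1))
  fix \<epsilon> :: real assume "0 < \<epsilon>"
  from assms(3)[OF this] obtain k where "k \<in> T" "(\<integral>w. (h w - k w)\<^sup>2 \<partial>P) < \<epsilon>" by blast
  then show "\<exists>k\<in>lin_span T. k \<in> L2 P \<and> (\<integral>w. (h w - k w)\<^sup>2 \<partial>P) < \<epsilon>"
    using assms(2) lin_span_base by (intro bexI[of _ k]) auto
qed

text \<open>The mean is continuous in the L2 norm and vanishes on the span, so it vanishes on the
  closure.\<close>

lemma closed_lin_span_L2_0: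
  assumes P: "prob_space P" and h: "h \<in> closed_lin_span P (L2_0 P)"
  shows "h \<in> L2_0 P"
proof -
  interpret prob_space P by fact
  have fin: "finite_measure P" using P by (rule prob_space.finite_measure)
  have hL: "h \<in> L2 P" using h by (simp add: closed_lin_span_def)
  have "(\<integral>w. h w \<partial>P)\<^sup>2 \<le> 0 + \<epsilon>" if "0 < \<epsilon>" for \<epsilon>
  proof -
    obtain k where k: "k \<in> lin_span (L2_0 P)" "k \<in> L2 P" "(\<integral>w. (h w - k w)\<^sup>2 \<partial>P) < \<epsilon>"
      using h \<open>0 < \<epsilon>\<close> unfolding closed_lin_span_def by blast
    obtain F a where F: "finite F" "F \<subseteq> L2_0 P" "k = (\<lambda>w. \<Sum>s\<in>F. a s * s w)"
      using k(1) unfolding lin_span_def by blast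
    have i: "integrable P s" "(\<integral>w. s w \<partial>P) = 0" if "s \<in> F" for s
      using F(2) that L2_integrable[OF fin] by (auto simp: L2_0_def)
    have "(\<integral>w. k w \<partial>P) = (\<Sum>s\<in>F. \<integral>w. a s * s w \<partial>P)"
      unfolding F(3) using i by (intro Bochner_Integration.integral_sum) auto
    then have "(\<integral>w. k w \<partial>P) = 0" using i by simp
    then have "(\<integral>w. h w \<partial>P) = (\<integral>w. (h w - k w) * 1 \<partial>P)"
      using L2_integrable[OF fin hL] L2_integrable[OF fin k(2)] by simp
    then have "(\<integral>w. h w \<partial>P)\<^sup>2 \<le> (\<integral>w. (h w - k w)\<^sup>2 \<partial>P) * (\<integral>w. 1\<^sup>2 \<partial>P)"
      using L2_Cauchy_Schwarz[OF L2_diff[OF hL k(2)] L2_const[OF fin, of 1]] by simp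
    then show ?thesis using k(3) by (simp add: prob_space)
  qed
  then have "(\<integral>w. h w \<partial>P)\<^sup>2 \<le> 0" by (rule field_le_epsilon)
  then show ?thesis using hL by (simp add: L2_0_def)
qed

context markov_kernel
begin

text \<open>Allows the function \<open>Q_inv Q R \<phi>\<close> to replace the version of the
  conditional expectation that it equals almost everywhere.\<close>

lemma kernel_adj_AE_cong:
  assumes P: "P \<in> space (prob_algebra N)" and g: "kernel_adj P s g"
    and g': "g' \<in> borel_measurable N'" and eq: "AE z in P \<bind> K. g' z = g z"
  shows "kernel_adj P s g'"
proof -
  note [measurable_cong] = sets_PK[OF P]
  have [measurable]: "g \<in> borel_measurable N'" "g' \<in> borel_measurable N'"
    using g g' by (simp_all add: kernel_adj_def)
  have "integrable (P \<bind> K) g'"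
    using g eq by (subst integrable_cong_AE[of g' _ g]) (auto simp: kernel_adj_def)
  moreover have "(\<integral>z. indicator B z * g' z \<partial>(P \<bind> K)) = (\<integral>z. indicator B z * g z \<partial>(P \<bind> K))"
    if [measurable]: "B \<in> sets N'" for B
    using eq by (intro integral_cong_AE) auto
  ultimately show ?thesis using g g' by (simp add: kernel_adj_def)
qed

text \<open>Only images of mean-zero functions are available as approximants, so orthogonality of r
  to them shows no more than that u y = \<integral> r dK y is almost surely constant. Injectivity,
  applied to r minus this constant c, makes r itself constant, and a mean-zero k is orthogonal to
  constants.\<close>

lemma kernel_adj_dense:
  assumes P: "P \<in> space (prob_algebra N)"
    and inj: "\<And>r. r \<in> L2 (P \<bind> K) \<Longrightarrow> (AE y in P. (\<integral>z. r z \<partial>K y) = 0) \<Longrightarrow> (AE z in P \<bind> K. r z = 0)"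
    and k: "k \<in> L2_0 (P \<bind> K)" and "0 < \<epsilon>"
  shows "\<exists>s\<in>L2_0 P. \<exists>g. kernel_adj P s g \<and> (\<integral>z. (k z - g z)\<^sup>2 \<partial>(P \<bind> K)) < \<epsilon>"
proof -
  interpret P: prob_space P by (rule prob_P[OF P])
  have finP: "finite_measure P" using prob_P[OF P] by (rule prob_space.finite_measure)
  note fin = finite_PK[OF P]
  let ?D = "{g. \<exists>s\<in>L2_0 P. kernel_adj P s g}"
  have L: "s \<in> L2 P" "integrable P s" if "s \<in> L2_0 P" for s
    using that L2_integrable[OF finP] by (auto simp: L2_0_def)
  have "\<exists>h\<in>?D. (\<integral>z. (k z - h z)\<^sup>2 \<partial>(P \<bind> K)) < \<epsilon>"
  proof (rule L2_closure_if_orthogonal[OF fin _ _ _ _ _ \<open>0 < \<epsilon>\<close>])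
    show "?D \<subseteq> L2 (P \<bind> K)" using kernel_adj_L2[OF P L(1)] by blast
    show "(\<lambda>_. 0) \<in> ?D"
      using kernel_adj_const[OF P, of 0] L2_const[OF finP, of 0] by (auto simp: L2_0_def)
    show "k \<in> L2 (P \<bind> K)" using k by (simp add: L2_0_def)
    show "(\<lambda>w. a * h w + b * h' w) \<in> ?D" if "h \<in> ?D" "h' \<in> ?D" for h h' a b
    proof -
      from that obtain s s' where s: "s \<in> L2_0 P" "kernel_adj P s h" "s' \<in> L2_0 P" "kernel_adj P s' h'"
        by blast
      have "(\<lambda>y. a * s y + b * s' y) \<in> L2_0 P"
      proof -
        have "(\<lambda>y. a * s y + b * s' y) \<in> L2 P" by (intro L2_add L2_scale L(1) s(1,3))
        moreover have "(\<integral>y. a * s y + b * s' y \<partial>P) = 0"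
          using L(2)[OF s(1)] L(2)[OF s(3)] s(1,3) by (simp add: L2_0_def)
        ultimately show ?thesis by (simp add: L2_0_def)
      qed
      then show ?thesis using kernel_adj_lin[OF P s(2,4) L(2)[OF s(1)] L(2)[OF s(3)], of a b] by blast
    qed
    fix r assume r: "r \<in> L2 (P \<bind> K)" and orth: "\<And>h. h \<in> ?D \<Longrightarrow> (\<integral>z. r z * h z \<partial>(P \<bind> K)) = 0"
    define u where "u y = (\<integral>z. r z \<partial>K y)" for y
    have u: "u \<in> L2 P" unfolding u_def by (rule integral_kernel_L2[OF P r])
    define c where "c = (\<integral>y. u y \<partial>P)"
    \<comment> \<open>The centred u is itself an admissible test function; orthogonality of r to its
      image makes the variance of u zero.\<close>
    define s where "s y = u y - c" for y
    have sL: "s \<in> L2 P" unfolding s_def by (rule L2_diff[OF u L2_const[OF finP]])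
    have s0: "(\<integral>y. s y \<partial>P) = 0"
      using L2_integrable[OF finP u] by (simp add: s_def c_def P.prob_space)
    obtain g where g: "kernel_adj P s g" using kernel_adj_exists[OF P L2_integrable[OF finP sL]] by blast
    have "(\<integral>y. s y * u y \<partial>P) = (\<integral>z. r z * g z \<partial>(P \<bind> K))"
      using kernel_adj_inner[OF P sL g r] by (simp add: u_def mult.commute)
    also have "\<dots> = 0" using sL s0 g by (intro orth) (auto simp: L2_0_def)
    finally have su: "(\<integral>y. s y * u y \<partial>P) = 0" .
    have "(\<integral>y. (s y)\<^sup>2 \<partial>P) = (\<integral>y. s y * u y - c * s y \<partial>P)"
      by (intro Bochner_Integration.integral_cong) (auto simp: s_def power2_eq_square algebra_simps)
    also have "\<dots> = 0"
      using L2_mult_integrable[OF sL u] L2_integrable[OF finP sL] s0 su by simp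
    finally have "AE y in P. (s y)\<^sup>2 = 0"
      using integral_nonneg_eq_0_iff_AE[OF L2_integrable_sq[OF sL]] by simp
    then have uc: "AE y in P. u y = c" by eventually_elim (simp add: s_def)
    have "AE y in P. (\<integral>z. r z - c \<partial>K y) = 0"
      using AE_integrable_kernel[OF sets_P[OF P] L2_integrable[OF fin r]] uc AE_space
    proof eventually_elim
      case (elim y)
      interpret Ky: prob_space "K y" using elim(3) by (intro prob_space_kernel) (simp add: space_P[OF P])
      show ?case using elim(1,2) by (simp add: u_def Ky.prob_space)
    qed
    then have rc: "AE z in P \<bind> K. r z - c = 0"
      by (rule inj[OF L2_diff[OF r L2_const[OF fin]]])
    have "(\<integral>z. r z * k z \<partial>(P \<bind> K)) = (\<integral>z. c * k z \<partial>(P \<bind> K))"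
      using rc r k by (intro integral_cong_AE) (auto simp: L2_0_def L2_def)
    also have "\<dots> = 0" using k by (simp add: L2_0_def)
    finally show "(\<integral>z. r z * k z \<partial>(P \<bind> K)) = 0" .
  qed
  then show ?thesis by blast
qed

text \<open>Two filters occur: the functional has to be identified at t = 0 as well, whereas
  differentiability in quadratic mean excludes t = 0.\<close>

lemma regular_submodel_eventually:
  assumes "regular_submodel \<M> P p" "\<M> \<subseteq> space (prob_algebra N)"
  shows "\<forall>\<^sub>F t in nhds 0. p t \<in> \<M>" and "\<forall>\<^sub>F t in at 0. p t \<in> space (prob_algebra N)"
proof -
  obtain \<epsilon> where "0 < \<epsilon>" "\<forall>t. \<bar>t\<bar> < \<epsilon> \<longrightarrow> p t \<in> \<M>"
    using assms(1) by (auto simp: regular_submodel_def)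
  then show "\<forall>\<^sub>F t in nhds 0. p t \<in> \<M>"
    by (auto simp: eventually_nhds_metric dist_real_def)
  then have "\<forall>\<^sub>F t in at 0. p t \<in> \<M>" by (simp add: eventually_nhds_conv_at)
  then show "\<forall>\<^sub>F t in at 0. p t \<in> space (prob_algebra N)"
    by eventually_elim (use assms(2) in auto)
qed

lemma kernel_adj_tangent_set:
  assumes P: "P \<in> space (prob_algebra N)" and "\<M> \<subseteq> space (prob_algebra N)"
    and reg: "\<forall>p\<in>S. regular_submodel \<M> P p"
    and "s \<in> tangent_set P S" "kernel_adj P s g"
  shows "g \<in> tangent_set (P \<bind> K) ((\<lambda>p t. p t \<bind> K) ` S)"
proof -
  obtain p where p: "p \<in> S" "dqm P p s" using assms(4) by (auto simp: tangent_set_def)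
  have "dqm (P \<bind> K) (\<lambda>t. p t \<bind> K) g"
    using dqm_kernel[OF P p(2) assms(5) regular_submodel_eventually(2)[OF _ assms(2)]] reg p(1) by blast
  then show ?thesis using p(1) by (auto simp: tangent_set_def)
qed

text \<open>The derivative condition quantifies over every score s' of the image path, so uniqueness
  of scores is used to identify s' with an adjoint image g. Duality moves \<integral> k g back to
  the source, where it becomes \<integral> \<phi> s. By injectivity the inverse map returns p t
  along the path, so the composed functional agrees with \<open>\<kappa> (p t)\<close> near
  0.\<close>

theorem efficient_influence_function_kernel:
  assumes \<M>: "\<M> \<subseteq> space (prob_algebra N)" and PM: "P \<in> \<M>"
    and eif: "efficient_influence_function \<M> S P \<kappa> \<phi>"
    and inj: "inj_on (\<lambda>P. P \<bind> K) \<M>"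
    and k: "k \<in> closed_lin_span (P \<bind> K) (tangent_set (P \<bind> K) ((\<lambda>p t. p t \<bind> K) ` S))"
    and \<phi>: "AE y in P. \<phi> y = (\<integral>z. k z \<partial>K y)"
  shows "efficient_influence_function ((\<lambda>P. P \<bind> K) ` \<M>) ((\<lambda>p t. p t \<bind> K) ` S) (P \<bind> K)
    (\<kappa> \<circ> inv_into \<M> (\<lambda>P. P \<bind> K)) k"
proof -
  have P: "P \<in> space (prob_algebra N)" using \<M> PM by auto
  have reg: "regular_submodel \<M> P p" if "p \<in> S" for p
    using eif that by (simp add: efficient_influence_function_def)
  have score: "\<exists>s g. s \<in> L2 P \<and> dqm P p s \<and> kernel_adj P s g \<and> dqm (P \<bind> K) (\<lambda>t. p t \<bind> K) g"
    if pS: "p \<in> S" for p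
  proof -
    obtain s where s: "dqm P p s" using reg[OF pS] by (auto simp: regular_submodel_def)
    then have sL: "s \<in> L2 P" by (simp add: dqm_def L2_0_def)
    obtain g where g: "kernel_adj P s g"
      using kernel_adj_exists[OF P L2_integrable[OF prob_space.finite_measure[OF prob_P[OF P]] sL]] by blast
    show ?thesis
      using s sL g dqm_kernel[OF P s g regular_submodel_eventually(2)[OF reg[OF pS] \<M>]] by blast
  qed
  have regK: "regular_submodel ((\<lambda>P. P \<bind> K) ` \<M>) (P \<bind> K) (\<lambda>t. p t \<bind> K)" if "p \<in> S" for p
    using score[OF that] reg[OF that] by (auto simp: regular_submodel_def)
  have deriv: "((\<lambda>t. (\<kappa> \<circ> inv_into \<M> (\<lambda>P. P \<bind> K)) (p t \<bind> K)) has_real_derivative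
      (\<integral>z. k z * s' z \<partial>(P \<bind> K))) (at 0)"
    if p: "p \<in> S" and s': "dqm (P \<bind> K) (\<lambda>t. p t \<bind> K) s'" for p s'
  proof -
    obtain s g where s: "s \<in> L2 P" "dqm P p s" "kernel_adj P s g" "dqm (P \<bind> K) (\<lambda>t. p t \<bind> K) g"
      using score[OF p] by blast
    note ev = regular_submodel_eventually[OF reg[OF p] \<M>]
    have "\<forall>\<^sub>F t in at 0. prob_space (p t \<bind> K) \<and> sets (p t \<bind> K) = sets (P \<bind> K)"
      using ev(2) by eventually_elim (simp add: prob_PK sets_PK P)
    then have eq: "AE z in P \<bind> K. s' z = g z"
      by (rule dqm_unique[OF s' s(4) prob_PK[OF P]])
    have kL: "k \<in> L2 (P \<bind> K)" using k by (simp add: closed_lin_span_def)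
    have s'L: "s' \<in> L2 (P \<bind> K)" using s' by (simp add: dqm_def L2_0_def)
    note gL = kernel_adj_L2[OF P s(1,3)]
    have \<phi>L: "\<phi> \<in> L2 P" using eif by (simp add: efficient_influence_function_def closed_lin_span_def)
    have "(\<integral>z. k z * s' z \<partial>(P \<bind> K)) = (\<integral>z. g z * k z \<partial>(P \<bind> K))"
      using eq kL[THEN L2_measurable] s'L[THEN L2_measurable] gL[THEN L2_measurable]
      by (intro integral_cong_AE) auto
    also have "\<dots> = (\<integral>y. s y * (\<integral>z. k z \<partial>K y) \<partial>P)" by (rule kernel_adj_inner[OF P s(1,3) kL])
    also have "\<dots> = (\<integral>y. \<phi> y * s y \<partial>P)"
      using \<phi> \<phi>L[THEN L2_measurable] s(1)[THEN L2_measurable] integral_kernel_L2[OF P kL, THEN L2_measurable]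
      by (intro integral_cong_AE) auto
    finally have int: "(\<integral>z. k z * s' z \<partial>(P \<bind> K)) = (\<integral>y. \<phi> y * s y \<partial>P)" .
    have d: "((\<lambda>t. \<kappa> (p t)) has_real_derivative (\<integral>y. \<phi> y * s y \<partial>P)) (at 0)"
      using eif p s(2) by (simp add: efficient_influence_function_def)
    have e: "\<forall>\<^sub>F t in nhds 0. \<kappa> (p t) = (\<kappa> \<circ> inv_into \<M> (\<lambda>P. P \<bind> K)) (p t \<bind> K)"
      using ev(1) by eventually_elim (simp add: inv_into_f_f[OF inj])
    show ?thesis unfolding int by (rule iffD1[OF DERIV_cong_ev[OF refl e refl] d])
  qed
  show ?thesis
    unfolding efficient_influence_function_def using regK k deriv by auto
qed

end

section \<open>Privacy mechanisms\<close>

lemma integral_finite_discrete: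
  fixes f :: "'a \<Rightarrow> real"
  assumes "finite_measure M" "finite (space M)" "sets M = Pow (space M)"
  shows "(\<integral>w. f w \<partial>M) = (\<Sum>a\<in>space M. measure M {a} * f a)"
proof -
  interpret finite_measure M by fact
  have "(\<integral>w. f w \<partial>M) = (\<integral>w. (\<Sum>a\<in>space M. f a * indicator {a} w) \<partial>M)"
    by (intro Bochner_Integration.integral_cong)
       (auto simp: indicator_def if_distrib sum.delta assms(2) cong: if_cong)
  also have "\<dots> = (\<Sum>a\<in>space M. \<integral>w. f a * indicator {a} w \<partial>M)"
    using assms by (intro Bochner_Integration.integral_sum integrable_mult_right integrable_real_indicator)
      (auto simp: less_top[symmetric])
  also have "\<dots> = (\<Sum>a\<in>space M. measure M {a} * f a)"
    using assms(3) by (intro sum.cong) auto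
  finally show ?thesis .
qed

section \<open>The channel from (V, X) to (V, Z)\<close>

text \<open>The kernel under the outer bind of \<open>law_VZ\<close>, named so that the results on
  Markov kernels apply to it.\<close>

definition mech_kernel ::
    "'v measure \<Rightarrow> 'x measure \<Rightarrow> ('x \<Rightarrow> 'x measure) \<Rightarrow> 'v \<times> 'x \<Rightarrow> ('v \<times> 'x) measure" where
  "mech_kernel MV MZ Q = (\<lambda>(v, x). Q x \<bind> (\<lambda>z. return (MV \<Otimes>\<^sub>M MZ) (v, z)))"

lemma law_VZ_eq: "law_VZ MV MZ Q P = P \<bind> mech_kernel MV MZ Q"
  by (simp add: law_VZ_def mech_kernel_def)

locale mechanism =
  fixes MV :: "'v measure" and MX MZ :: "'x measure" and Q :: "'x \<Rightarrow> 'x measure"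
  assumes Q: "Q \<in> MX \<rightarrow>\<^sub>M prob_algebra MZ"
    and nonempty_V: "space MV \<noteq> {}" and nonempty_X: "space MX \<noteq> {}"
begin

lemma return_prob: "return M \<in> M \<rightarrow>\<^sub>M prob_algebra M"
  by (rule measurable_prob_algebraI) (auto intro: prob_space_return)

sublocale markov_kernel "MV \<Otimes>\<^sub>M MX" "MV \<Otimes>\<^sub>M MZ" "mech_kernel MV MZ Q"
proof
  show "mech_kernel MV MZ Q \<in> MV \<Otimes>\<^sub>M MX \<rightarrow>\<^sub>M prob_algebra (MV \<Otimes>\<^sub>M MZ)"
    unfolding mech_kernel_def split_beta'
  proof (rule measurable_bind_prob_space2)
    show "(\<lambda>w. Q (snd w)) \<in> MV \<Otimes>\<^sub>M MX \<rightarrow>\<^sub>M prob_algebra MZ"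
      using Q by measurable
    have "(\<lambda>p. return (MV \<Otimes>\<^sub>M MZ) (fst (fst p), snd p)) \<in> (MV \<Otimes>\<^sub>M MX) \<Otimes>\<^sub>M MZ \<rightarrow>\<^sub>M prob_algebra (MV \<Otimes>\<^sub>M MZ)"
      by (rule measurable_compose[OF _ return_prob]) measurable
    then show "(\<lambda>(w, z). return (MV \<Otimes>\<^sub>M MZ) (fst w, z)) \<in> (MV \<Otimes>\<^sub>M MX) \<Otimes>\<^sub>M MZ \<rightarrow>\<^sub>M prob_algebra (MV \<Otimes>\<^sub>M MZ)"
      by (simp add: split_beta')
  qed
  show "space (MV \<Otimes>\<^sub>M MX) \<noteq> {}"
    using nonempty_V nonempty_X by (simp add: space_pair_measure)
qed

lemma
  assumes "x \<in> space MX"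
  shows prob_space_Q: "prob_space (Q x)" and sets_Q: "sets (Q x) = sets MZ"
    and space_Q: "space (Q x) = space MZ"
proof -
  show "prob_space (Q x)" and s: "sets (Q x) = sets MZ"
    using measurable_space[OF Q assms] by (auto simp: space_prob_algebra)
  then show "space (Q x) = space MZ" by (intro sets_eq_imp_space_eq) simp
qed

lemma Pair_measurable_Q:
  assumes "v \<in> space MV" "x \<in> space MX"
  shows "Pair v \<in> Q x \<rightarrow>\<^sub>M MV \<Otimes>\<^sub>M MZ"
  by (subst measurable_cong_sets[OF sets_Q[OF assms(2)] refl]) (rule measurable_Pair1'[OF assms(1)])

text \<open>For fixed (v, x) the kernel only attaches v to a draw from \<open>Q x\<close>, so
  integrals and null sets reduce to those of \<open>Q x\<close>.\<close>

lemma mech_kernel_eq: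
  assumes "v \<in> space MV" "x \<in> space MX"
  shows "mech_kernel MV MZ Q (v, x) = distr (Q x) (MV \<Otimes>\<^sub>M MZ) (Pair v)"
  unfolding mech_kernel_def
  using bind_return_distr'[OF prob_space.not_empty[OF prob_space_Q[OF assms(2)]] Pair_measurable_Q[OF assms]]
  by simp

lemma nn_integral_mech_kernel:
  assumes "v \<in> space MV" "x \<in> space MX" "f \<in> borel_measurable (MV \<Otimes>\<^sub>M MZ)"
  shows "(\<integral>\<^sup>+w. f w \<partial>mech_kernel MV MZ Q (v, x)) = (\<integral>\<^sup>+z. f (v, z) \<partial>Q x)"
  unfolding mech_kernel_eq[OF assms(1,2)]
  using assms by (intro nn_integral_distr Pair_measurable_Q) simp_all

lemma
  fixes f :: "'v \<times> 'x \<Rightarrow> real"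
  assumes "v \<in> space MV" "x \<in> space MX" and f: "f \<in> borel_measurable (MV \<Otimes>\<^sub>M MZ)"
  shows integral_mech_kernel: "(\<integral>w. f w \<partial>mech_kernel MV MZ Q (v, x)) = Q_op Q f (v, x)"
    and integrable_mech_kernel: "integrable (mech_kernel MV MZ Q (v, x)) f \<longleftrightarrow> integrable (Q x) (\<lambda>z. f (v, z))"
  unfolding mech_kernel_eq[OF assms(1,2)] Q_op_def
  using integral_distr[OF Pair_measurable_Q[OF assms(1,2)] f]
    integrable_distr_eq[OF Pair_measurable_Q[OF assms(1,2)] f] by auto

lemma AE_mech_kernel:
  assumes "v \<in> space MV" "x \<in> space MX" "AE w in mech_kernel MV MZ Q (v, x). R w"
  shows "AE z in Q x. R (v, z)"
  using AE_distrD[OF Pair_measurable_Q[OF assms(1,2)] assms(3)[unfolded mech_kernel_eq[OF assms(1,2)]]] .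

lemma Q_op_measurable [measurable]:
  assumes "f \<in> borel_measurable (MV \<Otimes>\<^sub>M MZ)"
  shows "Q_op Q f \<in> borel_measurable (MV \<Otimes>\<^sub>M MX)"
proof -
  have "Q_op Q f \<in> borel_measurable (MV \<Otimes>\<^sub>M MX) \<longleftrightarrow>
      (\<lambda>y. \<integral>w. f w \<partial>mech_kernel MV MZ Q y) \<in> borel_measurable (MV \<Otimes>\<^sub>M MX)"
    using assms by (intro measurable_cong) (auto simp: space_pair_measure integral_mech_kernel)
  then show ?thesis using integral_kernel_measurable[OF assms] by simp
qed

context
  fixes P :: "('v \<times> 'x) measure"
  assumes P: "P \<in> space (prob_algebra (MV \<Otimes>\<^sub>M MX))"
begin

lemma space_P_pair: "space P = space MV \<times> space MX"
  using space_P[OF P] by (simp add: space_pair_measure)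

lemma Q_op_L2:
  assumes "f \<in> L2 (P \<bind> mech_kernel MV MZ Q)"
  shows "Q_op Q f \<in> L2 P"
proof -
  have f: "f \<in> borel_measurable (MV \<Otimes>\<^sub>M MZ)"
    by (rule iffD1[OF measurable_bind_kernel[OF sets_P[OF P]] L2_measurable[OF assms]])
  have m: "Q_op Q f \<in> borel_measurable P"
    using Q_op_measurable[OF f] by (simp cong: measurable_cong_sets add: sets_P[OF P])
  have "AE y in P. (\<integral>w. f w \<partial>mech_kernel MV MZ Q y) = Q_op Q f y"
    by (intro AE_I2) (auto simp: space_P_pair integral_mech_kernel f)
  then show ?thesis by (rule L2_AE_cong[OF integral_kernel_L2[OF P assms] m])
qed

lemma fst_measurable_P: "fst \<in> P \<rightarrow>\<^sub>M MV"
  by (subst measurable_cong_sets[OF sets_P[OF P] refl]) (rule measurable_fst)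

lemma fst_measurable_PK: "fst \<in> (P \<bind> mech_kernel MV MZ Q) \<rightarrow>\<^sub>M MV"
  by (subst measurable_cong_sets[OF sets_PK[OF P] refl]) (rule measurable_fst)

text \<open>The mechanism does not touch V. Almost sure statements about V alone therefore pass
  between \<open>P\<close> and the law of (V, Z).\<close>

lemma distr_fst_bind: "distr (P \<bind> mech_kernel MV MZ Q) MV fst = distr P MV fst"
proof (rule measure_eqI)
  fix A assume "A \<in> sets (distr (P \<bind> mech_kernel MV MZ Q) MV fst)"
  then have A: "A \<in> sets MV" by simp
  have [measurable]: "A \<times> space MZ \<in> sets (MV \<Otimes>\<^sub>M MZ)" "A \<times> space MX \<in> sets (MV \<Otimes>\<^sub>M MX)"
    using A by auto
  have sub: "A \<subseteq> space MV" using sets.sets_into_space[OF A] .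
  have "emeasure (distr (P \<bind> mech_kernel MV MZ Q) MV fst) A
      = emeasure (P \<bind> mech_kernel MV MZ Q) (A \<times> space MZ)"
    using A sub fst_measurable_PK
    by (subst emeasure_distr)
       (auto simp: space_bind_kernel[OF sets_P[OF P]] space_pair_measure intro!: arg_cong2[where f = emeasure])
  also have "\<dots> = (\<integral>\<^sup>+y. emeasure (mech_kernel MV MZ Q y) (A \<times> space MZ) \<partial>P)"
    by (rule emeasure_bind_kernel[OF sets_P[OF P]]) measurable
  also have "\<dots> = (\<integral>\<^sup>+y. indicator (A \<times> space MX) y \<partial>P)"
  proof (rule nn_integral_cong)
    fix y assume "y \<in> space P"
    then obtain v x where y: "y = (v, x)" "v \<in> space MV" "x \<in> space MX" by (auto simp: space_P_pair)
    interpret Qx: prob_space "Q x" by (rule prob_space_Q[OF y(3)])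
    have "emeasure (mech_kernel MV MZ Q y) (A \<times> space MZ) = emeasure (Q x) (Pair v -` (A \<times> space MZ) \<inter> space (Q x))"
      unfolding y(1) mech_kernel_eq[OF y(2,3)]
      by (rule emeasure_distr[OF Pair_measurable_Q[OF y(2,3)]]) measurable
    also have "Pair v -` (A \<times> space MZ) \<inter> space (Q x) = (if v \<in> A then space (Q x) else {})"
      using space_Q[OF y(3)] by auto
    finally show "emeasure (mech_kernel MV MZ Q y) (A \<times> space MZ) = indicator (A \<times> space MX) y"
      using y Qx.emeasure_space_1 by (auto simp: indicator_def)
  qed
  also have "\<dots> = emeasure P (A \<times> space MX)"
    by (rule nn_integral_indicator) (simp add: sets_P[OF P])
  also have "\<dots> = emeasure (distr P MV fst) A"
    using A sub fst_measurable_P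
    by (subst emeasure_distr) (auto simp: space_P_pair intro!: arg_cong2[where f = emeasure])
  finally show "emeasure (distr (P \<bind> mech_kernel MV MZ Q) MV fst) A = emeasure (distr P MV fst) A" .
qed simp

text \<open>Both objects describe the same integrals over the joint law of (V, X, Z): the
  conditional expectation is tested on the events {(V, Z) \<in> B}, and integrating z out turns
  these integrals into \<integral> s(y) K y B dP.\<close>

lemma Q_adj_kernel_adj:
  assumes s: "integrable P s" and k: "k \<in> Q_adj MV MX MZ Q P s"
  shows "kernel_adj P s k"
proof -
  let ?N3 = "MV \<Otimes>\<^sub>M MX \<Otimes>\<^sub>M MZ"
  \<comment> \<open>The joint law is the bind of \<open>P\<close> with this kernel, and forgetting x
    gives back the law of (V, Z).\<close>
  define K3 where "K3 = (\<lambda>(v, x). Q x \<bind> (\<lambda>z. return ?N3 (v, x, z)))"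
  interpret K3: markov_kernel "MV \<Otimes>\<^sub>M MX" ?N3 K3
  proof
    show "K3 \<in> MV \<Otimes>\<^sub>M MX \<rightarrow>\<^sub>M prob_algebra ?N3"
      unfolding K3_def split_beta'
    proof (rule measurable_bind_prob_space2)
      show "(\<lambda>w. Q (snd w)) \<in> MV \<Otimes>\<^sub>M MX \<rightarrow>\<^sub>M prob_algebra MZ"
        using Q by measurable
      have "(\<lambda>p. return ?N3 (fst (fst p), snd (fst p), snd p)) \<in> (MV \<Otimes>\<^sub>M MX) \<Otimes>\<^sub>M MZ \<rightarrow>\<^sub>M prob_algebra ?N3"
        by (rule measurable_compose[OF _ return_prob]) measurable
      then show "(\<lambda>(w, z). return ?N3 (fst w, snd w, z)) \<in> (MV \<Otimes>\<^sub>M MX) \<Otimes>\<^sub>M MZ \<rightarrow>\<^sub>M prob_algebra ?N3"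
        by (simp add: split_beta')
    qed
    show "space (MV \<Otimes>\<^sub>M MX) \<noteq> {}" by (rule nonempty)
  qed
  define J where "J = P \<bind> K3"
  have J: "law_VXZ MV MX MZ Q P = J" by (simp add: law_VXZ_def J_def K3_def)
  note sP = sets_P[OF P]
  have sJ[measurable_cong]: "sets J = sets ?N3" unfolding J_def by (rule K3.sets_bind_kernel[OF sP])
  have spJ: "space J = space ?N3" using sJ by (rule sets_eq_imp_space_eq)
  interpret J: prob_space J unfolding J_def by (rule K3.prob_PK[OF P])
  have K3_eq: "K3 (v, x) = distr (Q x) ?N3 (\<lambda>z. (v, x, z))" and
    m3: "(\<lambda>z. (v, x, z)) \<in> Q x \<rightarrow>\<^sub>M ?N3" if "v \<in> space MV" "x \<in> space MX" for v x
  proof -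
    have "(\<lambda>z. (v, x, z)) \<in> MZ \<rightarrow>\<^sub>M ?N3" using that by measurable
    then show m: "(\<lambda>z. (v, x, z)) \<in> Q x \<rightarrow>\<^sub>M ?N3"
      by (subst measurable_cong_sets[OF sets_Q[OF that(2)] refl])
    show "K3 (v, x) = distr (Q x) ?N3 (\<lambda>z. (v, x, z))"
      unfolding K3_def using bind_return_distr'[OF prob_space.not_empty[OF prob_space_Q[OF that(2)]] m] by simp
  qed
  let ?Y = "\<lambda>(v, x, z). (v, z)" and ?h = "\<lambda>(v, x, z). s (v, x)"
  have Y[measurable]: "?Y \<in> ?N3 \<rightarrow>\<^sub>M MV \<Otimes>\<^sub>M MZ" by measurable
  have [measurable]: "s \<in> borel_measurable (MV \<Otimes>\<^sub>M MX)"
    using borel_measurable_integrable[OF s] by (simp cong: measurable_cong_sets add: sP)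
  have h[measurable]: "?h \<in> borel_measurable ?N3" by measurable
  have distr_Y: "distr J (MV \<Otimes>\<^sub>M MZ) ?Y = P \<bind> mech_kernel MV MZ Q"
  proof -
    have "distr J (MV \<Otimes>\<^sub>M MZ) ?Y = P \<bind> (\<lambda>y. distr (K3 y) (MV \<Otimes>\<^sub>M MZ) ?Y)"
      unfolding J_def using prob_space.not_empty[OF prob_P[OF P]]
      by (intro distr_bind[OF K3.kernel_subprob[OF sP] _ Y])
    also have "\<dots> = P \<bind> mech_kernel MV MZ Q"
    proof (rule bind_cong[OF refl])
      fix y assume "y \<in> space P"
      then obtain v x where y: "y = (v, x)" "v \<in> space MV" "x \<in> space MX" by (auto simp: space_P_pair)
      show "distr (K3 y) (MV \<Otimes>\<^sub>M MZ) ?Y = mech_kernel MV MZ Q y"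
        unfolding y(1) K3_eq[OF y(2,3)] mech_kernel_eq[OF y(2,3)]
        by (subst distr_distr[OF Y m3[OF y(2,3)]]) (simp add: comp_def)
    qed
    finally show ?thesis .
  qed
  have hK: "(\<integral>w. f (?Y w) * ?h w \<partial>K3 y) = s y * (\<integral>z. f z \<partial>mech_kernel MV MZ Q y)"
    if f[measurable]: "f \<in> borel_measurable (MV \<Otimes>\<^sub>M MZ)" and yP: "y \<in> space P" for y and f :: "_ \<Rightarrow> real"
  proof -
    obtain v x where y: "y = (v, x)" "v \<in> space MV" "x \<in> space MX" using yP by (auto simp: space_P_pair)
    have "(\<integral>w. f (?Y w) * ?h w \<partial>K3 y) = (\<integral>z. f (v, z) * s (v, x) \<partial>Q x)"
      unfolding y(1) K3_eq[OF y(2,3)] by (subst integral_distr[OF m3[OF y(2,3)]]) simp_all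
    then show ?thesis
      by (simp add: y(1) integral_mech_kernel[OF y(2,3) f] Q_op_def mult.commute)
  qed
  have nnh: "(\<integral>\<^sup>+w. ennreal \<bar>?h w\<bar> \<partial>K3 y) = ennreal \<bar>s y\<bar>" if yP: "y \<in> space P" for y
  proof -
    obtain v x where y: "y = (v, x)" "v \<in> space MV" "x \<in> space MX" using yP by (auto simp: space_P_pair)
    have "(\<integral>\<^sup>+w. ennreal \<bar>?h w\<bar> \<partial>K3 y) = (\<integral>\<^sup>+z. ennreal \<bar>s (v, x)\<bar> \<partial>Q x)"
      unfolding y(1) K3_eq[OF y(2,3)] by (subst nn_integral_distr[OF m3[OF y(2,3)]]) simp_all
    then show ?thesis using prob_space.emeasure_space_1[OF prob_space_Q[OF y(3)]] by (simp add: y(1))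
  qed
  have "(\<integral>\<^sup>+w. ennreal \<bar>?h w\<bar> \<partial>J) = (\<integral>\<^sup>+y. ennreal \<bar>s y\<bar> \<partial>P)"
    unfolding J_def by (subst K3.nn_integral_bind_kernel[OF sP]) (auto intro!: nn_integral_cong nnh)
  also have "\<dots> < \<infinity>" using s by (simp add: integrable_iff_bounded)
  finally have hi: "integrable J ?h"
    by (simp add: integrable_iff_bounded cong: measurable_cong_sets add: sJ)
  define F where "F = vimage_algebra (space J) ?Y (MV \<Otimes>\<^sub>M MZ)"
  have YJ: "?Y \<in> J \<rightarrow>\<^sub>M MV \<Otimes>\<^sub>M MZ" by measurable
  interpret F: finite_measure_subalgebra J F
  proof
    show "subalgebra J F"
      unfolding subalgebra_def F_def
      using measurable_sets[OF YJ] measurable_space[OF YJ] by (auto simp: sets_vimage_algebra2)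
  qed
  have km[measurable]: "k \<in> borel_measurable (MV \<Otimes>\<^sub>M MZ)"
    and kae: "AE w in J. k (?Y w) = real_cond_exp J F ?h w"
    using k by (simp_all add: Q_adj_def cond_exp_version_def J F_def)
  have rc: "integrable J (real_cond_exp J F ?h)" by (rule F.real_cond_exp_int(1)[OF hi])
  have kY: "(\<lambda>w. k (?Y w)) \<in> borel_measurable J" by measurable
  have kYi: "integrable J (\<lambda>w. k (?Y w))"
    using integrable_cong_AE[OF kY borel_measurable_integrable[OF rc] kae] rc by simp
  then have ki: "integrable (P \<bind> mech_kernel MV MZ Q) k"
    unfolding distr_Y[symmetric] using integrable_distr_eq[OF YJ km] by simp
  show ?thesis
    unfolding kernel_adj_def
  proof (intro conjI ballI km ki)
    fix B assume B[measurable]: "B \<in> sets (MV \<Otimes>\<^sub>M MZ)"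
    let ?A = "?Y -` B \<inter> space J"
    have A: "?A \<in> sets F" unfolding F_def using B measurable_space[OF YJ] by (auto simp: sets_vimage_algebra2)
    have AJ: "?A \<in> sets J" using measurable_sets[OF YJ B] .
    have "(\<integral>z. indicator B z * k z \<partial>(P \<bind> mech_kernel MV MZ Q)) = (\<integral>w. indicator B (?Y w) * k (?Y w) \<partial>J)"
      unfolding distr_Y[symmetric] by (rule integral_distr[OF YJ]) measurable
    also have "\<dots> = (\<integral>w\<in>?A. k (?Y w) \<partial>J)"
      unfolding set_lebesgue_integral_def
      by (intro Bochner_Integration.integral_cong) (auto simp: indicator_def)
    also have "\<dots> = (\<integral>w\<in>?A. real_cond_exp J F ?h w \<partial>J)"
      unfolding set_lebesgue_integral_def
      using kae kY borel_measurable_integrable[OF rc] AJ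
      by (intro integral_cong_AE) auto
    also have "\<dots> = (\<integral>w\<in>?A. ?h w \<partial>J)"
      by (rule F.real_cond_exp_intA[OF hi A, symmetric])
    also have "\<dots> = (\<integral>w. indicator B (?Y w) * ?h w \<partial>J)"
      unfolding set_lebesgue_integral_def
      by (intro Bochner_Integration.integral_cong) (auto simp: indicator_def)
    also have "\<dots> = (\<integral>y. (\<integral>w. indicator B (?Y w) * ?h w \<partial>K3 y) \<partial>P)"
      unfolding J_def
    proof (rule K3.integral_bind_kernel[OF sP])
      have "integrable J (\<lambda>w. indicator ?A w *\<^sub>R ?h w)" by (rule integrable_mult_indicator[OF AJ hi])
      then have "integrable J (\<lambda>w. indicator B (?Y w) * ?h w)"
        by (rule Bochner_Integration.integrable_cong[THEN iffD1, rotated -1]) (auto simp: indicator_def)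
      then show "integrable (P \<bind> K3) (\<lambda>w. indicator B (?Y w) * ?h w)" by (simp add: J_def)
    qed
    also have "\<dots> = (\<integral>y. s y * measure (mech_kernel MV MZ Q y) B \<partial>P)"
    proof (rule Bochner_Integration.integral_cong)
      fix y assume y: "y \<in> space P"
      have "(\<integral>w. indicator B (?Y w) * ?h w \<partial>K3 y) = s y * (\<integral>z. indicator B z \<partial>mech_kernel MV MZ Q y)"
        by (rule hK[OF _ y]) measurable
      then show "(\<integral>w. indicator B (?Y w) * ?h w \<partial>K3 y) = s y * measure (mech_kernel MV MZ Q y) B"
        using y B by (simp add: sets_kernel space_P[OF P])
    qed simp
    finally show "(\<integral>z. indicator B z * k z \<partial>(P \<bind> mech_kernel MV MZ Q))
        = (\<integral>y. s y * measure (mech_kernel MV MZ Q y) B \<partial>P)" .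
  qed
qed

end

end

section \<open>Mixture mechanisms\<close>

locale mixture_mechanism = mechanism MV MX MZ Q
  for MV :: "'v measure" and MX MZ :: "'x measure" and Q +
  fixes \<alpha> :: real and Qbar :: "'x measure"
  assumes presents: "presents MX MZ Q (Mixture \<alpha> Qbar)"
begin

lemma alpha: "0 < \<alpha>" "\<alpha> < 1" and sets_MZ: "sets MZ = sets MX"
  and Qbar: "sets Qbar = sets MX" "prob_space Qbar"
  using presents by (auto simp: space_prob_algebra)

sublocale Qbar: prob_space Qbar by (rule Qbar)

lemma space_Qbar: "space Qbar = space MX" and space_MZ: "space MZ = space MX"
  using Qbar sets_MZ by (auto dest: sets_eq_imp_space_eq)

text \<open>Pure noise is a mechanism in its own right, whose kernel \<open>K'\<close> ignores x.
  The kernel \<open>K\<close> is \<alpha> times the identity plus 1 - \<alpha> times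
  \<open>K'\<close>, and all results on mechanisms are available for \<open>K'\<close>.\<close>

sublocale noise: mechanism MV MX MX "\<lambda>_. Qbar"
  using Qbar nonempty_V nonempty_X by unfold_locales (auto simp: space_prob_algebra)

abbreviation "K \<equiv> mech_kernel MV MZ Q"
abbreviation "K' \<equiv> mech_kernel MV MX (\<lambda>_. Qbar)"

lemma sets_VZ: "sets (MV \<Otimes>\<^sub>M MZ) = sets (MV \<Otimes>\<^sub>M MX)"
  by (rule sets_pair_measure_cong) (simp_all add: sets_MZ)

lemma borel_VZ: "borel_measurable (MV \<Otimes>\<^sub>M MZ) = borel_measurable (MV \<Otimes>\<^sub>M MX)"
  by (rule measurable_cong_sets) (simp_all add: sets_VZ)

lemma emeasure_Q:
  assumes x: "x \<in> space MX" and B: "B \<in> sets MX"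
  shows "emeasure (Q x) B = ennreal \<alpha> * emeasure (return MX x) B + ennreal (1 - \<alpha>) * emeasure Qbar B"
proof -
  interpret Qx: prob_space "Q x" by (rule prob_space_Q[OF x])
  interpret R: prob_space "return MX x" by (rule prob_space_return[OF x])
  have "measure (Q x) B = \<alpha> * measure (return MX x) B + (1 - \<alpha>) * measure Qbar B"
    using presents x B by simp
  then show ?thesis
    using alpha
    by (simp add: Qx.emeasure_eq_measure R.emeasure_eq_measure Qbar.emeasure_eq_measure
        ennreal_plus ennreal_mult)
qed

lemma nn_integral_Q:
  assumes x: "x \<in> space MX" and f: "f \<in> borel_measurable MX"
  shows "(\<integral>\<^sup>+z. f z \<partial>Q x) = ennreal \<alpha> * f x + ennreal (1 - \<alpha>) * (\<integral>\<^sup>+z. f z \<partial>Qbar)"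
proof -
  have "(\<integral>\<^sup>+z. f z \<partial>Q x) = ennreal \<alpha> * (\<integral>\<^sup>+z. f z \<partial>return MX x) + ennreal (1 - \<alpha>) * (\<integral>\<^sup>+z. f z \<partial>Qbar)"
    using emeasure_Q[OF x] f
    by (intro nn_integral_mixture)
       (auto simp: sets_Q[OF x] sets_MZ Qbar cong: measurable_cong_sets)
  then show ?thesis using x f by (simp add: nn_integral_return)
qed

text \<open>Integrability of the section keeps the Bochner integrals away from their default value
  0; in the applications it holds for almost every v, hence its role as a hypothesis.\<close>

lemma Q_op_mixture:
  assumes v: "v \<in> space MV" and x: "x \<in> space MX" and f: "f \<in> borel_measurable (MV \<Otimes>\<^sub>M MX)"
    and i: "integrable Qbar (\<lambda>z. f (v, z))"
  shows "Q_op Q f (v, x) = \<alpha> * f (v, x) + (1 - \<alpha>) * (\<integral>z. f (v, z) \<partial>Qbar)"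
proof -
  have m: "(\<lambda>z. f (v, z)) \<in> borel_measurable MX"
    using measurable_compose[OF measurable_Pair1'[OF v] f] .
  have "integrable (return MX x) (\<lambda>z. f (v, z))"
    using m x by (simp add: integrable_iff_bounded nn_integral_return)
  then have "(\<integral>z. f (v, z) \<partial>Q x) = \<alpha> * (\<integral>z. f (v, z) \<partial>return MX x) + (1 - \<alpha>) * (\<integral>z. f (v, z) \<partial>Qbar)"
    using emeasure_Q[OF x] alpha i
    by (intro integral_mixture) (auto simp: sets_Q[OF x] sets_MZ Qbar)
  then show ?thesis using m x by (simp add: Q_op_def integral_return)
qed

lemma Q_inv_mixture_eq:
  "Q_inv Q (Mixture \<alpha> Qbar) h = (\<lambda>w. 1 / \<alpha> * h w - (1 - \<alpha>) / \<alpha> * Q_op (\<lambda>_. Qbar) h w)"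
  by (auto simp: Q_op_def)

lemma Q_inv_mixture_measurable:
  assumes "h \<in> borel_measurable (MV \<Otimes>\<^sub>M MX)"
  shows "Q_inv Q (Mixture \<alpha> Qbar) h \<in> borel_measurable (MV \<Otimes>\<^sub>M MX)"
  unfolding Q_inv_mixture_eq
  by (intro borel_measurable_diff borel_measurable_times borel_measurable_const assms
      noise.Q_op_measurable[OF assms])

context
  fixes P :: "('v \<times> 'x) measure"
  assumes P: "P \<in> space (prob_algebra (MV \<Otimes>\<^sub>M MX))"
begin

text \<open>The law of (V, Z) is a mixture of \<open>P\<close> and the noise law, so null sets and
  square integrability under it can be checked on the two components.\<close>

lemma nn_integral_bind_mixture:
  assumes f: "f \<in> borel_measurable (MV \<Otimes>\<^sub>M MX)"
  shows "(\<integral>\<^sup>+w. f w \<partial>(P \<bind> K)) = ennreal \<alpha> * (\<integral>\<^sup>+w. f w \<partial>P) + ennreal (1 - \<alpha>) * (\<integral>\<^sup>+w. f w \<partial>(P \<bind> K'))"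
proof -
  note [measurable_cong] = sets_P[OF P]
  have [measurable]: "f \<in> borel_measurable P" "(\<lambda>y. \<integral>\<^sup>+w. f w \<partial>K' y) \<in> borel_measurable P"
    using f noise.nn_integral_kernel_measurable[OF f] by (simp_all cong: measurable_cong_sets add: sets_P[OF P])
  have "(\<integral>\<^sup>+w. f w \<partial>(P \<bind> K)) = (\<integral>\<^sup>+y. (\<integral>\<^sup>+w. f w \<partial>K y) \<partial>P)"
    by (rule nn_integral_bind_kernel[OF sets_P[OF P]]) (use f in \<open>simp add: borel_VZ\<close>)
  also have "\<dots> = (\<integral>\<^sup>+y. ennreal \<alpha> * f y + ennreal (1 - \<alpha>) * (\<integral>\<^sup>+w. f w \<partial>K' y) \<partial>P)"
  proof (rule nn_integral_cong)
    fix y assume "y \<in> space P"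
    then obtain v x where y: "y = (v, x)" "v \<in> space MV" "x \<in> space MX" by (auto simp: space_P_pair[OF P])
    have m: "(\<lambda>z. f (v, z)) \<in> borel_measurable MX"
      using measurable_compose[OF measurable_Pair1'[OF y(2)] f] .
    show "(\<integral>\<^sup>+w. f w \<partial>K y) = ennreal \<alpha> * f y + ennreal (1 - \<alpha>) * (\<integral>\<^sup>+w. f w \<partial>K' y)"
      unfolding y(1) using f y
      by (simp add: nn_integral_mech_kernel noise.nn_integral_mech_kernel borel_VZ nn_integral_Q[OF y(3) m])
  qed
  also have "\<dots> = ennreal \<alpha> * (\<integral>\<^sup>+w. f w \<partial>P) + ennreal (1 - \<alpha>) * (\<integral>\<^sup>+y. (\<integral>\<^sup>+w. f w \<partial>K' y) \<partial>P)"
    by (simp add: nn_integral_add nn_integral_cmult)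
  finally show ?thesis by (simp add: noise.nn_integral_bind_kernel[OF sets_P[OF P] f])
qed

lemma sets_bind_eq: "sets (P \<bind> K) = sets P" "sets (P \<bind> K') = sets P"
  by (simp_all add: sets_PK[OF P] noise.sets_PK[OF P] sets_P[OF P] sets_VZ)

lemma AE_bind_mixture:
  assumes "AE w in P. R w" "AE w in P \<bind> K'. R w"
  shows "AE w in P \<bind> K. R w"
proof (rule AE_mixture[OF _ _ _ assms])
  show "sets P = sets (P \<bind> K)" "sets (P \<bind> K') = sets (P \<bind> K)" by (simp_all add: sets_bind_eq)
  fix A assume "A \<in> sets (P \<bind> K)"
  then have A: "A \<in> sets (MV \<Otimes>\<^sub>M MX)" by (simp add: sets_bind_eq sets_P[OF P])
  then have "(indicator A :: _ \<Rightarrow> ennreal) \<in> borel_measurable (MV \<Otimes>\<^sub>M MX)" by simp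
  from nn_integral_bind_mixture[OF this] A
  show "emeasure (P \<bind> K) A = ennreal \<alpha> * emeasure P A + ennreal (1 - \<alpha>) * emeasure (P \<bind> K') A"
    by (simp add: sets_bind_eq sets_P[OF P])
qed

text \<open>Both weights are positive, so the second moment is finite if and only if it is finite
  for both components; a nonmeasurable f fails on both sides.\<close>

lemma L2_bind_mixture: "f \<in> L2 (P \<bind> K) \<longleftrightarrow> f \<in> L2 P \<and> f \<in> L2 (P \<bind> K')"
proof (cases "f \<in> borel_measurable (MV \<Otimes>\<^sub>M MX)")
  case True
  then have m: "f \<in> borel_measurable P" "f \<in> borel_measurable (P \<bind> K')" "f \<in> borel_measurable (P \<bind> K)"
    by (simp_all cong: measurable_cong_sets add: sets_bind_eq sets_P[OF P])
  have sq: "(\<lambda>w. ennreal ((f w)\<^sup>2)) \<in> borel_measurable (MV \<Otimes>\<^sub>M MX)" using True by measurable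
  show ?thesis
    using alpha by (auto simp: L2_iff_nn m nn_integral_bind_mixture[OF sq] ennreal_mult_less_top)
next
  case False
  then have "f \<notin> borel_measurable P" "f \<notin> borel_measurable (P \<bind> K)"
    by (simp_all cong: measurable_cong_sets add: sets_bind_eq sets_P[OF P])
  then show ?thesis by (auto simp: L2_def)
qed

text \<open>\<open>K'\<close> ignores x, so only the marginal of V survives, and the section formula
  for product measures applies.\<close>

lemma bind_noise: "P \<bind> K' = distr P MV fst \<Otimes>\<^sub>M Qbar"
proof (rule measure_eqI)
  have s: "sets (distr P MV fst \<Otimes>\<^sub>M Qbar) = sets (MV \<Otimes>\<^sub>M MX)"
    by (rule sets_pair_measure_cong) (simp_all add: Qbar)
  show "sets (P \<bind> K') = sets (distr P MV fst \<Otimes>\<^sub>M Qbar)"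
    by (simp only: noise.sets_PK[OF P] s)
  fix A assume "A \<in> sets (P \<bind> K')"
  then have A: "A \<in> sets (MV \<Otimes>\<^sub>M MX)" by (simp add: noise.sets_PK[OF P])
  have sec: "Pair v -` A \<in> sets MX" for v using A by (rule sets_Pair1)
  have A': "A \<in> sets (distr P MV fst \<Otimes>\<^sub>M Qbar)" using A s by simp
  have m: "(\<lambda>v. emeasure Qbar (Pair v -` A)) \<in> borel_measurable MV"
    using Qbar.measurable_emeasure_Pair[OF A'] by (simp cong: measurable_cong_sets)
  have "emeasure (P \<bind> K') A = (\<integral>\<^sup>+y. emeasure (K' y) A \<partial>P)"
    by (rule noise.emeasure_bind_kernel[OF sets_P[OF P] A])
  also have "\<dots> = (\<integral>\<^sup>+y. emeasure Qbar (Pair (fst y) -` A) \<partial>P)"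
  proof (rule nn_integral_cong)
    fix y assume "y \<in> space P"
    then obtain v x where y: "y = (v, x)" "v \<in> space MV" "x \<in> space MX" by (auto simp: space_P_pair[OF P])
    have "Pair v -` A \<inter> space Qbar = Pair v -` A"
      using sets.sets_into_space[OF sec] by (auto simp: space_Qbar)
    then show "emeasure (K' y) A = emeasure Qbar (Pair (fst y) -` A)"
      unfolding y(1) noise.mech_kernel_eq[OF y(2,3)]
      using emeasure_distr[OF noise.Pair_measurable_Q[OF y(2,3)] A] by simp
  qed
  also have "\<dots> = (\<integral>\<^sup>+v. emeasure Qbar (Pair v -` A) \<partial>distr P MV fst)"
    by (rule nn_integral_distr[symmetric]) (use m in \<open>simp_all add: fst_measurable_P[OF P]\<close>)
  also have "\<dots> = emeasure (distr P MV fst \<Otimes>\<^sub>M Qbar) A"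
    by (rule Qbar.emeasure_pair_measure_alt[OF A', symmetric])
  finally show "emeasure (P \<bind> K') A = emeasure (distr P MV fst \<Otimes>\<^sub>M Qbar) A" .
qed

text \<open>With c = \<integral> k(v, z) Qbar(dz) one has h = \<alpha> k + (1 - \<alpha>) c, whose
  Qbar-integral is c again; subtracting (1 - \<alpha>)/\<alpha> times c from h/\<alpha> leaves k.
  The equation under the noise law is what permits integrating h over Qbar.\<close>

lemma Q_inv_Q_op_P:
  assumes k: "k \<in> L2 (P \<bind> K')" and h: "h \<in> borel_measurable (MV \<Otimes>\<^sub>M MX)"
    and eq: "AE w in P. h w = Q_op Q k w" "AE w in P \<bind> K'. h w = Q_op Q k w"
  shows "AE w in P. Q_inv Q (Mixture \<alpha> Qbar) h w = k w"
proof -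
  have km: "k \<in> borel_measurable (MV \<Otimes>\<^sub>M MX)"
    by (rule iffD1[OF noise.measurable_bind_kernel[OF sets_P[OF P]] L2_measurable[OF k]])
  show ?thesis
    using eq(1) noise.AE_bind_kernel[OF sets_P[OF P] eq(2)]
      noise.AE_integrable_kernel[OF sets_P[OF P] L2_integrable[OF noise.finite_PK[OF P] k]] AE_space
  proof eventually_elim
    case (elim y)
    then obtain v x where y: "y = (v, x)" "v \<in> space MV" "x \<in> space MX" by (auto simp: space_P_pair[OF P])
    let ?c = "\<integral>z. k (v, z) \<partial>Qbar"
    have i: "integrable Qbar (\<lambda>z. k (v, z))"
      using elim(3) noise.integrable_mech_kernel[OF y(2,3) km] by (simp add: y(1))
    have mk: "(\<lambda>z. k (v, z)) \<in> borel_measurable Qbar" using i by (rule borel_measurable_integrable)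
    have mh: "(\<lambda>z. h (v, z)) \<in> borel_measurable Qbar"
      using measurable_compose[OF measurable_Pair1'[OF y(2)] h] by (simp cong: measurable_cong_sets add: Qbar)
    note op = Q_op_mixture[OF y(2) _ km i]
    have "AE z in Qbar. h (v, z) = Q_op Q k (v, z)"
      by (rule noise.AE_mech_kernel[OF y(2,3) elim(2)[unfolded y(1)]])
    then have "AE z in Qbar. h (v, z) = \<alpha> * k (v, z) + (1 - \<alpha>) * ?c"
      using AE_space by eventually_elim (simp add: op space_Qbar)
    then have "(\<integral>z. h (v, z) \<partial>Qbar) = (\<integral>z. \<alpha> * k (v, z) + (1 - \<alpha>) * ?c \<partial>Qbar)"
      using mk mh by (intro integral_cong_AE) auto
    also have "\<dots> = ?c" using i by (simp add: Qbar.prob_space algebra_simps)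
    finally have "(\<integral>z. h (v, z) \<partial>Qbar) = ?c" .
    moreover have "h (v, x) = \<alpha> * k (v, x) + (1 - \<alpha>) * ?c"
      using elim(1) by (simp add: y(1) op[OF y(3)])
    ultimately show ?case using alpha by (simp add: y(1) field_simps)
  qed
qed

text \<open>\<open>Q_inv\<close> preserves the Qbar-average c of a section, so the two terms (1 -
  \<alpha>) c cancel.\<close>

lemma Q_op_Q_inv_mixture:
  assumes h: "h \<in> L2 (P \<bind> K')"
  shows "AE w in P. Q_op Q (Q_inv Q (Mixture \<alpha> Qbar) h) w = h w"
proof -
  have hm: "h \<in> borel_measurable (MV \<Otimes>\<^sub>M MX)"
    by (rule iffD1[OF noise.measurable_bind_kernel[OF sets_P[OF P]] L2_measurable[OF h]])
  have qm: "Q_inv Q (Mixture \<alpha> Qbar) h \<in> borel_measurable (MV \<Otimes>\<^sub>M MX)"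
    by (rule Q_inv_mixture_measurable[OF hm])
  show ?thesis
    using noise.AE_integrable_kernel[OF sets_P[OF P] L2_integrable[OF noise.finite_PK[OF P] h]] AE_space
  proof eventually_elim
    case (elim y)
    then obtain v x where y: "y = (v, x)" "v \<in> space MV" "x \<in> space MX" by (auto simp: space_P_pair[OF P])
    have i: "integrable Qbar (\<lambda>z. h (v, z))"
      using elim(1) noise.integrable_mech_kernel[OF y(2,3) hm] by (simp add: y(1))
    then have i': "integrable Qbar (\<lambda>z. Q_inv Q (Mixture \<alpha> Qbar) h (v, z))" by simp
    show ?case
      unfolding y(1) Q_op_mixture[OF y(2,3) qm i'] using i alpha
      by (simp add: Qbar.prob_space field_simps)
  qed
qed

end

end

lemma L2_indicator:
  assumes "finite_measure M" "E \<in> sets M"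
  shows "indicator E \<in> L2 M"
proof -
  interpret finite_measure M by fact
  have "(\<lambda>w. (indicator E w :: real)\<^sup>2) = indicator E" by (auto simp: indicator_def)
  then show ?thesis using assms(2) by (simp add: L2_def less_top[symmetric])
qed

context mixture_mechanism
begin

context
  fixes P :: "('v \<times> 'x) measure"
  assumes P: "P \<in> space (prob_algebra (MV \<Otimes>\<^sub>M MX))"
begin

lemma noise_law: "P \<bind> K' \<in> space (prob_algebra (MV \<Otimes>\<^sub>M MX))"
  by (rule noise.bind_kernel_prob_algebra[OF P])

text \<open>Replacing X by independent noise twice is the same as doing it once. Statements proved
  for a general law can thus be applied to the noise law without introducing further
  components.\<close>

lemma noise_idem: "P \<bind> K' \<bind> K' = P \<bind> K'"
  by (simp add: bind_noise[OF noise_law] noise.distr_fst_bind[OF P] flip: bind_noise[OF P])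

lemma inv_domain_mixture: "inv_domain MV MZ Q P (Mixture \<alpha> Qbar) = L2 (P \<bind> K)"
  by (auto simp: L2_bind_mixture[OF P] bind_noise[OF P])

lemma Q_op_L2_mixture:
  assumes "k \<in> L2 (P \<bind> K)"
  shows "Q_op Q k \<in> L2 (P \<bind> K)"
proof -
  have k: "k \<in> L2 (P \<bind> K')" using assms by (simp add: L2_bind_mixture[OF P])
  then have "k \<in> L2 (P \<bind> K' \<bind> K)" by (simp add: L2_bind_mixture[OF noise_law] noise_idem)
  then show ?thesis
    using Q_op_L2[OF P assms] Q_op_L2[OF noise_law] by (simp add: L2_bind_mixture[OF P])
qed

lemma Q_inv_Q_op_mixture:
  assumes k: "k \<in> L2 (P \<bind> K)" and h: "h \<in> borel_measurable (MV \<Otimes>\<^sub>M MX)"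
    and eq: "inv_equal MV MX P (Mixture \<alpha> Qbar) h (Q_op Q k)"
  shows "AE w in P \<bind> K. Q_inv Q (Mixture \<alpha> Qbar) h w = k w"
    and "h \<in> inv_domain MV MZ Q P (Mixture \<alpha> Qbar)"
    and "AE w in P. h w = Q_op Q k w"
proof -
  have e1: "AE w in P. h w = Q_op Q k w" and e2: "AE w in P \<bind> K'. h w = Q_op Q k w"
    using eq unfolding bind_noise[OF P] by simp_all
  show "AE w in P. h w = Q_op Q k w" by (rule e1)
  have k': "k \<in> L2 (P \<bind> K')" using k by (simp add: L2_bind_mixture[OF P])
  show "AE w in P \<bind> K. Q_inv Q (Mixture \<alpha> Qbar) h w = k w"
  proof (rule AE_bind_mixture[OF P])
    show "AE w in P. Q_inv Q (Mixture \<alpha> Qbar) h w = k w"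
      by (rule Q_inv_Q_op_P[OF P k' h e1 e2])
    \<comment> \<open>The noise law takes the place of \<open>P\<close>; idempotence turns the
      hypotheses about its own noise law into those at hand.\<close>
    show "AE w in P \<bind> K'. Q_inv Q (Mixture \<alpha> Qbar) h w = k w"
      by (rule Q_inv_Q_op_P[OF noise_law _ h e2]) (unfold noise_idem, rule k', rule e2)
  qed
  have "AE w in P \<bind> K. h w = Q_op Q k w" by (rule AE_bind_mixture[OF P e1 e2])
  then have "AE w in P \<bind> K. Q_op Q k w = h w" by eventually_elim simp
  moreover have "h \<in> borel_measurable (P \<bind> K)"
    using h by (simp cong: measurable_cong_sets add: sets_bind_eq[OF P] sets_P[OF P])
  ultimately show "h \<in> inv_domain MV MZ Q P (Mixture \<alpha> Qbar)"
    unfolding inv_domain_mixture by (intro L2_AE_cong[OF Q_op_L2_mixture[OF k]])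
qed

lemma Q_inv_L2_mixture:
  assumes h: "h \<in> L2 (P \<bind> K)"
  shows "Q_inv Q (Mixture \<alpha> Qbar) h \<in> L2 (P \<bind> K)"
proof -
  have h': "h \<in> L2 (P \<bind> K')" using h by (simp add: L2_bind_mixture[OF P])
  then have "h \<in> L2 (P \<bind> K' \<bind> K')" by (simp add: noise_idem)
  then have "Q_op (\<lambda>_. Qbar) h \<in> L2 (P \<bind> K)"
    using noise.Q_op_L2[OF P h'] noise.Q_op_L2[OF noise_law] by (simp add: L2_bind_mixture[OF P])
  then show ?thesis unfolding Q_inv_mixture_eq by (intro L2_diff L2_scale h)
qed

end

end

section \<open>Invertible mechanisms on finite spaces\<close>

locale finite_mechanism = mechanism MV MX MZ Q
  for MV :: "'v measure" and MX MZ :: "'x measure" and Q +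
  fixes J :: nat and x z :: "nat \<Rightarrow> 'x"
  assumes presents: "presents MX MZ Q (Finite J x z)"
begin

abbreviation "K \<equiv> mech_kernel MV MZ Q"

abbreviation "A \<equiv> mech_matrix J x z Q"

definition "B = the (mat_inverse (transpose_mat A))"

lemma x: "bij_betw x {..<J} (space MX)" "sets MX = Pow (space MX)"
  and z: "bij_betw z {..<J} (space MZ)" "sets MZ = Pow (space MZ)"
  and invertible: "invertible_mat A"
  using presents by auto

lemma x_in: "k < J \<Longrightarrow> x k \<in> space MX" and z_in: "j < J \<Longrightarrow> z j \<in> space MZ"
  using x(1) z(1) by (auto simp: bij_betw_def)

text \<open>\<open>mat_inverse\<close> returns an option, so \<open>the\<close> is meaningful only
  once \<open>None\<close> is excluded. The transpose of an inverse C of the mechanism matrix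
  exhibits the transposed matrix as a unit of the matrix ring, which does so.\<close>

lemma mat_B: "B \<in> carrier_mat J J" "B * transpose_mat A = 1\<^sub>m J" "transpose_mat A * B = 1\<^sub>m J"
proof -
  have A: "A \<in> carrier_mat J J" by (simp add: mech_matrix_def)
  obtain C where C: "A * C = 1\<^sub>m J" "C * A = 1\<^sub>m (dim_row C)"
    using invertible A by (auto simp: invertible_mat_def inverts_mat_def)
  have "dim_col C = J" using arg_cong[OF C(1), of dim_col] by simp
  moreover have "dim_row C = J" using arg_cong[OF C(2), of dim_col] A by simp
  ultimately have Cc: "C \<in> carrier_mat J J" by auto
  then have C2: "C * A = 1\<^sub>m J" using C(2) by simp
  have "transpose_mat A * transpose_mat C = 1\<^sub>m J" "transpose_mat C * transpose_mat A = 1\<^sub>m J"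
    unfolding transpose_mult[OF Cc A, symmetric] transpose_mult[OF A Cc, symmetric] C(1) C2
    by simp_all
  then have "transpose_mat A \<in> Units (ring_mat TYPE(real) J ())"
    using A Cc by (auto simp: Units_def ring_mat_def intro!: bexI[of _ "transpose_mat C"])
  moreover have At: "transpose_mat A \<in> carrier_mat J J" using A by simp
  ultimately obtain D where D: "mat_inverse (transpose_mat A) = Some D"
    using mat_inverse(1)[OF At, where b = "()"] by (cases "mat_inverse (transpose_mat A)") auto
  then show "B \<in> carrier_mat J J" "B * transpose_mat A = 1\<^sub>m J" "transpose_mat A * B = 1\<^sub>m J"
    using mat_inverse(2)[OF At D] by (auto simp: B_def)
qed

lemma B_Q:
  assumes "i < J" "j < J"
  shows "(\<Sum>k<J. B $$ (i, k) * measure (Q (x k)) {z j}) = (if i = j then 1 else 0)"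
proof -
  have "(B * transpose_mat A) $$ (i, j) = (\<Sum>k<J. B $$ (i, k) * measure (Q (x k)) {z j})"
    using assms mat_B(1)
    by (auto simp: scalar_prod_def mech_matrix_def atLeast0LessThan intro!: sum.cong)
  then show ?thesis using assms by (simp add: mat_B(2))
qed

lemma Q_B:
  assumes "l < J" "k < J"
  shows "(\<Sum>j<J. measure (Q (x l)) {z j} * B $$ (j, k)) = (if l = k then 1 else 0)"
proof -
  have "(transpose_mat A * B) $$ (l, k) = (\<Sum>j<J. measure (Q (x l)) {z j} * B $$ (j, k))"
    using assms mat_B(1)
    by (auto simp: scalar_prod_def mech_matrix_def atLeast0LessThan intro!: sum.cong)
  then show ?thesis using assms by (simp add: mat_B(3))
qed

lemma Q_op_finite:
  assumes "l < J"
  shows "Q_op Q f (v, x l) = (\<Sum>j<J. measure (Q (x l)) {z j} * f (v, z j))"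
proof -
  interpret Ql: prob_space "Q (x l)" by (rule prob_space_Q[OF x_in[OF assms]])
  have sp: "space (Q (x l)) = space MZ" "sets (Q (x l)) = Pow (space MZ)"
    using space_Q sets_Q x_in[OF assms] z(2) by auto
  have "finite (space MZ)" using z(1) bij_betw_finite by blast
  then have "Q_op Q f (v, x l) = (\<Sum>a\<in>space MZ. measure (Q (x l)) {a} * f (v, a))"
    unfolding Q_op_def by (simp add: integral_finite_discrete[OF Ql.finite_measure_axioms] sp)
  also have "\<dots> = (\<Sum>j<J. measure (Q (x l)) {z j} * f (v, z j))"
    by (rule sum.reindex_bij_betw[OF z(1), symmetric])
  finally show ?thesis .
qed

lemma Q_inv_finite:
  assumes "i < J"
  shows "Q_inv Q (Finite J x z) h (v, z i) = (\<Sum>k<J. B $$ (i, k) * h (v, x k))"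
  using assms z(1) by (simp add: B_def the_inv_into_f_f bij_betw_def)

text \<open>The transposed mechanism matrix times \<open>B\<close> is the identity; unlike in the
  mixture case there are no exceptional points.\<close>

lemma Q_op_Q_inv_finite:
  assumes "y \<in> space MX"
  shows "Q_op Q (Q_inv Q (Finite J x z) h) (v, y) = h (v, y)"
proof -
  obtain l where l: "l < J" "y = x l" using assms x(1) by (auto simp: bij_betw_def)
  have "Q_op Q (Q_inv Q (Finite J x z) h) (v, y)
      = (\<Sum>j<J. measure (Q (x l)) {z j} * (\<Sum>k<J. B $$ (j, k) * h (v, x k)))"
    unfolding l(2) Q_op_finite[OF l(1)] by (intro sum.cong) (simp_all del: Q_inv.simps add: Q_inv_finite)
  also have "\<dots> = (\<Sum>k<J. (\<Sum>j<J. measure (Q (x l)) {z j} * B $$ (j, k)) * h (v, x k))"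
    unfolding sum_distrib_left sum_distrib_right by (subst sum.swap) (simp add: mult.assoc)
  also have "\<dots> = (\<Sum>k<J. (if l = k then 1 else 0) * h (v, x k))"
    by (intro sum.cong) (simp_all add: Q_B[OF l(1)])
  also have "\<dots> = h (v, y)" using l by (simp add: if_distrib[of "\<lambda>a. a * _"] cong: if_cong)
  finally show ?thesis .
qed

text \<open>A row of \<open>B\<close> combines the values of h at all points of the space of X, so
  the equation is required on the whole fibre over v.\<close>

lemma Q_inv_Q_op_finite:
  assumes "y \<in> space MZ" and h: "\<And>a. a \<in> space MX \<Longrightarrow> h (v, a) = Q_op Q k (v, a)"
  shows "Q_inv Q (Finite J x z) h (v, y) = k (v, y)"
proof -
  obtain i where i: "i < J" "y = z i" using assms z(1) by (auto simp: bij_betw_def)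
  have "Q_inv Q (Finite J x z) h (v, y)
      = (\<Sum>l<J. B $$ (i, l) * (\<Sum>j<J. measure (Q (x l)) {z j} * k (v, z j)))"
    unfolding i(2) Q_inv_finite[OF i(1)] by (intro sum.cong) (simp_all add: h x_in Q_op_finite)
  also have "\<dots> = (\<Sum>j<J. (\<Sum>l<J. B $$ (i, l) * measure (Q (x l)) {z j}) * k (v, z j))"
    unfolding sum_distrib_left sum_distrib_right by (subst sum.swap) (simp add: mult.assoc)
  also have "\<dots> = (\<Sum>j<J. (if i = j then 1 else 0) * k (v, z j))"
    by (intro sum.cong) (simp_all add: B_Q[OF i(1)])
  also have "\<dots> = k (v, y)" using i by (simp add: if_distrib[of "\<lambda>a. a * _"] cong: if_cong)
  finally show ?thesis .
qed

lemma Q_inv_finite_measurable: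
  assumes h: "h \<in> borel_measurable (MV \<Otimes>\<^sub>M MX)"
  shows "Q_inv Q (Finite J x z) h \<in> borel_measurable (MV \<Otimes>\<^sub>M MZ)"
proof -
  have "(\<lambda>w. \<Sum>k<J. B $$ (the_inv_into {..<J} z (snd w), k) * h (fst w, x k)) \<in> borel_measurable (MV \<Otimes>\<^sub>M MZ)"
  proof (intro borel_measurable_sum borel_measurable_times)
    fix k assume k: "k \<in> {..<J}"
    have "(\<lambda>y. B $$ (the_inv_into {..<J} z y, k)) \<in> borel_measurable MZ"
      by (simp add: measurable_def z(2))
    then show "(\<lambda>w. B $$ (the_inv_into {..<J} z (snd w), k)) \<in> borel_measurable (MV \<Otimes>\<^sub>M MZ)"
      by (rule measurable_compose[OF measurable_snd])
    have "(\<lambda>v. h (v, x k)) \<in> borel_measurable MV"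
      using measurable_compose[OF measurable_Pair2'[OF x_in] h] k by simp
    then show "(\<lambda>w. h (fst w, x k)) \<in> borel_measurable (MV \<Otimes>\<^sub>M MZ)"
      by (rule measurable_compose[OF measurable_fst])
  qed
  then show ?thesis by (simp add: split_beta' B_def)
qed

context
  fixes P :: "('v \<times> 'x) measure"
  assumes P: "P \<in> space (prob_algebra (MV \<Otimes>\<^sub>M MX))"
begin

text \<open>Equality under the marginal of V times counting measure means equality on the whole
  fibre for almost every v. As \<open>P\<close> and the law of (V, Z) share the marginal of V, the
  pointwise inversion formula applies under the latter.\<close>

lemma Q_inv_Q_op_AE_finite:
  assumes k: "k \<in> L2 (P \<bind> K)" and h: "h \<in> borel_measurable (MV \<Otimes>\<^sub>M MX)"
    and eq: "inv_equal MV MX P (Finite J x z) h (Q_op Q k)"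
  shows "AE w in P \<bind> K. Q_inv Q (Finite J x z) h w = k w"
    and "h \<in> inv_domain MV MZ Q P (Finite J x z)"
    and "AE w in P. h w = Q_op Q k w"
proof -
  interpret PV: prob_space "distr P MV fst"
    by (rule prob_space.prob_space_distr[OF prob_P[OF P] fst_measurable_P[OF P]])
  have "finite (space MX)" using x(1) bij_betw_finite by blast
  then interpret C: sigma_finite_measure "count_space (space MX)"
    by (rule sigma_finite_measure_count_space_finite)
  interpret PC: pair_sigma_finite "distr P MV fst" "count_space (space MX)" ..
  have "AE v in distr P MV fst. AE a in count_space (space MX). h (v, a) = Q_op Q k (v, a)"
    using eq by (intro PC.AE_pair) simp
  then have V: "AE v in distr P MV fst. \<forall>a\<in>space MX. h (v, a) = Q_op Q k (v, a)"
    by (simp add: AE_count_space)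
  have "AE w in P. \<forall>a\<in>space MX. h (fst w, a) = Q_op Q k (fst w, a)"
    by (rule AE_distrD[OF fst_measurable_P[OF P] V])
  then show e: "AE w in P. h w = Q_op Q k w"
    using AE_space by eventually_elim (auto simp: space_P_pair[OF P])
  have "AE w in P \<bind> K. \<forall>a\<in>space MX. h (fst w, a) = Q_op Q k (fst w, a)"
    by (rule AE_distrD[OF fst_measurable_PK[OF P]]) (unfold distr_fst_bind[OF P], rule V)
  then show e': "AE w in P \<bind> K. Q_inv Q (Finite J x z) h w = k w"
    using AE_space
  proof eventually_elim
    case (elim w)
    then obtain v y where w: "w = (v, y)" "y \<in> space MZ"
      by (auto simp: space_bind_kernel[OF sets_P[OF P]] space_pair_measure)
    show ?case unfolding w(1) by (rule Q_inv_Q_op_finite[OF w(2)]) (use elim(1) w in auto)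
  qed
  have "h \<in> L2 P"
  proof (rule L2_AE_cong[OF Q_op_L2[OF P k]])
    show "h \<in> borel_measurable P" using h by (simp cong: measurable_cong_sets add: sets_P[OF P])
    show "AE w in P. Q_op Q k w = h w" using e by eventually_elim simp
  qed
  moreover have "Q_inv Q (Finite J x z) h \<in> L2 (P \<bind> K)"
  proof (rule L2_AE_cong[OF k])
    show "Q_inv Q (Finite J x z) h \<in> borel_measurable (P \<bind> K)"
      by (rule iffD2[OF measurable_bind_kernel[OF sets_P[OF P]] Q_inv_finite_measurable[OF h]])
    show "AE w in P \<bind> K. k w = Q_inv Q (Finite J x z) h w" using e' by eventually_elim simp
  qed
  ultimately show "h \<in> inv_domain MV MZ Q P (Finite J x z)" by (simp add: law_VZ_eq)
qed

text \<open>The inverse may fail to map L2 to L2, but it maps bounded functions to bounded ones: the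
  image of an indicator is at most the sum of the absolute entries of \<open>B\<close>.\<close>

lemma indicator_inv_domain_finite:
  assumes E: "E \<in> sets (MV \<Otimes>\<^sub>M MX)"
  shows "indicator E \<in> inv_domain MV MZ Q P (Finite J x z)"
proof -
  have m: "(indicator E :: _ \<Rightarrow> real) \<in> borel_measurable (MV \<Otimes>\<^sub>M MX)" using E by simp
  interpret PK: prob_space "P \<bind> K" by (rule prob_PK[OF P])
  interpret P: prob_space P by (rule prob_P[OF P])
  have "(indicator E :: _ \<Rightarrow> real) \<in> L2 P"
    using E by (intro L2_indicator P.finite_measure_axioms) (simp add: sets_P[OF P])
  moreover have "Q_inv Q (Finite J x z) (indicator E) \<in> L2 (P \<bind> K)" (is "?g \<in> _")
  proof -
    have [measurable]: "?g \<in> borel_measurable (P \<bind> K)"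
      by (rule iffD2[OF measurable_bind_kernel[OF sets_P[OF P]] Q_inv_finite_measurable[OF m]])
    let ?c = "\<Sum>i<J. \<Sum>k<J. \<bar>B $$ (i, k)\<bar>"
    have "\<bar>?g w\<bar> \<le> ?c" if w: "w \<in> space (P \<bind> K)" for w
    proof -
      obtain v y where "w = (v, y)" "y \<in> z ` {..<J}"
        using w z(1) by (auto simp: space_bind_kernel[OF sets_P[OF P]] space_pair_measure bij_betw_def)
      then obtain i where vi: "w = (v, z i)" "i < J" by auto
      have "\<bar>?g w\<bar> \<le> (\<Sum>k<J. \<bar>B $$ (i, k) * indicator E (v, x k)\<bar>)"
        unfolding vi(1) Q_inv_finite[OF vi(2)] by (rule sum_abs)
      also have "\<dots> \<le> (\<Sum>k<J. \<bar>B $$ (i, k)\<bar>)"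
        by (intro sum_mono) (auto simp: indicator_def)
      also have "\<dots> \<le> ?c"
        using vi(2) by (intro member_le_sum[where f = "\<lambda>i. \<Sum>k<J. \<bar>B $$ (i, k)\<bar>"]) (auto intro: sum_nonneg)
      finally show ?thesis .
    qed
    then have "AE w in P \<bind> K. norm ((?g w)\<^sup>2) \<le> ?c\<^sup>2"
      by (intro AE_I2) (simp add: abs_le_square_iff[symmetric] sum_nonneg)
    then have "integrable (P \<bind> K) (\<lambda>w. (?g w)\<^sup>2)"
      by (rule PK.integrable_const_bound) measurable
    then show ?thesis by (simp del: Q_inv.simps add: L2_def)
  qed
  ultimately show ?thesis by (simp add: law_VZ_eq)
qed

end

end

section \<open>Inversion for both classes of mechanisms\<close>

text \<open>The interface through which the two classes enter what follows; beyond it only the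
  presentation R is visible. Indicators belong to the domain so that the inverse can identify the
  law of (V, X).\<close>

lemma (in mechanism)
  assumes R: "presents MX MZ Q R" and P: "P \<in> space (prob_algebra (MV \<Otimes>\<^sub>M MX))"
  shows Q_inv_Q_op:
      "\<lbrakk>k \<in> L2 (law_VZ MV MZ Q P); h \<in> borel_measurable (MV \<Otimes>\<^sub>M MX); inv_equal MV MX P R h (Q_op Q k)\<rbrakk> \<Longrightarrow>
         AE w in law_VZ MV MZ Q P. Q_inv Q R h w = k w"
    and inv_domain_if_inv_equal:
      "\<lbrakk>k \<in> L2 (law_VZ MV MZ Q P); h \<in> borel_measurable (MV \<Otimes>\<^sub>M MX); inv_equal MV MX P R h (Q_op Q k)\<rbrakk> \<Longrightarrow>
         h \<in> inv_domain MV MZ Q P R"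
    and Q_op_Q_inv: "h \<in> inv_domain MV MZ Q P R \<Longrightarrow> AE w in P. Q_op Q (Q_inv Q R h) w = h w"
    and Q_inv_L2: "h \<in> inv_domain MV MZ Q P R \<Longrightarrow> Q_inv Q R h \<in> L2 (law_VZ MV MZ Q P)"
    and indicator_inv_domain: "E \<in> sets (MV \<Otimes>\<^sub>M MX) \<Longrightarrow> indicator E \<in> inv_domain MV MZ Q P R"
proof -
  have "(k \<in> L2 (law_VZ MV MZ Q P) \<longrightarrow> h \<in> borel_measurable (MV \<Otimes>\<^sub>M MX) \<longrightarrow> inv_equal MV MX P R h (Q_op Q k) \<longrightarrow>
         (AE w in law_VZ MV MZ Q P. Q_inv Q R h w = k w) \<and> h \<in> inv_domain MV MZ Q P R) \<and>
    (h \<in> inv_domain MV MZ Q P R \<longrightarrow>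
       (AE w in P. Q_op Q (Q_inv Q R h) w = h w) \<and> Q_inv Q R h \<in> L2 (law_VZ MV MZ Q P)) \<and>
    (E \<in> sets (MV \<Otimes>\<^sub>M MX) \<longrightarrow> indicator E \<in> inv_domain MV MZ Q P R)" for k h E
  proof (cases R)
    case (Finite J x z)
    interpret finite_mechanism MV MX MZ Q J x z
      using R Finite by unfold_locales simp
    have "AE w in P. Q_op Q (Q_inv Q R h) w = h w"
      unfolding Finite by (intro AE_I2) (auto simp del: Q_inv.simps simp: space_P_pair[OF P] Q_op_Q_inv_finite)
    then show ?thesis
      using Q_inv_Q_op_AE_finite[OF P, of k h] indicator_inv_domain_finite[OF P, of E]
      unfolding Finite law_VZ_eq by (simp del: Q_inv.simps inv_equal.simps add: law_VZ_eq)
  next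
    case (Mixture \<alpha> Qbar)
    interpret mixture_mechanism MV MX MZ Q \<alpha> Qbar
      using R Mixture by unfold_locales simp
    interpret PK: prob_space "P \<bind> mech_kernel MV MZ Q" by (rule prob_PK[OF P])
    have "indicator E \<in> L2 (P \<bind> mech_kernel MV MZ Q)" if "E \<in> sets (MV \<Otimes>\<^sub>M MX)"
      using that by (intro L2_indicator PK.finite_measure_axioms) (simp add: sets_bind_eq[OF P] sets_P[OF P])
    moreover have "AE w in P. Q_op Q (Q_inv Q R h) w = h w" if "h \<in> L2 (P \<bind> mech_kernel MV MZ Q)"
      unfolding Mixture using that by (intro Q_op_Q_inv_mixture[OF P]) (simp add: L2_bind_mixture[OF P])
    ultimately show ?thesis
      using Q_inv_Q_op_mixture[OF P, of k h] Q_inv_L2_mixture[OF P, of h]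
      unfolding Mixture law_VZ_eq inv_domain_mixture[OF P] by (simp del: Q_inv.simps inv_equal.simps)
  qed
  then show
      "\<lbrakk>k \<in> L2 (law_VZ MV MZ Q P); h \<in> borel_measurable (MV \<Otimes>\<^sub>M MX); inv_equal MV MX P R h (Q_op Q k)\<rbrakk> \<Longrightarrow>
         AE w in law_VZ MV MZ Q P. Q_inv Q R h w = k w"
      "\<lbrakk>k \<in> L2 (law_VZ MV MZ Q P); h \<in> borel_measurable (MV \<Otimes>\<^sub>M MX); inv_equal MV MX P R h (Q_op Q k)\<rbrakk> \<Longrightarrow>
         h \<in> inv_domain MV MZ Q P R"
      "h \<in> inv_domain MV MZ Q P R \<Longrightarrow> AE w in P. Q_op Q (Q_inv Q R h) w = h w"
      "h \<in> inv_domain MV MZ Q P R \<Longrightarrow> Q_inv Q R h \<in> L2 (law_VZ MV MZ Q P)"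
      "E \<in> sets (MV \<Otimes>\<^sub>M MX) \<Longrightarrow> indicator E \<in> inv_domain MV MZ Q P R"
    by blast+
qed

context mechanism
begin

text \<open>\<open>P E = \<integral> 1\<^sub>E dP = \<integral> Q_op (Q_inv 1\<^sub>E) dP = \<integral> Q_inv 1\<^sub>E dP\<^sub>V\<^sub>Z\<close>, and the last
  integrand does not involve \<open>P\<close>.\<close>

lemma measure_eq_integral_Q_inv:
  assumes R: "presents MX MZ Q R" and P: "P \<in> space (prob_algebra (MV \<Otimes>\<^sub>M MX))"
    and E: "E \<in> sets (MV \<Otimes>\<^sub>M MX)"
  shows "measure P E = (\<integral>w. Q_inv Q R (indicator E) w \<partial>(P \<bind> mech_kernel MV MZ Q))"
proof -
  let ?K = "mech_kernel MV MZ Q" and ?k = "Q_inv Q R (indicator E)"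
  note dom = indicator_inv_domain[OF R P E]
  have kL: "?k \<in> L2 (P \<bind> ?K)" using Q_inv_L2[OF R P dom] by (simp only: law_VZ_eq)
  have km: "?k \<in> borel_measurable (MV \<Otimes>\<^sub>M MZ)"
    by (rule iffD1[OF measurable_bind_kernel[OF sets_P[OF P]] L2_measurable[OF kL]])
  have "(\<integral>w. ?k w \<partial>(P \<bind> ?K)) = (\<integral>y. (\<integral>w. ?k w \<partial>?K y) \<partial>P)"
    by (rule integral_bind_kernel[OF sets_P[OF P] L2_integrable[OF finite_PK[OF P] kL]])
  also have "\<dots> = (\<integral>y. indicator E y \<partial>P)"
  proof (rule integral_cong_AE)
    show "AE y in P. (\<integral>w. ?k w \<partial>?K y) = indicator E y"
      using Q_op_Q_inv[OF R P dom] AE_space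
      by eventually_elim (auto simp: space_P_pair[OF P] integral_mech_kernel[OF _ _ km])
    show "(\<lambda>y. \<integral>w. ?k w \<partial>?K y) \<in> borel_measurable P"
      by (rule L2_measurable[OF integral_kernel_L2[OF P kL]])
    show "(indicator E :: _ \<Rightarrow> real) \<in> borel_measurable P"
      by (rule borel_measurable_indicator) (use E in \<open>simp add: sets_P[OF P]\<close>)
  qed
  also have "\<dots> = measure P E" using E by (simp add: sets_P[OF P])
  finally show ?thesis by simp
qed

text \<open>The preceding formula expresses every probability under \<open>P\<close> through the law
  of (V, Z). Injectivity makes \<open>inv_into\<close> in \<open>psi\<close> the recovery map for
  every model contained in the set of all laws.\<close>

lemma law_VZ_inj:
  assumes R: "presents MX MZ Q R"
  shows "inj_on (\<lambda>P. P \<bind> mech_kernel MV MZ Q) (space (prob_algebra (MV \<Otimes>\<^sub>M MX)))"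
proof (rule inj_onI)
  fix P P' assume P: "P \<in> space (prob_algebra (MV \<Otimes>\<^sub>M MX))" and P': "P' \<in> space (prob_algebra (MV \<Otimes>\<^sub>M MX))"
    and eq: "P \<bind> mech_kernel MV MZ Q = P' \<bind> mech_kernel MV MZ Q"
  interpret P: prob_space P by (rule prob_P[OF P])
  interpret P': prob_space P' by (rule prob_P[OF P'])
  show "P = P'"
  proof (rule measure_eqI)
    show "sets P = sets P'" by (simp add: sets_P[OF P] sets_P[OF P'])
    fix E assume "E \<in> sets P"
    then have E: "E \<in> sets (MV \<Otimes>\<^sub>M MX)" by (simp add: sets_P[OF P])
    have "measure P E = measure P' E"
      by (simp only: measure_eq_integral_Q_inv[OF R P E] measure_eq_integral_Q_inv[OF R P' E] eq)
    then show "emeasure P E = emeasure P' E"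
      by (simp add: P.emeasure_eq_measure P'.emeasure_eq_measure)
  qed
qed

end

section \<open>Efficient influence functions under privacy mechanisms\<close>

theorem theorem2:
  fixes I :: "'i set" and MV :: "'i \<Rightarrow> 'v measure" and MX MZ :: "'x measure"
    and Q :: "'x \<Rightarrow> 'x measure"
    and \<M> :: "(('i \<Rightarrow> 'v) \<times> 'x) measure set"
    and S :: "(real \<Rightarrow> (('i \<Rightarrow> 'v) \<times> 'x) measure) set"
    and P :: "(('i \<Rightarrow> 'v) \<times> 'x) measure"
    and \<kappa> :: "(('i \<Rightarrow> 'v) \<times> 'x) measure \<Rightarrow> real"
    and \<phi> :: "('i \<Rightarrow> 'v) \<times> 'x \<Rightarrow> real"
    and I1 I2 :: "'i set" and c :: "'i \<Rightarrow> 'v"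
    and m g :: "('i \<Rightarrow> 'v) \<times> 'x \<Rightarrow> real"
    and \<mu>X :: "(('i \<Rightarrow> 'v) \<times> 'x) measure \<Rightarrow> ('i \<Rightarrow> 'v) \<times> 'x \<Rightarrow> real"
    and \<Gamma> :: "real set"
    and f f' f'' :: "('i \<Rightarrow> 'v) \<times> 'x \<Rightarrow> (('i \<Rightarrow> 'v) \<times> 'x \<Rightarrow> real) \<Rightarrow> real \<Rightarrow> real"
    and r :: "('i \<Rightarrow> 'v) \<times> 'x \<Rightarrow> real"
    and R :: "'x presentation"
  assumes "Q \<in> mech_psi MX MZ" and "presents MX MZ Q R"
    and "\<M> \<subseteq> space (prob_algebra (PiM I MV \<Otimes>\<^sub>M MX))" and "P \<in> \<M>"
    and "efficient_influence_function \<M> S P \<kappa> \<phi>"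
  shows
    "(\<phi> \<in> Q_op_adj_image (PiM I MV) MX MZ Q P R (tangent_set P S) \<longrightarrow>
        efficient_influence_function
          (law_VZ (PiM I MV) MZ Q ` \<M>) (induced_submodels (PiM I MV) MZ Q S)
          (law_VZ (PiM I MV) MZ Q P) (psi (PiM I MV) MZ Q \<M> \<kappa>)
          (Q_inv Q R \<phi>))
     \<and>
     (\<M> = space (prob_algebra (PiM I MV \<Otimes>\<^sub>M MX)) \<and> tangent_set P S = L2_0 P \<and>
      target_parameter I MV MX P I1 I2 c m g (\<mu>X P) \<Gamma> f f' f'' r \<and>
      (\<forall>P'\<in>\<M>. cond_exp_version P' (PiM I1 MV \<Otimes>\<^sub>M MX) (V1X I1) m (\<mu>X P')) \<and>
      (\<forall>P'\<in>\<M>. \<kappa> P' = target_functional I2 c g \<mu>X f P') \<and>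
      (AE w in P. \<phi> w = chi_tilde P I1 I2 c m g \<mu>X f f' r w) \<and>
      chi_tilde P I1 I2 c m g \<mu>X f f' r \<in> inv_domain (PiM I MV) MZ Q P R \<and>
      inv_respects_AE (PiM I MV) MZ Q P R \<longrightarrow>
        efficient_influence_function
          (law_VZ (PiM I MV) MZ Q ` \<M>) (induced_submodels (PiM I MV) MZ Q S)
          (law_VZ (PiM I MV) MZ Q P) (psi (PiM I MV) MZ Q \<M> \<kappa>)
          (Q_inv Q R (chi_tilde P I1 I2 c m g \<mu>X f f' r)))"
proof -
  \<comment> \<open>The kernel results concern an arbitrary space for V; the product space enters
    them as a single symbol.\<close>
  define MVI where "MVI = PiM I MV"
  let ?N = "MVI \<Otimes>\<^sub>M MX" and ?L = "law_VZ MVI MZ Q"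
  let ?K = "mech_kernel MVI MZ Q"
  have P: "P \<in> space (prob_algebra ?N)" using assms(3,4) by (auto simp: MVI_def)
  then have "prob_space P" "sets P = sets ?N" by (auto simp: space_prob_algebra)
  \<comment> \<open>A probability law lives on a nonempty space, which supplies the nonemptiness
    assumptions of \<open>mechanism\<close>.\<close>
  then have "space ?N \<noteq> {}"
    using prob_space.not_empty[of P] sets_eq_imp_space_eq[of P ?N] by simp
  moreover have "Q \<in> MX \<rightarrow>\<^sub>M prob_algebra MZ" using assms(2) by (cases R) auto
  ultimately interpret mechanism MVI MX MZ Q
    by unfold_locales (auto simp: space_pair_measure)
  have \<M>: "\<M> \<subseteq> space (prob_algebra ?N)" using assms(3) by (simp add: MVI_def)
  have L: "?L = (\<lambda>P. P \<bind> ?K)" by (simp add: fun_eq_iff law_VZ_eq)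
  have L': "law_VZ MVI MZ Q P = P \<bind> ?K" for P by (simp add: law_VZ_eq)
  have \<phi>: "\<phi> \<in> closed_lin_span P (tangent_set P S)" and \<phi>L: "\<phi> \<in> L2 P"
    and reg: "\<forall>p\<in>S. regular_submodel \<M> P p"
    using assms(5) by (auto simp: efficient_influence_function_def closed_lin_span_def)
  have \<phi>m: "\<phi> \<in> borel_measurable ?N"
    using L2_measurable[OF \<phi>L] by (simp cong: measurable_cong_sets add: sets_P[OF P])
  have finP: "finite_measure P" using prob_P[OF P] by (rule prob_space.finite_measure)
  have measurable_N': "k \<in> borel_measurable (MVI \<Otimes>\<^sub>M MZ)" if "k \<in> L2 (P \<bind> ?K)" for k
    by (rule iffD1[OF measurable_bind_kernel[OF sets_P[OF P]] L2_measurable[OF that]])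
  have Q_op_eq: "Q_op Q k w = (\<integral>z. k z \<partial>?K w)" if "k \<in> L2 (P \<bind> ?K)" "w \<in> space P" for k w
    using measurable_N'[OF that(1)] that(2) by (auto simp: space_P_pair[OF P] integral_mech_kernel)
  have inj: "inj_on (\<lambda>P. P \<bind> ?K) \<M>"
    by (rule inj_on_subset[OF law_VZ_inj[OF assms(2)] \<M>])
  have S': "induced_submodels MVI MZ Q S = (\<lambda>p t. p t \<bind> ?K) ` S"
    by (simp add: induced_submodels_def L')
  \<comment> \<open>What the two parts share: it suffices to exhibit k in the closed span of the
    induced scores with \<open>Q_op\<close> image \<phi>. The parts differ in how membership in the
    closed span is obtained.\<close>
  have transfer: "efficient_influence_function (?L ` \<M>) (induced_submodels MVI MZ Q S) (?L P)
      (psi MVI MZ Q \<M> \<kappa>) k"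
    if k: "k \<in> closed_lin_span (P \<bind> ?K) (tangent_set (P \<bind> ?K) ((\<lambda>p t. p t \<bind> ?K) ` S))"
      and k\<phi>: "AE w in P. \<phi> w = Q_op Q k w" for k
    unfolding psi_def S' L
  proof (rule efficient_influence_function_kernel[OF \<M> assms(4,5) inj k])
    have kL: "k \<in> L2 (P \<bind> ?K)" using k by (simp add: closed_lin_span_def)
    show "AE w in P. \<phi> w = (\<integral>z. k z \<partial>?K w)"
      using k\<phi> AE_space by eventually_elim (simp only: Q_op_eq[OF kL])
  qed
  have tangent: "k \<in> tangent_set (P \<bind> ?K) ((\<lambda>p t. p t \<bind> ?K) ` S)"
    if "s \<in> tangent_set P S" "kernel_adj P s k" for s k
    by (rule kernel_adj_tangent_set[OF P \<M> reg that])
  have tangent_L2: "T \<subseteq> L2 P'" if "T = tangent_set P' S'" for T P' and S' :: "(real \<Rightarrow> (('i \<Rightarrow> 'v) \<times> 'x) measure) set"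
    using that by (auto simp: tangent_set_def dqm_def L2_0_def)
  show ?thesis
    unfolding MVI_def[symmetric]
  proof (intro conjI impI)
    assume "\<phi> \<in> Q_op_adj_image MVI MX MZ Q P R (tangent_set P S)"
    then obtain s k where s: "s \<in> tangent_set P S" and k: "k \<in> Q_adj MVI MX MZ Q P s"
      and eq: "inv_equal MVI MX P R \<phi> (Q_op Q k)"
      by (auto simp: Q_op_adj_image_def)
    have sL: "s \<in> L2 P" using s tangent_L2[OF refl] by auto
    have adj: "kernel_adj P s k" by (rule Q_adj_kernel_adj[OF P L2_integrable[OF finP sL] k])
    have kL: "k \<in> L2 (P \<bind> ?K)" by (rule kernel_adj_L2[OF P sL adj])
    note inv = Q_inv_Q_op[OF assms(2) P, unfolded L', OF kL \<phi>m eq]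
      inv_domain_if_inv_equal[OF assms(2) P, unfolded L', OF kL \<phi>m eq]
    have iL: "Q_inv Q R \<phi> \<in> L2 (P \<bind> ?K)" using Q_inv_L2[OF assms(2) P inv(2)] by (simp only: L')
    \<comment> \<open>The inverse undoes \<open>Q_op\<close> and leaves the conditional expectation
      k of s, up to a null set; hence it is a score of the image of a path with score s.\<close>
    have "kernel_adj P s (Q_inv Q R \<phi>)"
      by (rule kernel_adj_AE_cong[OF P adj measurable_N'[OF iL] inv(1)])
    from tangent[OF s this] iL
    have "Q_inv Q R \<phi> \<in> closed_lin_span (P \<bind> ?K) (tangent_set (P \<bind> ?K) ((\<lambda>p t. p t \<bind> ?K) ` S))"
      by (intro closed_lin_spanI tangent_L2[OF refl]) (auto intro!: bexI[of _ "Q_inv Q R \<phi>"])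
    moreover have "AE w in P. \<phi> w = Q_op Q (Q_inv Q R \<phi>) w"
      using Q_op_Q_inv[OF assms(2) P inv(2)] by eventually_elim simp
    ultimately show "efficient_influence_function (?L ` \<M>) (induced_submodels MVI MZ Q S) (?L P)
      (psi MVI MZ Q \<M> \<kappa>) (Q_inv Q R \<phi>)" by (rule transfer)
  next
    let ?\<chi> = "chi_tilde P I1 I2 c m g \<mu>X f f' r"
    let ?k = "Q_inv Q R ?\<chi>"
    assume asm: "\<M> = space (prob_algebra ?N) \<and> tangent_set P S = L2_0 P \<and>
      target_parameter I MV MX P I1 I2 c m g (\<mu>X P) \<Gamma> f f' f'' r \<and>
      (\<forall>P'\<in>\<M>. cond_exp_version P' (PiM I1 MV \<Otimes>\<^sub>M MX) (V1X I1) m (\<mu>X P')) \<and>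
      (\<forall>P'\<in>\<M>. \<kappa> P' = target_functional I2 c g \<mu>X f P') \<and>
      (AE w in P. \<phi> w = ?\<chi> w) \<and>
      ?\<chi> \<in> inv_domain MVI MZ Q P R \<and> inv_respects_AE MVI MZ Q P R"
    then have T: "tangent_set P S = L2_0 P" and ae: "AE w in P. \<phi> w = ?\<chi> w"
      and dom: "?\<chi> \<in> inv_domain MVI MZ Q P R" and resp: "inv_respects_AE MVI MZ Q P R"
      by blast+
    have kL: "?k \<in> L2 (P \<bind> ?K)" using Q_inv_L2[OF assms(2) P dom] by (simp only: L')
    have k\<phi>: "AE w in P. \<phi> w = Q_op Q ?k w"
      using Q_op_Q_inv[OF assms(2) P dom] ae by eventually_elim simp
    \<comment> \<open>Approximation by image scores is available for mean-zero functions only; mean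
      zero is inherited from \<phi> because \<open>Q_op\<close> preserves means.\<close>
    have "\<phi> \<in> L2_0 P" using \<phi> unfolding T by (rule closed_lin_span_L2_0[OF prob_P[OF P]])
    have "(\<integral>z. ?k z \<partial>(P \<bind> ?K)) = (\<integral>w. (\<integral>z. ?k z \<partial>?K w) \<partial>P)"
      by (rule integral_bind_kernel[OF sets_P[OF P] L2_integrable[OF finite_PK[OF P] kL]])
    also have "\<dots> = (\<integral>w. \<phi> w \<partial>P)"
    proof (rule integral_cong_AE)
      show "AE w in P. (\<integral>z. ?k z \<partial>?K w) = \<phi> w"
        using k\<phi> AE_space by eventually_elim (simp only: Q_op_eq[OF kL])
    qed (use L2_measurable[OF integral_kernel_L2[OF P kL]] L2_measurable[OF \<phi>L] in auto)
    also have "\<dots> = 0" using \<open>\<phi> \<in> L2_0 P\<close> by (simp add: L2_0_def)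
    finally have k0: "?k \<in> L2_0 (P \<bind> ?K)" using kL by (simp add: L2_0_def)
    \<comment> \<open>If \<open>Q_op Q h\<close> vanishes almost everywhere, h is still what
      \<open>Q_inv\<close> makes of it. That this forces h to vanish is where
      \<open>inv_respects_AE\<close> enters, as \<open>P\<close> need not charge all the points that
      \<open>Q_inv\<close> reads.\<close>
    have triv: "AE z in P \<bind> ?K. h z = 0"
      if h: "h \<in> L2 (P \<bind> ?K)" and zero: "AE w in P. (\<integral>z. h z \<partial>?K w) = 0" for h
    proof -
      have refl: "inv_equal MVI MX P R (Q_op Q h) (Q_op Q h)" by (cases R) auto
      note inv = Q_inv_Q_op[OF assms(2) P, unfolded L', OF h Q_op_measurable[OF measurable_N'[OF h]] refl]
        inv_domain_if_inv_equal[OF assms(2) P, unfolded L', OF h Q_op_measurable[OF measurable_N'[OF h]] refl]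
      have "AE w in P. Q_op Q h w = 0"
        using zero AE_space by eventually_elim (simp only: Q_op_eq[OF h])
      then have "AE z in P \<bind> ?K. Q_inv Q R (Q_op Q h) z = 0"
        using resp[unfolded inv_respects_AE_def, THEN bspec, OF inv(2)] unfolding L' by blast
      then show ?thesis using inv(1) by eventually_elim simp
    qed
    have "?k \<in> closed_lin_span (P \<bind> ?K) (tangent_set (P \<bind> ?K) ((\<lambda>p t. p t \<bind> ?K) ` S))"
    proof (rule closed_lin_spanI[OF kL tangent_L2[OF refl]])
      fix \<epsilon> :: real assume "0 < \<epsilon>"
      from kernel_adj_dense[OF P triv k0 this] obtain s h where
        "s \<in> L2_0 P" "kernel_adj P s h" "(\<integral>z. (?k z - h z)\<^sup>2 \<partial>(P \<bind> ?K)) < \<epsilon>" by blast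
      \<comment> \<open>Every mean-zero s is the score of some path in S, so each approximant is the
        score of an induced path.\<close>
      then show "\<exists>h\<in>tangent_set (P \<bind> ?K) ((\<lambda>p t. p t \<bind> ?K) ` S). (\<integral>z. (?k z - h z)\<^sup>2 \<partial>(P \<bind> ?K)) < \<epsilon>"
        using tangent unfolding T by blast
    qed
    then show "efficient_influence_function (?L ` \<M>) (induced_submodels MVI MZ Q S) (?L P)
      (psi MVI MZ Q \<M> \<kappa>) ?k" using k\<phi> by (rule transfer)
  qed
qed

end
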